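(* For $n\ge 1$ and $i\ge 1$ let $B_{n,i}$ be the number of blocks of length $i$ in a uniformly random game with $n$ pairs of cards. Then, as $n\to\infty$, $$\frac1{\sqrt n}\left(B_{n,i}-\frac{4n}{(i+2)_3}\right)_{i=1}^\infty\stackrel{d}{\longrightarrow}\big(W_i\big)_{i=1}^\infty,$$ where $(W_i)_{i\ge1}$ are jointly Gaussian with mean zero and covariance matrix $\Sigma=[\sigma_{ij}]$ given by $$\sigma_{ij}=\begin{cases}\dfrac{16}{(i+2)_3(j+2)_3}-\dfrac{24}{(i+j+2)_4}, & i\neq j,\\[2mm] \dfrac{4}{(j+2)_3}+\dfrac{16}{\big((j+2)_3\big)^2}-\dfrac{24}{(2j+2)_4}, & i=j.\end{cases}$$
   Context: Cards and games: there are $n$ labels $1,\dots,n$, and for each label two cards, a blue copy and a red copy. A game with $n$ pairs of cards is an arrangement (permutation) of these $2n$ cards in a row, from left to right, such that for each label the blue card precedes the red card with the same label. $\mathcal{T}_n$ is the set of all such arrangements, so $|\mathcal{T}_n|=(2n)!/2^n$. A (uniformly) random game is a uniformly random element of $\mathcal{T}_n$. Blocks: the red cards partition an arrangement into $n$ disjoint blocks of consecutive cards; for $1\le k\le n$ the $k$-th block ends with the $k$-th red card from the left (the first block starts at the first card, and the $k$-th block for $k\ge 2$ starts right after the $(k-1)$-st red card). The length of a block is the number of cards it contains. $(m)_k=m(m-1)\cdots(m-k+1)$ denotes the falling factorial; in particular $(i+2)_3=i(i+1)(i+2)$. $\stackrel{d}{\to}$ denotes convergence in distribution (joint convergence of the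 infinite sequence, i.e. in $\mathbb{R}^\infty$ with the product topology). *)

theory Defs
  imports "HOL-Probability.Probability" "HOL-Combinatorics.Multiset_Permutations"
begin

subsection \<open>Games and blocks\<close>

datatype colour = Blue | Red

type_synonym card = "nat \<times> colour"

definition games :: "nat \<Rightarrow> card list set" where
  "games n = {xs \<in> permutations_of_set ({1..n} \<times> {Blue, Red}).
     \<forall>l\<in>{1..n}. \<exists>a b. a < b \<and> b < length xs \<and> xs ! a = (l, Blue) \<and> xs ! b = (l, Red)}"

definition random_game :: "nat \<Rightarrow> card list pmf" where
  "random_game n = pmf_of_set (games n)"

text \<open>The blocks are numbered from 1, as is \<open>k\<close> here, whereas list positions are counted from 0.\<close>

definition red_position :: "card list \<Rightarrow> nat \<Rightarrow> nat" where
  "red_position xs k = filter (\<lambda>p. snd (xs ! p) = Red) [0..<length xs] ! (k - 1)"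

definition block :: "card list \<Rightarrow> nat \<Rightarrow> card list" where
  "block xs k =
     drop (if k = 1 then 0 else Suc (red_position xs (k - 1))) (take (Suc (red_position xs k)) xs)"

definition num_blocks :: "nat \<Rightarrow> nat \<Rightarrow> card list \<Rightarrow> nat" where
  "num_blocks n i xs = card {k \<in> {1..n}. length (block xs k) = i}"

lemma finite_games: "finite (games n)"
  by (simp add: games_def)

text \<open>\<^const>\<open>pmf_of_set\<close> is only meaningful on finite nonempty sets.\<close>

lemma games_nonempty: "games n \<noteq> {}"
proof -
  have "\<exists>xs. xs \<in> games n"
  proof (induction n)
    case 0
    have "[] \<in> games 0" by (simp add: games_def)
    then show ?case by blast
  next
    case (Suc n)
    then obtain xs where xs: "xs \<in> games n" by blast
    define ys where "ys = xs @ [(Suc n, Blue), (Suc n, Red)]"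
    have set_xs: "set xs = {1..n} \<times> {Blue, Red}" and "distinct xs"
      using xs unfolding games_def permutations_of_set_def by blast+
    have "{1..Suc n} = insert (Suc n) {1..n}"
      by (simp add: atLeastAtMostSuc_conv insert_commute)
    then have "set ys = {1..Suc n} \<times> {Blue, Red}"
      using set_xs unfolding ys_def by auto
    moreover have "distinct ys"
      using \<open>distinct xs\<close> unfolding ys_def by (simp add: set_xs)
    ultimately have "ys \<in> permutations_of_set ({1..Suc n} \<times> {Blue, Red})"
      by (simp add: permutations_of_set_def)
    moreover have "\<exists>a b. a < b \<and> b < length ys \<and> ys ! a = (l, Blue) \<and> ys ! b = (l, Red)"
      if l: "l \<in> {1..Suc n}" for l
    proof (cases "l = Suc n")
      case True
      then show ?thesis
        by (intro exI[of _ "length xs"] exI[of _ "Suc (length xs)"]) (simp add: ys_def nth_append)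
    next
      case False
      with l have "l \<in> {1..n}" by simp
      then obtain a b where "a < b" "b < length xs" "xs ! a = (l, Blue)" "xs ! b = (l, Red)"
        using xs unfolding games_def by blast
      then show ?thesis
        by (intro exI[of _ a] exI[of _ b]) (simp add: ys_def nth_append)
    qed
    ultimately show ?case unfolding games_def by blast
  qed
  then show ?thesis by blast
qed


subsection \<open>Gaussian families and convergence in distribution\<close>

definition falling_factorial :: "real \<Rightarrow> nat \<Rightarrow> real" where
  "falling_factorial m k = (\<Prod>j<k. m - real j)"

text \<open>Degenerate (almost surely constant) normal variables are allowed, as needed for the linear
  combinations of a jointly Gaussian family.\<close>

definition gaussian :: "'a measure \<Rightarrow> ('a \<Rightarrow> real) \<Rightarrow> bool" where
  "gaussian M X \<longleftrightarrow> X \<in> borel_measurable M \<and>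
     (\<exists>\<mu>. (AE \<omega> in M. X \<omega> = \<mu>) \<or> (\<exists>\<sigma>>0. distributed M lborel X (normal_density \<mu> \<sigma>)))"

definition jointly_gaussian :: "'a measure \<Rightarrow> 'i set \<Rightarrow> ('i \<Rightarrow> 'a \<Rightarrow> real) \<Rightarrow> bool" where
  "jointly_gaussian M I W \<longleftrightarrow>
     (\<forall>J c. finite J \<and> J \<subseteq> I \<longrightarrow> gaussian M (\<lambda>\<omega>. \<Sum>i\<in>J. c i * W i \<omega>))"

definition covariance :: "'a measure \<Rightarrow> ('a \<Rightarrow> real) \<Rightarrow> ('a \<Rightarrow> real) \<Rightarrow> real" where
  "covariance M X Y =
     (\<integral>\<omega>. (X \<omega> - (\<integral>\<omega>. X \<omega> \<partial>M)) * (Y \<omega> - (\<integral>\<omega>. Y \<omega> \<partial>M)) \<partial>M)"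

text \<open>For values in \<^typ>\<open>nat \<Rightarrow> real\<close>, the topology of the function type is the product topology.\<close>

definition converges_in_distribution ::
  "(nat \<Rightarrow> 'a measure) \<Rightarrow> (nat \<Rightarrow> 'a \<Rightarrow> 'c::topological_space) \<Rightarrow> 'b measure \<Rightarrow> ('b \<Rightarrow> 'c) \<Rightarrow> bool"
where
  "converges_in_distribution M X N Y \<longleftrightarrow>
     (\<forall>n. X n \<in> borel_measurable (M n)) \<and> Y \<in> borel_measurable N \<and>
     (\<forall>f :: 'c \<Rightarrow> real. continuous_on UNIV f \<and> bounded (range f) \<longrightarrow>
        (\<lambda>n. \<integral>\<omega>. f (X n \<omega>) \<partial>M n) \<longlonglongrightarrow> (\<integral>\<omega>. f (Y \<omega>) \<partial>N))"

definition block_cov :: "nat \<Rightarrow> nat \<Rightarrow> real" where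
  "block_cov i j =
     (if i \<noteq> j then
        16 / (falling_factorial (real (i + 2)) 3 * falling_factorial (real (j + 2)) 3)
          - 24 / falling_factorial (real (i + j + 2)) 4
      else
        4 / falling_factorial (real (j + 2)) 3 + 16 / (falling_factorial (real (j + 2)) 3)\<^sup>2
          - 24 / falling_factorial (real (2 * j + 2)) 4)"

text \<open>A sequence indexed by \<open>i \<ge> 1\<close> is encoded as \<^typ>\<open>nat \<Rightarrow> real\<close>, with the entry of index
  \<open>i = Suc k\<close> at position \<open>k\<close>.\<close>

definition normalized_blocks :: "nat \<Rightarrow> card list \<Rightarrow> nat \<Rightarrow> real" where
  "normalized_blocks n xs = (\<lambda>k. let i = Suc k in
     (1 / sqrt (real n)) *
       (real (num_blocks n i xs) - 4 * real n / falling_factorial (real (i + 2)) 3))"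

end

theory Submission
  imports Defs "HOL-Combinatorics.Transposition"
begin

text \<open>A game with \<open>n + 1\<close> pairs arises from one with \<open>n\<close> pairs by inserting a blue card at one of
\<open>2 n + 1\<close> places and appending its red partner. For the block lengths this is a preferential
attachment process: a block of length \<open>l\<close> grows with probability \<open>l / (2 n + 1)\<close>, a new block of
length 1 appears, and insertion right before the new red card acts as if a virtual block of length 1
had grown (\<open>expectation_random_game_Suc\<close>).

Let \<open>D\<^sub>n(s)\<close> be the sum of \<open>s l\<close> over all block lengths \<open>l\<close>, minus its approximate mean
\<open>n (\<Sum>l. p\<^sub>l s l)\<close> with \<open>p\<^sub>l = 4 / (l (l + 1) (l + 2))\<close>. Given the past, the increment of \<open>D\<^sub>n(s)\<close>
has mean \<open>D\<^sub>n(A s) / (2 n + 1)\<close> up to an error of order \<open>1/n\<close>, where \<open>A\<close> is the linear operator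
\<open>drift\<close>, and its variance is close to a quadratic form \<open>q(s)\<close>. Hence the characteristic functions
\<open>\<psi>\<^sub>n(s) = E exp (\<i> D\<^sub>n(s))\<close> satisfy
\<open>\<psi>\<^sub>n\<^sub>+\<^sub>1(s) \<approx> (1 - q(s) / 2) \<psi>\<^sub>n(s + A s / (2 n + 1))\<close> (\<open>charf_Suc\<close>). The Gaussian functions
\<open>exp (- n \<sigma>(s, s) / 2)\<close> satisfy the same recursion (\<open>gauss_Suc\<close>) because the covariance form
\<open>\<sigma>\<close> of the theorem solves the Lyapunov equation \<open>\<sigma>(s, s) = \<sigma>(s, A s) + q(s)\<close>
(\<open>cov_form_lyapunov\<close>), an identity between rational functions that summation by parts proves. The
map \<open>s \<mapsto> s + A s / (2 n + 1)\<close> takes convex combinations of neighbouring values of \<open>s\<close>, so it does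
not increase the supremum norm. The one-step errors therefore just add up, and for \<open>s\<close> of size
\<open>1 / sqrt n\<close> their sum tends to 0 (\<open>charf_clt\<close>). The same device bounds the second moments.

Since characteristic functions are bounded by 1, the limit shows that \<open>\<sigma>\<close> is positive
semidefinite; a Cholesky factorisation then realises the Gaussian limit as triangular linear
combinations of independent standard normal variables. Finally, in the space of real sequences,
convergence of the characteristic functions of all finite linear combinations together with bounded
second moments implies convergence in distribution
(\<open>converges_in_distribution_sequence\<close>): the second moments confine the laws to compact boxes up to
small probability, and on such a box a continuous function is uniformly approximated by
trigonometric polynomials.\<close>

section \<open>Growing a random game by one pair of cards\<close>

definition card_pair :: "nat \<Rightarrow> nat \<Rightarrow> card list" where
  "card_pair n l = (if 1 \<le> l \<and> l \<le> n then [(l, Blue), (l, Red)] else [])"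

text \<open>Membership in \<^const>\<open>games\<close> is a condition on the subsequence of each label separately. In this form
inserting, deleting and relabelling cards are computations with \<^const>\<open>filter\<close>.\<close>

lemma games_iff_filter:
  "xs \<in> games n \<longleftrightarrow> (\<forall>l. filter (\<lambda>c. fst c = l) xs = card_pair n l)"
proof
  assume xs: "xs \<in> games n"
  then have set_xs: "set xs = {1..n} \<times> {Blue, Red}" and dist: "distinct xs"
    unfolding games_def permutations_of_set_def by blast+
  show "\<forall>l. filter (\<lambda>c. fst c = l) xs = card_pair n l"
  proof
    fix l
    show "filter (\<lambda>c. fst c = l) xs = card_pair n l"
    proof (cases "1 \<le> l \<and> l \<le> n")
      case False
      then show ?thesis using set_xs by (auto simp: card_pair_def filter_empty_conv)
    next
      case True
      then obtain a b where ab: "a < b" "b < length xs" "xs ! a = (l, Blue)" "xs ! b = (l, Red)"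
        using xs unfolding games_def mem_Collect_eq by (meson atLeastAtMost_iff)
      define vs where "vs = drop (Suc a) xs"
      have 1: "xs = take a xs @ (l, Blue) # vs"
        using id_take_nth_drop[of a xs] ab by (simp add: vs_def)
      have "vs ! (b - Suc a) = (l, Red)" "b - Suc a < length vs"
        using ab by (simp_all add: vs_def)
      then have 2: "vs = take (b - Suc a) vs @ (l, Red) # drop (Suc (b - Suc a)) vs"
        using id_take_nth_drop by metis
      obtain us ms ws where e: "xs = us @ (l, Blue) # ms @ (l, Red) # ws"
        using 1 2 by metis
      have *: "c \<in> set xs \<Longrightarrow> fst c = l \<Longrightarrow> c = (l, Blue) \<or> c = (l, Red)" for c
        using set_xs by auto
      have "filter (\<lambda>c. fst c = l) us = []" "filter (\<lambda>c. fst c = l) ms = []"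
        "filter (\<lambda>c. fst c = l) ws = []"
        using * dist by (fastforce simp: e filter_empty_conv)+
      then show ?thesis using True by (simp add: e card_pair_def)
    qed
  qed
next
  assume f: "\<forall>l. filter (\<lambda>c. fst c = l) xs = card_pair n l"
  have "c \<in> set xs \<longleftrightarrow> c \<in> set (card_pair n (fst c))" for c
  proof -
    have "c \<in> set xs \<longleftrightarrow> c \<in> set (filter (\<lambda>d. fst d = fst c) xs)" by simp
    then show ?thesis using f by simp
  qed
  then have "c \<in> set xs \<longleftrightarrow> c \<in> {1..n} \<times> {Blue, Red}" for c
    by (cases c) (auto simp: card_pair_def)
  then have set_xs: "set xs = {1..n} \<times> {Blue, Red}" by blast
  have "count (mset xs) c \<le> 1" for c
  proof -
    have "count (mset xs) c = count (filter_mset (\<lambda>d. fst d = fst c) (mset xs)) c" by simp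
    also have "\<dots> = count (mset (card_pair n (fst c))) c"
      using f by (simp flip: mset_filter)
    also have "\<dots> \<le> 1" by (cases c) (auto simp: card_pair_def)
    finally show ?thesis .
  qed
  moreover have "0 < count (mset xs) c" if "c \<in> set xs" for c
    using that by (simp add: count_greater_zero_iff)
  ultimately have "count (mset xs) c = (if c \<in> set xs then 1 else 0)" for c
    by (cases "c \<in> set xs") (simp_all add: le_antisym Suc_le_eq count_eq_zero_iff)
  then have "distinct xs" by (simp add: distinct_count_atmost_1)
  moreover have "\<exists>a b. a < b \<and> b < length xs \<and> xs ! a = (l, Blue) \<and> xs ! b = (l, Red)"
    if "l \<in> {1..n}" for l
  proof -
    have "filter (\<lambda>c. fst c = l) xs = [(l, Blue), (l, Red)]"
      using f that by (simp add: card_pair_def)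
    then obtain us vs where 1: "xs = us @ (l, Blue) # vs" "[(l, Red)] = filter (\<lambda>c. fst c = l) vs"
      unfolding filter_eq_Cons_iff by blast
    then obtain ms ws where "vs = ms @ (l, Red) # ws"
      unfolding eq_commute[of "[(l, Red)]"] filter_eq_Cons_iff by blast
    with 1 show ?thesis
      by (intro exI[of _ "length us"] exI[of _ "Suc (length us + length ms)"])
        (simp add: nth_append)
  qed
  ultimately show "xs \<in> games n"
    using set_xs by (simp add: games_def permutations_of_set_def)
qed

lemma relabel_mem_games:
  assumes "xs \<in> games n" "a \<in> {1..n}" "b \<in> {1..n}"
  shows "map (apfst (Transposition.transpose a b)) xs \<in> games n"
  unfolding games_iff_filter
proof
  fix l
  let ?t = "Transposition.transpose a b"
  have "filter (\<lambda>c. fst c = l) (map (apfst ?t) xs) = map (apfst ?t) (filter (\<lambda>c. fst c = ?t l) xs)"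
    unfolding filter_map by (rule arg_cong[where f = "map _"], rule filter_cong) (auto simp: Transposition.transpose_def)
  also have "\<dots> = map (apfst ?t) (card_pair n (?t l))"
    using assms by (simp add: games_iff_filter)
  also have "\<dots> = card_pair n l"
    using assms by (auto simp: card_pair_def Transposition.transpose_def split: if_splits)
  finally show "filter (\<lambda>c. fst c = l) (map (apfst ?t) xs) = card_pair n l" .
qed

lemma length_game: "xs \<in> games n \<Longrightarrow> length xs = 2 * n"
  by (auto simp: games_def card_cartesian_product dest: length_finite_permutations_of_set)

lemma last_game_red:
  assumes "xs \<in> games n" "xs \<noteq> []"
  shows "snd (last xs) = Red"
proof -
  obtain l c where lc: "last xs = (l, c)" by fastforce
  have e: "xs = butlast xs @ [(l, c)]" using assms(2) lc by (metis append_butlast_last_id)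
  have "filter (\<lambda>c. fst c = l) xs = card_pair n l" using assms(1) by (simp add: games_iff_filter)
  then have "filter (\<lambda>c. fst c = l) (butlast xs) @ [(l, c)] = card_pair n l"
    by (subst (asm) e) simp
  then show ?thesis using lc by (auto simp: card_pair_def append_eq_Cons_conv split: if_splits)
qed

definition insert_last_pair :: "nat \<Rightarrow> nat \<Rightarrow> card list \<Rightarrow> card list" where
  "insert_last_pair n p xs = take p xs @ (Suc n, Blue) # drop p xs @ [(Suc n, Red)]"

lemma insert_last_pair_mem_games:
  assumes "xs \<in> games n"
  shows "insert_last_pair n p xs \<in> games (Suc n)"
  unfolding games_iff_filter
proof
  fix l
  have f: "filter (\<lambda>c. fst c = l) xs = card_pair n l" for l
    using assms by (simp add: games_iff_filter)
  have "filter (\<lambda>c. fst c = l) (take p xs) @ filter (\<lambda>c. fst c = l) (drop p xs) = card_pair n l" for l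
    using f by (metis append_take_drop_id filter_append)
  from this[of l] show "filter (\<lambda>c. fst c = l) (insert_last_pair n p xs) = card_pair (Suc n) l"
    by (cases "l = Suc n") (auto simp: insert_last_pair_def card_pair_def)
qed

lemma game_with_last_label_cases:
  assumes "zs \<in> games (Suc n)" "zs \<noteq> []" "last zs = (Suc n, Red)"
  obtains p xs where "p \<le> 2 * n" "xs \<in> games n" "zs = insert_last_pair n p xs"
proof -
  have f: "filter (\<lambda>c. fst c = l) zs = card_pair (Suc n) l" for l
    using assms(1) by (simp add: games_iff_filter)
  have e: "zs = butlast zs @ [(Suc n, Red)]"
    using assms by (metis append_butlast_last_id)
  have "filter (\<lambda>c. fst c = Suc n) (butlast zs) @ [(Suc n, Red)] = card_pair (Suc n) (Suc n)"
    using f[of "Suc n"] by (subst (asm) e) simp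
  then have "filter (\<lambda>c. fst c = Suc n) (butlast zs) = [(Suc n, Blue)]"
    by (simp add: card_pair_def)
  then obtain us vs where uv: "butlast zs = us @ (Suc n, Blue) # vs"
    "\<forall>c\<in>set us. fst c \<noteq> Suc n" "[] = filter (\<lambda>c. fst c = Suc n) vs"
    unfolding filter_eq_Cons_iff by blast
  have zs: "zs = us @ (Suc n, Blue) # vs @ [(Suc n, Red)]" using e uv by simp
  have "us @ vs \<in> games n"
    unfolding games_iff_filter
  proof
    fix l
    show "filter (\<lambda>c. fst c = l) (us @ vs) = card_pair n l"
    proof (cases "l = Suc n")
      case True
      then show ?thesis using uv by (simp add: card_pair_def filter_empty_conv)
    next
      case False
      then show ?thesis using f[of l] by (auto simp: zs card_pair_def)
    qed
  qed
  moreover from this have "length us \<le> 2 * n" using length_game by force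
  moreover have "zs = insert_last_pair n (length us) (us @ vs)"
    by (simp add: zs insert_last_pair_def)
  ultimately show ?thesis using that by blast
qed

text \<open>The last card of a game is red. Exchanging its label with \<open>Suc n\<close> makes it \<open>(Suc n, Red)\<close>, and
removing both cards with label \<open>Suc n\<close> leaves a game with \<open>n\<close> pairs. What is lost is the original
label of the last card and the position of its blue partner among the \<open>2 n + 1\<close> possible ones.\<close>

lemma bij_betw_relabel_insert_last_pair:
  "bij_betw (\<lambda>(l, p, xs). map (apfst (Transposition.transpose l (Suc n))) (insert_last_pair n p xs))
     ({1..Suc n} \<times> {..2 * n} \<times> games n) (games (Suc n))"
  (is "bij_betw ?F ?D ?R")
  unfolding bij_betw_def
proof
  have inj_t: "inj (apfst (Transposition.transpose l (Suc n)) :: card \<Rightarrow> card)" for l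
    by (rule injI) (auto simp: apfst_def map_prod_def split: prod.splits dest: injD[OF inj_transpose])
  show "inj_on ?F ?D"
  proof (rule inj_onI, clarsimp)
    fix l p xs l' p' xs'
    assume p: "p \<le> 2 * n" "p' \<le> 2 * n" and xs: "xs \<in> games n" "xs' \<in> games n"
      and eq: "map (apfst (Transposition.transpose l (Suc n))) (insert_last_pair n p xs)
        = map (apfst (Transposition.transpose l' (Suc n))) (insert_last_pair n p' xs')"
    from arg_cong[OF eq, of last] have l: "l = l'"
      by (simp add: insert_last_pair_def)
    with eq have "insert_last_pair n p xs = insert_last_pair n p' xs'"
      by (simp add: inj_map_eq_map[OF inj_t])
    then have e: "take p xs @ (Suc n, Blue) # drop p xs = take p' xs' @ (Suc n, Blue) # drop p' xs'"
      by (simp add: insert_last_pair_def)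
    have "(Suc n, Blue) \<notin> set ys" if "ys \<in> games n" for ys
      using that by (auto simp: games_def permutations_of_set_def)
    then have "(Suc n, Blue) \<notin> set (take p xs)" "(Suc n, Blue) \<notin> set (drop p xs)"
      using xs in_set_takeD in_set_dropD by metis+
    with e have tk: "take p xs = take p' xs'" and dr: "drop p xs = drop p' xs'"
      by (simp_all add: append_Cons_eq_iff)
    have "p = p'" using arg_cong[OF tk, of length] p xs by (simp add: length_game)
    moreover have "xs = xs'" using tk dr by (metis append_take_drop_id)
    ultimately show "l = l' \<and> p = p' \<and> xs = xs'" using l by simp
  qed
  show "?F ` ?D = ?R"
  proof (intro equalityI subsetI)
    fix ys assume "ys \<in> ?F ` ?D"
    then show "ys \<in> ?R"
      by (auto intro!: relabel_mem_games insert_last_pair_mem_games)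
  next
    fix ys assume ys: "ys \<in> ?R"
    then have ne: "ys \<noteq> []" using length_game[OF ys] by auto
    obtain l where l: "last ys = (l, Red)" using last_game_red[OF ys ne] by (metis prod.collapse)
    have "l \<in> {1..Suc n}"
      using ys last_in_set[OF ne] by (auto simp: l games_def permutations_of_set_def)
    let ?t = "apfst (Transposition.transpose l (Suc n)) :: card \<Rightarrow> card"
    have "map ?t ys \<in> games (Suc n)"
      using ys \<open>l \<in> _\<close> by (intro relabel_mem_games) auto
    moreover have "last (map ?t ys) = (Suc n, Red)" using ne l by (simp add: last_map)
    ultimately obtain p xs where *: "p \<le> 2 * n" "xs \<in> games n" "map ?t ys = insert_last_pair n p xs"
      using ne game_with_last_label_cases by (metis map_is_Nil_conv)
    have "ys = map ?t (map ?t ys)" by (induction ys) auto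
    then have "ys = ?F (l, p, xs)" using * by simp
    then show "ys \<in> ?F ` ?D" using * \<open>l \<in> _\<close> by blast
  qed
qed

lemma card_games_Suc: "card (games (Suc n)) = Suc n * ((2 * n + 1) * card (games n))"
  using bij_betw_same_card[OF bij_betw_relabel_insert_last_pair[of n]]
  by (simp add: card_cartesian_product)

lemma sum_games_Suc:
  fixes f :: "colour list \<Rightarrow> 'a :: real_vector"
  shows "(\<Sum>ys\<in>games (Suc n). f (map snd ys)) =
    real (Suc n) *\<^sub>R (\<Sum>xs\<in>games n. \<Sum>p\<le>2 * n.
       f (take p (map snd xs) @ Blue # drop p (map snd xs) @ [Red]))"
proof -
  have s: "map snd (map (apfst t) xs) = map snd xs" for t and xs :: "card list"
    by (induction xs) auto
  have "(\<Sum>ys\<in>games (Suc n). f (map snd ys)) =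
    (\<Sum>(l, p, xs) \<in> {1..Suc n} \<times> {..2 * n} \<times> games n.
       f (take p (map snd xs) @ Blue # drop p (map snd xs) @ [Red]))"
    unfolding sum.reindex_bij_betw[OF bij_betw_relabel_insert_last_pair[of n], symmetric]
    by (intro sum.cong refl) (auto simp: s insert_last_pair_def take_map drop_map simp del: map_map)
  also have "\<dots> = (\<Sum>l=1..Suc n. \<Sum>p\<le>2 * n. \<Sum>xs\<in>games n.
       f (take p (map snd xs) @ Blue # drop p (map snd xs) @ [Red]))"
    by (simp add: sum.cartesian_product)
  also have "\<dots> = real (Suc n) *\<^sub>R (\<Sum>xs\<in>games n. \<Sum>p\<le>2 * n.
       f (take p (map snd xs) @ Blue # drop p (map snd xs) @ [Red]))"
    by (subst sum.swap) (simp add: sum_constant_scaleR del: sum.atMost_Suc)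
  finally show ?thesis .
qed

section \<open>Block lengths\<close>

fun grow_first :: "nat list \<Rightarrow> nat list" where
  "grow_first [] = []"
| "grow_first (l # ls) = Suc l # ls"

text \<open>The lengths are read off the colours alone. Blue cards behind the last red card belong to no block;
\<^const>\<open>grow_first\<close> drops them, as there is no later block to lengthen.\<close>

fun block_lengths :: "colour list \<Rightarrow> nat list" where
  "block_lengths [] = []"
| "block_lengths (Red # cs) = 1 # block_lengths cs"
| "block_lengths (Blue # cs) = grow_first (block_lengths cs)"

definition ends_red :: "colour list \<Rightarrow> bool" where
  "ends_red cs \<longleftrightarrow> cs = [] \<or> last cs = Red"

lemma ends_red_Cons: "ends_red (c # cs) \<longleftrightarrow> (if cs = [] then c = Red else ends_red cs)"
  by (auto simp: ends_red_def)

lemma grow_first_eq_Nil [simp]: "grow_first ls = [] \<longleftrightarrow> ls = []"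
  by (cases ls) auto

lemma grow_first_append: "ls \<noteq> [] \<Longrightarrow> grow_first (ls @ ks) = grow_first ls @ ks"
  by (cases ls) auto

lemma sum_list_grow_first: "ls \<noteq> [] \<Longrightarrow> sum_list (grow_first ls) = Suc (sum_list ls)"
  by (cases ls) auto

lemma block_lengths_eq_Nil: "ends_red cs \<Longrightarrow> block_lengths cs = [] \<longleftrightarrow> cs = []"
proof (induction cs)
  case (Cons c cs)
  then show ?case by (cases c) (simp_all add: ends_red_Cons split: if_splits)
qed simp

lemma block_lengths_snoc:
  assumes "ends_red cs"
  shows "block_lengths (cs @ [Red]) = block_lengths cs @ [1]"
    and "block_lengths (cs @ [Blue, Red]) = block_lengths cs @ [2]"
proof -
  have "block_lengths (cs @ ds) = block_lengths cs @ block_lengths ds" for ds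
    using assms
  proof (induction cs)
    case (Cons c cs)
    then show ?case
      using block_lengths_eq_Nil[of cs]
      by (cases c) (simp_all add: ends_red_Cons grow_first_append split: if_splits)
  qed simp
  then show "block_lengths (cs @ [Red]) = block_lengths cs @ [1]"
    and "block_lengths (cs @ [Blue, Red]) = block_lengths cs @ [2]"
    by (simp_all add: numeral_2_eq_2)
qed

lemma sum_list_block_lengths: "ends_red cs \<Longrightarrow> sum_list (block_lengths cs) = length cs"
proof (induction cs)
  case (Cons c cs)
  then show ?case
    using block_lengths_eq_Nil[of cs]
    by (cases c) (simp_all add: ends_red_Cons sum_list_grow_first split: if_splits)
qed simp

text \<open>A block of length \<open>l\<close> offers \<open>l\<close> places for a new blue card, one in front of each of its cards, and
every one of them lengthens this block by one.\<close>

lemma sum_insert_blue: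
  fixes G :: "nat list \<Rightarrow> 'a :: real_vector"
  assumes "ends_red cs"
  shows "(\<Sum>p<length cs. G (block_lengths (take p cs @ Blue # drop p cs))) =
    (\<Sum>j<length (block_lengths cs).
       real (block_lengths cs ! j) *\<^sub>R G ((block_lengths cs)[j := Suc (block_lengths cs ! j)]))"
  using assms
proof (induction cs arbitrary: G)
  case Nil
  then show ?case by simp
next
  case (Cons c cs)
  then have cs: "ends_red cs" by (auto simp: ends_red_Cons ends_red_def split: if_splits)
  have lt: "(\<Sum>p<length (c # cs). f p) = f 0 + (\<Sum>p<length cs. f (Suc p))" for f :: "nat \<Rightarrow> 'a"
    by (simp add: sum.lessThan_Suc_shift del: sum.lessThan_Suc)
  show ?case
  proof (cases c)
    case Red
    have "(\<Sum>p<length cs. G (1 # block_lengths (take p cs @ Blue # drop p cs))) =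
      (\<Sum>j<length (block_lengths cs). real (block_lengths cs ! j) *\<^sub>R
        G (1 # (block_lengths cs)[j := Suc (block_lengths cs ! j)]))"
      using Cons.IH[OF cs, of "\<lambda>ls. G (1 # ls)"] by simp
    then show ?thesis
      unfolding lt using Red
      by (simp add: sum.lessThan_Suc_shift numeral_2_eq_2 del: sum.lessThan_Suc)
  next
    case Blue
    with Cons.prems have "cs \<noteq> []" by (auto simp: ends_red_def)
    then obtain l ls where ls: "block_lengths cs = l # ls"
      using block_lengths_eq_Nil[OF cs] by (cases "block_lengths cs") auto
    have "(\<Sum>p<length cs. G (grow_first (block_lengths (take p cs @ Blue # drop p cs)))) =
      (\<Sum>j<length (block_lengths cs). real (block_lengths cs ! j) *\<^sub>R
        G (grow_first ((block_lengths cs)[j := Suc (block_lengths cs ! j)])))"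
      using Cons.IH[OF cs, of "\<lambda>ls. G (grow_first ls)"] by simp
    also have "\<dots> = real l *\<^sub>R G (Suc (Suc l) # ls) +
      (\<Sum>j<length ls. real (ls ! j) *\<^sub>R G (Suc l # ls[j := Suc (ls ! j)]))"
      unfolding ls by (simp add: sum.lessThan_Suc_shift del: sum.lessThan_Suc)
    finally show ?thesis
      unfolding lt using Blue ls
      by (simp add: sum.lessThan_Suc_shift scaleR_left_distrib del: sum.lessThan_Suc)
  qed
qed

text \<open>The description of blocks by positions and the recursive one are compared through the list of
positions of the red cards.\<close>

definition red_indices :: "colour list \<Rightarrow> nat list" where
  "red_indices cs = filter (\<lambda>p. cs ! p = Red) [0..<length cs]"

lemma red_indices_Cons:
  "red_indices (c # cs) = (if c = Red then [0] else []) @ map Suc (red_indices cs)"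
proof -
  have "[0..<length (c # cs)] = 0 # map Suc [0..<length cs]"
    by (simp add: map_Suc_upt upt_conv_Cons del: upt_Suc)
  then show ?thesis by (simp add: red_indices_def filter_map o_def)
qed

lemma block_lengths_red_indices:
  "block_lengths cs = map (\<lambda>k. Suc (red_indices cs ! k) - (if k = 0 then 0 else Suc (red_indices cs ! (k - 1))))
     [0..<length (red_indices cs)]"
proof (induction cs)
  case Nil
  then show ?case by (simp add: red_indices_def)
next
  case (Cons c cs)
  define r where "r = red_indices cs"
  have IH: "block_lengths cs = map (\<lambda>k. Suc (r ! k) - (if k = 0 then 0 else Suc (r ! (k - 1)))) [0..<length r]"
    using Cons.IH by (simp add: r_def)
  show ?case
  proof (cases c)
    case Red
    show ?thesis
    proof (rule nth_equalityI)
      fix k assume "k < length (block_lengths (c # cs))"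
      then show "block_lengths (c # cs) ! k = map (\<lambda>k. Suc (red_indices (c # cs) ! k) -
          (if k = 0 then 0 else Suc (red_indices (c # cs) ! (k - 1))))
          [0..<length (red_indices (c # cs))] ! k"
        using Red by (cases k; cases "k - 1")
          (auto simp: red_indices_Cons r_def[symmetric] IH simp del: upt_Suc)
    qed (use Red in \<open>simp add: red_indices_Cons r_def[symmetric] IH\<close>)
  next
    case Blue
    have "grow_first ls = (if ls = [] then [] else Suc (hd ls) # tl ls)" for ls
      by (cases ls) auto
    then have g: "length (grow_first ls) = length ls"
      "k < length ls \<Longrightarrow> grow_first ls ! k = (if k = 0 then Suc (ls ! 0) else ls ! k)" for ls k
      by (cases ls; simp add: nth_Cons')+
    show ?thesis
      using Blue by (intro nth_equalityI)
        (auto simp: red_indices_Cons r_def[symmetric] IH g simp del: upt_Suc)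
  qed
qed

lemma num_blocks_eq_count:
  assumes "xs \<in> games n"
  shows "num_blocks n i xs = count_list (block_lengths (map snd xs)) i"
    and "length (block_lengths (map snd xs)) = n"
proof -
  define r where "r = red_indices (map snd xs)"
  have r: "r = filter (\<lambda>p. snd (xs ! p) = Red) [0..<length xs]"
    unfolding r_def red_indices_def by (auto intro!: filter_cong)
  have "length r = n"
  proof -
    have "length r = card (set xs \<inter> {c. snd c = Red})"
    proof -
      have d: "distinct xs" using assms by (auto simp: games_def permutations_of_set_def)
      have "length r = length (filter (\<lambda>c. snd c = Red) xs)"
        by (simp add: r length_filter_conv_card cong: conj_cong) 
      also have "\<dots> = card (set (filter (\<lambda>c. snd c = Red) xs))"
        by (metis d distinct_card distinct_filter)
      finally show ?thesis by (simp add: Int_def)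
    qed
    also have "set xs \<inter> {c. snd c = Red} = (\<lambda>l. (l, Red)) ` {1..n}"
      using assms by (auto simp: games_def permutations_of_set_def)
    also have "card \<dots> = n" by (subst card_image) (auto simp: inj_on_def)
    finally show ?thesis .
  qed
  have rl: "r ! k < length xs" if "k < n" for k
    using nth_mem[of k r] that \<open>length r = n\<close> by (auto simp: r)
  define f where "f k = Suc (r ! k) - (if k = 0 then 0 else Suc (r ! (k - 1)))" for k
  have bl: "block_lengths (map snd xs) = map f [0..<n]"
    using block_lengths_red_indices[of "map snd xs"] \<open>length r = n\<close> by (simp add: f_def r_def)
  then show "length (block_lengths (map snd xs)) = n" by simp
  have "length (block xs (Suc k)) = f k" if "k < n" for k
    using rl[OF that] that by (cases k) (auto simp: block_def red_position_def r[symmetric] f_def)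
  then have "{k \<in> {1..n}. length (block xs k) = i} = Suc ` {k. k < n \<and> f k = i}"
    by (auto simp: image_iff Suc_le_eq gr0_conv_Suc)
  then have "num_blocks n i xs = card {k. k < n \<and> f k = i}"
    by (simp add: num_blocks_def card_image)
  also have "\<dots> = length (filter (\<lambda>k. f k = i) [0..<n])"
    by (auto simp: length_filter_conv_card cong: conj_cong)
  also have "\<dots> = count_list (map f [0..<n]) i"
    by (induction n) auto
  finally show "num_blocks n i xs = count_list (block_lengths (map snd xs)) i"
    using bl by simp
qed

section \<open>The evolution of linear block statistics\<close>

definition block_sum :: "(nat \<Rightarrow> real) \<Rightarrow> card list \<Rightarrow> real" where
  "block_sum s xs = (\<Sum>l\<leftarrow>block_lengths (map snd xs). s l)"

text \<open>The change of a block sum when a block of length \<open>l\<close> grows and a new block of length 1 appears.\<close>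

definition increment :: "(nat \<Rightarrow> real) \<Rightarrow> nat \<Rightarrow> real" where
  "increment s l = s (Suc l) - s l + s 1"

lemma expectation_random_game:
  fixes f :: "card list \<Rightarrow> 'a :: {banach, second_countable_topology}"
  shows "measure_pmf.expectation (random_game n) f = (\<Sum>xs\<in>games n. f xs) /\<^sub>R card (games n)"
  unfolding random_game_def using games_nonempty[of n] finite_games[of n]
  by (subst integral_measure_pmf[of "games n"]) (auto simp: scaleR_sum_right divide_inverse)

lemma sum_list_nth_update:
  fixes s :: "nat \<Rightarrow> real"
  assumes "j < length ls"
  shows "(\<Sum>l\<leftarrow>ls[j := k]. s l) = (\<Sum>l\<leftarrow>ls. s l) + s k - s (ls ! j)"
  using assms by (induction ls arbitrary: j) (auto split: nat.split simp: nth_Cons')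

lemma ends_red_game: "xs \<in> games n \<Longrightarrow> ends_red (map snd xs)"
  unfolding ends_red_def by (metis last_game_red last_map map_is_Nil_conv)

text \<open>If the blue card is placed immediately before its red partner, the game gains a block of length 2.
Since \<open>increment s 1 = s 2\<close>, this agrees with the growth of an additional, virtual block of length 1.
With the virtual block in front of the list, the weights \<open>l\<close> add up to \<open>2 n + 1\<close>.\<close>

lemma expectation_random_game_Suc:
  fixes h :: "real \<Rightarrow> 'a :: {banach, second_countable_topology}"
  shows "measure_pmf.expectation (random_game (Suc n)) (\<lambda>xs. h (block_sum s xs)) =
    measure_pmf.expectation (random_game n) (\<lambda>xs.
      (\<Sum>l\<leftarrow>1 # block_lengths (map snd xs). real l *\<^sub>R h (block_sum s xs + increment s l))
        /\<^sub>R real (2 * n + 1))"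
proof -
  define H where "H = (\<lambda>cs. h (\<Sum>l\<leftarrow>block_lengths cs. s l))"
  have step: "(\<Sum>p\<le>2 * n. H (take p (map snd xs) @ Blue # drop p (map snd xs) @ [Red])) =
    (\<Sum>l\<leftarrow>1 # block_lengths (map snd xs). real l *\<^sub>R h (block_sum s xs + increment s l))"
    if xs: "xs \<in> games n" for xs
  proof -
    define cs where "cs = map snd xs"
    define b where "b = block_lengths cs"
    have len: "length cs = 2 * n" using length_game[OF xs] by (simp add: cs_def)
    have er: "ends_red cs" using ends_red_game[OF xs] by (simp add: cs_def)
    have er': "ends_red (take p cs @ Blue # drop p cs)" if "p < length cs" for p
      using er that by (auto simp: ends_red_def)
    have "(\<Sum>p\<le>2 * n. H (take p cs @ Blue # drop p cs @ [Red])) =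
      (\<Sum>p<length cs. H (take p cs @ Blue # drop p cs @ [Red])) + H (cs @ [Blue, Red])"
      by (simp add: len lessThan_Suc_atMost[symmetric] sum.lessThan_Suc)
    also have "(\<Sum>p<length cs. H (take p cs @ Blue # drop p cs @ [Red])) =
      (\<Sum>p<length cs. h ((\<Sum>l\<leftarrow>block_lengths (take p cs @ Blue # drop p cs). s l) + s 1))"
      using block_lengths_snoc(1)[OF er'] by (intro sum.cong) (auto simp: H_def)
    also have "\<dots> = (\<Sum>j<length b. real (b ! j) *\<^sub>R h ((\<Sum>l\<leftarrow>b[j := Suc (b ! j)]. s l) + s 1))"
      unfolding b_def by (rule sum_insert_blue[OF er, of "\<lambda>ls. h ((\<Sum>l\<leftarrow>ls. s l) + s 1)"])
    also have "\<dots> = (\<Sum>j<length b. real (b ! j) *\<^sub>R h ((\<Sum>l\<leftarrow>b. s l) + increment s (b ! j)))"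
      by (intro sum.cong) (auto simp: sum_list_nth_update increment_def algebra_simps)
    also have "\<dots> = (\<Sum>l\<leftarrow>b. real l *\<^sub>R h ((\<Sum>l\<leftarrow>b. s l) + increment s l))"
      by (simp add: sum_list_sum_nth atLeast0LessThan)
    also have "H (cs @ [Blue, Red]) = h ((\<Sum>l\<leftarrow>b. s l) + increment s 1)"
      using block_lengths_snoc(2)[OF er] by (simp add: H_def b_def increment_def numeral_2_eq_2)
    finally show ?thesis by (simp add: block_sum_def b_def cs_def add.commute)
  qed
  have "measure_pmf.expectation (random_game (Suc n)) (\<lambda>xs. h (block_sum s xs)) =
    (\<Sum>ys\<in>games (Suc n). H (map snd ys)) /\<^sub>R card (games (Suc n))"
    by (simp add: expectation_random_game H_def block_sum_def)
  also have "\<dots> = (\<Sum>xs\<in>games n. \<Sum>l\<leftarrow>1 # block_lengths (map snd xs).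
      real l *\<^sub>R h (block_sum s xs + increment s l)) /\<^sub>R ((2 * n + 1) * card (games n))"
  proof -
    have "inverse (real (Suc n * k)) * real (Suc n) = inverse (real k)" for k
      by (simp del: of_nat_Suc mult_Suc)
    then show ?thesis
      unfolding sum_games_Suc card_games_Suc scaleR_scaleR
      by (simp only: step cong: sum.cong)
  qed
  also have "\<dots> = measure_pmf.expectation (random_game n) (\<lambda>xs.
      (\<Sum>l\<leftarrow>1 # block_lengths (map snd xs). real l *\<^sub>R h (block_sum s xs + increment s l))
        /\<^sub>R real (2 * n + 1))"
    by (simp only: expectation_random_game scaleR_sum_right scaleR_scaleR of_nat_mult
        inverse_mult_distrib mult.commute)
  finally show ?thesis .
qed

section \<open>Limiting frequencies and the covariance form\<close>

text \<open>The limiting proportion of blocks of length \<open>l\<close>, namely \<open>4 / (l + 2)\<^sub>3\<close>.\<close>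

definition block_freq :: "nat \<Rightarrow> real" where
  "block_freq l = 4 / (real l * (real l + 1) * (real l + 2))"

text \<open>For \<open>l \<ge> 1\<close> this is \<open>l p\<^sub>l\<close>, twice the limiting probability that a block of length \<open>l\<close> grows. The
value 2 at \<open>l = 0\<close> is what the telescoping identities below need at their lower end.\<close>

definition growth_rate :: "nat \<Rightarrow> real" where
  "growth_rate l = 4 / ((real l + 1) * (real l + 2))"

definition freq_sum :: "nat \<Rightarrow> (nat \<Rightarrow> real) \<Rightarrow> real" where
  "freq_sum M s = (\<Sum>l=1..M. block_freq l * s l)"

text \<open>The operator \<open>A\<close> that governs the conditional mean of the next increment: a block of length \<open>l\<close>
grows at a rate proportional to \<open>l\<close>.\<close>

definition drift :: "(nat \<Rightarrow> real) \<Rightarrow> nat \<Rightarrow> real" where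
  "drift s l = real l * (s (Suc l) - s l)"

definition flow :: "nat \<Rightarrow> (nat \<Rightarrow> real) \<Rightarrow> nat \<Rightarrow> real" where
  "flow n s l = s l + drift s l / real (2 * n + 1)"

text \<open>Test functions that see only blocks of length at most \<open>M\<close>. The bound \<open>e\<close> is of order
\<open>1 / sqrt n\<close> when these functions are applied to a game with \<open>n\<close> pairs.\<close>

definition weights :: "nat \<Rightarrow> real \<Rightarrow> (nat \<Rightarrow> real) \<Rightarrow> bool" where
  "weights M e s \<longleftrightarrow> (\<forall>l. \<bar>s l\<bar> \<le> e) \<and> (\<forall>l>M. s l = 0)"

text \<open>The limit, as the proportions of the block lengths settle down, of the conditional variance of one
increment.\<close>

definition step_variance :: "nat \<Rightarrow> (nat \<Rightarrow> real) \<Rightarrow> real" where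
  "step_variance M s = (\<Sum>l=1..M. growth_rate l * (s (Suc l) - s l)\<^sup>2) / 2 - (s 1 - freq_sum M s)\<^sup>2"

definition cov_form :: "nat \<Rightarrow> (nat \<Rightarrow> real) \<Rightarrow> (nat \<Rightarrow> real) \<Rightarrow> real" where
  "cov_form M s t = (\<Sum>i=1..M. \<Sum>j=1..M. s i * t j * block_cov i j)"

lemma block_freq_falling: "4 / falling_factorial (real (i + 2)) 3 = block_freq i"
proof -
  have "falling_factorial (real (i + 2)) 3 = (real i + 2) * (real i + 1) * real i"
    by (simp add: falling_factorial_def eval_nat_numeral lessThan_Suc add_ac mult_ac)
  then show ?thesis by (simp only: block_freq_def mult_ac)
qed

lemma growth_rate_eq: "l \<ge> 1 \<Longrightarrow> growth_rate l = real l * block_freq l"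
  by (simp add: growth_rate_def block_freq_def)

lemma growth_rate_nonneg: "growth_rate l \<ge> 0"
  by (simp add: growth_rate_def)

lemma block_freq_nonneg: "block_freq l \<ge> 0"
  by (simp add: block_freq_def)

lemma telescope_two: "b \<noteq> 0 \<Longrightarrow> c \<noteq> 0 \<Longrightarrow> c = b + 1 \<Longrightarrow> k / (b * c) = k / b - k / (c :: real)"
  by (simp add: field_simps)

lemma telescope_three:
  assumes "a \<noteq> 0" "b \<noteq> 0" "c \<noteq> 0" "c = a + 2"
  shows "2 * k / (a * b * c) = k / (a * b) - k / (b * c :: real)"
proof -
  have "k / (a * b) = k * c / (a * b * c)" "k / (b * c) = k * a / (a * b * c)"
    using assms(1-3) by simp_all
  then have "k / (a * b) - k / (b * c) = k * (c - a) / (a * b * c)"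
    by (simp only: diff_divide_distrib right_diff_distrib)
  then show ?thesis unfolding assms(4) by simp
qed

lemma block_freq_Suc:
  "2 * block_freq (Suc M) = growth_rate M - growth_rate (Suc M)"
  "block_freq (Suc M) = growth_rate M / 2 - growth_rate (Suc M) / 2"
proof -
  have "2 * (2 * k) / ((real M + 1) * (real M + 2) * (real M + 3)) =
      2 * k / ((real M + 1) * (real M + 2)) - 2 * k / ((real M + 2) * (real M + 3))" for k
    by (rule telescope_three) simp_all
  from this[of 2] show "2 * block_freq (Suc M) = growth_rate M - growth_rate (Suc M)"
    by (simp add: block_freq_def growth_rate_def add_ac)
  then show "block_freq (Suc M) = growth_rate M / 2 - growth_rate (Suc M) / 2" by simp
qed

lemma sum_block_freq: "(\<Sum>l=1..M. block_freq l) = 1 - growth_rate M / 2"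
proof (induction M)
  case 0
  then show ?case by (simp add: growth_rate_def)
next
  case (Suc M)
  then show ?case by (simp add: block_freq_Suc(2))
qed

lemma sum_growth_rate: "(\<Sum>l=1..M. growth_rate l) = 2 - 4 / (real M + 2)"
proof (induction M)
  case (Suc M)
  have "growth_rate (Suc M) = 4 / ((real M + 2) * (real M + 3))"
    by (simp add: growth_rate_def add_ac)
  also have "\<dots> = 4 / (real M + 2) - 4 / (real M + 3)"
    by (rule telescope_two) simp_all
  finally show ?case using Suc by simp
qed simp

lemma sum_growth_rate_le: "(\<Sum>l=1..M. growth_rate l) \<le> 2"
  unfolding sum_growth_rate by simp

lemma sum_block_freq_le: "(\<Sum>l=1..M. block_freq l) \<le> 1"
  unfolding sum_block_freq by (simp add: growth_rate_nonneg)

text \<open>Summation by parts. The frequencies are stationary for the growth process in the sense that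
\<open>growth_rate (l - 1) - growth_rate l = 2 block_freq l\<close>.\<close>

lemma sum_growth_rate_diff:
  "(\<Sum>l=1..M. growth_rate l * (s (Suc l) - s l)) =
     growth_rate M * s (Suc M) + 2 * freq_sum M s - 2 * s 1"
proof (induction M)
  case 0
  then show ?case by (simp add: growth_rate_def freq_sum_def)
next
  case (Suc M)
  have *: "growth_rate M = growth_rate (Suc M) + 2 * block_freq (Suc M)"
    using block_freq_Suc(1)[of M] by simp
  show ?case using Suc by (simp add: freq_sum_def * algebra_simps)
qed

lemma weights_zero_above: "weights M e s \<Longrightarrow> l > M \<Longrightarrow> s l = 0"
  by (simp add: weights_def)

lemma weights_bound: "weights M e s \<Longrightarrow> \<bar>s l\<bar> \<le> e"
  by (simp add: weights_def)

lemma weights_nonneg: "weights M e s \<Longrightarrow> e \<ge> 0"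
  by (metis abs_ge_zero order_trans weights_def)

lemma freq_sum_drift:
  assumes "weights M e s"
  shows "freq_sum M (drift s) = 2 * freq_sum M s - 2 * s 1"
proof -
  have "freq_sum M (drift s) = (\<Sum>l=1..M. growth_rate l * (s (Suc l) - s l))"
    unfolding freq_sum_def by (intro sum.cong) (auto simp: drift_def growth_rate_eq)
  then show ?thesis using sum_growth_rate_diff[of s M] weights_zero_above[OF assms, of "Suc M"] by simp
qed

lemma freq_sum_bound:
  assumes "weights M e s"
  shows "\<bar>freq_sum M s\<bar> \<le> e"
proof -
  have "\<bar>freq_sum M s\<bar> \<le> (\<Sum>l=1..M. block_freq l * e)"
    unfolding freq_sum_def using weights_bound[OF assms] block_freq_nonneg
    by (intro order_trans[OF sum_abs] sum_mono) (simp add: abs_mult mult_left_mono)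
  also have "\<dots> = (\<Sum>l=1..M. block_freq l) * e" by (simp add: sum_distrib_right)
  also have "\<dots> \<le> 1 * e"
    using weights_nonneg[OF assms] by (intro mult_right_mono sum_block_freq_le)
  finally show ?thesis by simp
qed

lemma weights_diff:
  assumes "weights M e s"
  shows "\<bar>s (Suc l) - s l\<bar> \<le> 2 * e"
  using weights_bound[OF assms, of l] weights_bound[OF assms, of "Suc l"] by linarith

lemma weights_drift:
  assumes "weights M e s"
  shows "weights M (2 * real M * e) (drift s)"
  unfolding weights_def
proof (intro conjI allI impI)
  fix l
  show "\<bar>drift s l\<bar> \<le> 2 * real M * e"
  proof (cases "l \<le> M")
    case True
    then show ?thesis
      using mult_mono[of "real l" "real M" "\<bar>s (Suc l) - s l\<bar>" "2 * e"] weights_diff[OF assms, of l]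
      by (simp add: drift_def abs_mult)
  next
    case False
    then show ?thesis using assms weights_nonneg[OF assms] by (simp add: drift_def weights_zero_above)
  qed
qed (use assms in \<open>simp add: drift_def weights_zero_above\<close>)

text \<open>Since \<open>flow n s l\<close> is a convex combination of \<open>s l\<close> and \<open>s (Suc l)\<close> for \<open>l \<le> 2 n + 1\<close>, following the
flow does not enlarge the weights, and one-step errors can be added up without amplification.\<close>

lemma weights_flow:
  assumes "weights M e s" "M \<le> 2 * n + 1"
  shows "weights M e (flow n s)"
  unfolding weights_def
proof (intro conjI allI impI)
  fix l
  show "\<bar>flow n s l\<bar> \<le> e"
  proof (cases "l \<le> M")
    case True
    define a where "a = real l / real (2 * n + 1)"
    have a: "0 \<le> a" "a \<le> 1" using True assms(2) by (auto simp: a_def)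
    have "flow n s l = (1 - a) * s l + a * s (Suc l)"
      by (simp add: flow_def drift_def a_def algebra_simps diff_divide_distrib)
    also have "\<bar>\<dots>\<bar> \<le> (1 - a) * e + a * e"
      using a weights_bound[OF assms(1)]
      by (intro order_trans[OF abs_triangle_ineq] add_mono) (simp_all add: abs_mult mult_left_mono)
    finally show ?thesis by (simp add: algebra_simps)
  next
    case False
    then show ?thesis using assms weights_nonneg[OF assms(1)] by (simp add: drift_def flow_def weights_zero_above)
  qed
qed (use assms in \<open>simp add: drift_def flow_def weights_zero_above\<close>)

text \<open>A variance is nonnegative: the mean \<open>freq_sum M s - s 1\<close> is itself half a sum against the growth
rates, whose total mass is at most 2, so the Cauchy-Schwarz inequality applies.\<close>

lemma step_variance_nonneg:
  assumes "weights M e s"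
  shows "step_variance M s \<ge> 0"
proof -
  let ?d = "\<lambda>l. s (Suc l) - s l"
  have eq: "(\<Sum>l=1..M. growth_rate l * ?d l) = 2 * (freq_sum M s - s 1)"
    using sum_growth_rate_diff[of s M] weights_zero_above[OF assms, of "Suc M"] by simp
  have "(\<Sum>l=1..M. growth_rate l * ?d l) = (\<Sum>l=1..M. sqrt (growth_rate l) * (sqrt (growth_rate l) * ?d l))"
    using growth_rate_nonneg by (intro sum.cong) (auto simp flip: mult.assoc)
  then have "(\<Sum>l=1..M. growth_rate l * ?d l)\<^sup>2 \<le>
      (\<Sum>l=1..M. (sqrt (growth_rate l))\<^sup>2) * (\<Sum>l=1..M. (sqrt (growth_rate l) * ?d l)\<^sup>2)"
    using Cauchy_Schwarz_ineq_sum[of "\<lambda>l. sqrt (growth_rate l)" "\<lambda>l. sqrt (growth_rate l) * ?d l" "{1..M}"]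
    by simp
  also have "\<dots> = (\<Sum>l=1..M. growth_rate l) * (\<Sum>l=1..M. growth_rate l * (?d l)\<^sup>2)"
    using growth_rate_nonneg by (simp add: power_mult_distrib)
  also have "\<dots> \<le> 2 * (\<Sum>l=1..M. growth_rate l * (?d l)\<^sup>2)"
    by (intro mult_right_mono sum_nonneg sum_growth_rate_le) (simp add: growth_rate_nonneg)
  finally have "(2 * (freq_sum M s - s 1))\<^sup>2 \<le> 2 * (\<Sum>l=1..M. growth_rate l * (?d l)\<^sup>2)"
    by (simp only: eq)
  then show ?thesis by (simp add: step_variance_def power2_eq_square algebra_simps)
qed

lemma step_variance_le:
  assumes "weights M e s"
  shows "step_variance M s \<le> 4 * e\<^sup>2"
proof -
  have "(s (Suc l) - s l)\<^sup>2 \<le> (2 * e)\<^sup>2" for l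
    using weights_diff[OF assms, of l] weights_nonneg[OF assms]
    by (intro iffD1[OF abs_le_square_iff]) simp
  then have "(\<Sum>l=1..M. growth_rate l * (s (Suc l) - s l)\<^sup>2) \<le> (\<Sum>l=1..M. growth_rate l * (2 * e)\<^sup>2)"
    by (intro sum_mono mult_left_mono growth_rate_nonneg)
  also have "\<dots> = (\<Sum>l=1..M. growth_rate l) * (2 * e)\<^sup>2" by (simp add: sum_distrib_right)
  also have "\<dots> \<le> 2 * (2 * e)\<^sup>2" by (intro mult_right_mono sum_growth_rate_le) simp
  finally have "(\<Sum>l=1..M. growth_rate l * (s (Suc l) - s l)\<^sup>2) / 2 \<le> 4 * e\<^sup>2"
    by (simp add: power2_eq_square)
  then show ?thesis unfolding step_variance_def
    using zero_le_power2[of "s 1 - freq_sum M s"] by linarith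
qed

definition pair_freq :: "nat \<Rightarrow> real" where
  "pair_freq k = 24 / ((real k - 1) * real k * (real k + 1) * (real k + 2))"

lemma block_cov_eq:
  assumes "i \<ge> 1" "j \<ge> 1"
  shows "block_cov i j = (if i = j then block_freq i else 0) + block_freq i * block_freq j - pair_freq (i + j)"
proof -
  have 4: "24 / falling_factorial (real (k + 2)) 4 = pair_freq k" for k
  proof -
    have "falling_factorial (real (k + 2)) 4 =
        (real k + 2) * ((real k + 1) * (real k * (real k - 1)))"
      by (simp add: falling_factorial_def eval_nat_numeral lessThan_Suc add_ac mult_ac)
    then show ?thesis by (simp only: pair_freq_def mult_ac)
  qed
  have 16: "16 / (x * y) = (4 / x) * (4 / y)" for x y :: real by simp
  show ?thesis
    unfolding block_cov_def power2_eq_square 16 block_freq_falling 4 mult_2 by simp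
qed

definition pair_form :: "nat \<Rightarrow> (nat \<Rightarrow> real) \<Rightarrow> (nat \<Rightarrow> real) \<Rightarrow> real" where
  "pair_form M s t = (\<Sum>i=1..M. \<Sum>j=1..M. s i * t j * pair_freq (i + j))"

lemma cov_form_eq:
  "cov_form M s t = (\<Sum>l=1..M. block_freq l * s l * t l) + freq_sum M s * freq_sum M t - pair_form M s t"
proof -
  have "cov_form M s t = (\<Sum>i=1..M. \<Sum>j=1..M. (if i = j then block_freq i * s i * t j else 0)
      + (block_freq i * s i) * (block_freq j * t j) - s i * t j * pair_freq (i + j))"
    unfolding cov_form_def
    by (intro sum.cong refl) (auto simp: block_cov_eq algebra_simps)
  also have "\<dots> = (\<Sum>i=1..M. \<Sum>j=1..M. (if i = j then block_freq i * s i * t j else 0))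
      + (\<Sum>i=1..M. \<Sum>j=1..M. (block_freq i * s i) * (block_freq j * t j)) - pair_form M s t"
    by (simp add: sum.distrib sum_subtractf pair_form_def)
  also have "(\<Sum>i=1..M. \<Sum>j=1..M. (if i = j then block_freq i * s i * t j else 0)) =
      (\<Sum>l=1..M. block_freq l * s l * t l)"
    by (intro sum.cong refl) (simp add: sum.delta)
  also have "(\<Sum>i=1..M. \<Sum>j=1..M. (block_freq i * s i) * (block_freq j * t j)) =
      freq_sum M s * freq_sum M t"
    by (simp add: freq_sum_def sum_product)
  finally show ?thesis .
qed

text \<open>With \<open>k = i + j\<close> the left-hand side is \<open>(k - 2) pair_freq (k - 1) - k pair_freq k\<close>. The factor
\<open>k - 2\<close> cancels one in the denominator of \<open>pair_freq (k - 1)\<close>, except for \<open>i = j = 1\<close>, where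
it is 0; this causes the correction by 4.\<close>

lemma pair_freq_recurrence:
  assumes "i \<ge> 1" "j \<ge> 1"
  shows "(real j - 1) * pair_freq (i + j - 1) - real j * pair_freq (i + j)
    + ((real i - 1) * pair_freq (j + i - 1) - real i * pair_freq (j + i))
    = 2 * pair_freq (i + j) - (if i = 1 \<and> j = 1 then 4 else 0)"
proof (cases "i = 1 \<and> j = 1")
  case True
  then show ?thesis by (simp add: pair_freq_def)
next
  case False
  define k where "k = real (i + j)"
  have k: "k > 2" using False assms by (auto simp: k_def)
  have r: "real (i + j - 1) = k - 1" using assms by (simp add: k_def of_nat_diff)
  have *: "(k - 2) * pair_freq (i + j - 1) = (k + 2) * pair_freq (i + j)"
  proof -
    have "(k - 2) * pair_freq (i + j - 1) = (k - 2) * (24 / ((k - 2) * (k - 1) * k * (k + 1)))"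
      unfolding pair_freq_def r by (simp add: algebra_simps)
    also have "\<dots> = (k + 2) * (24 / ((k - 1) * k * (k + 1) * (k + 2)))"
      using k by (simp add: divide_simps) (simp add: algebra_simps)
    finally show ?thesis by (simp add: pair_freq_def k_def)
  qed
  have "(real j - 1) * pair_freq (i + j - 1) - real j * pair_freq (i + j)
    + ((real i - 1) * pair_freq (j + i - 1) - real i * pair_freq (j + i))
    = (k - 2) * pair_freq (i + j - 1) - k * pair_freq (i + j)"
    by (simp add: k_def add.commute algebra_simps)
  also have "\<dots> = 2 * pair_freq (i + j)" using * by (simp add: algebra_simps)
  finally show ?thesis using False by simp
qed

text \<open>Summation by parts moves the drift onto the kernel. Because the remaining form is summed against a
symmetric expression in \<open>i\<close> and \<open>j\<close>, its kernel may be symmetrised, which makes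
\<open>pair_freq_recurrence\<close> applicable.\<close>

lemma pair_form_drift:
  assumes "weights M e s"
  shows "pair_form M s (drift s) = pair_form M s s - 2 * (s 1)\<^sup>2"
proof -
  define f where "f i j = (real j - 1) * pair_freq (i + j - 1) - real j * pair_freq (i + j)" for i j
  have parts: "(\<Sum>j=1..K. drift s j * pair_freq (i + j)) =
      real K * pair_freq (i + K) * s (Suc K) + (\<Sum>j=1..K. s j * f i j)" for K i
  proof (induction K)
    case (Suc K)
    then show ?case by (simp add: drift_def f_def algebra_simps)
  qed simp
  have "pair_form M s (drift s) = (\<Sum>i=1..M. s i * (\<Sum>j=1..M. drift s j * pair_freq (i + j)))"
    by (simp add: pair_form_def sum_distrib_left mult.assoc)
  also have "\<dots> = (\<Sum>i=1..M. \<Sum>j=1..M. s i * s j * f i j)"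
    unfolding parts using assms by (simp add: weights_zero_above sum_distrib_left mult.assoc)
  finally have A: "pair_form M s (drift s) = (\<Sum>i=1..M. \<Sum>j=1..M. s i * s j * f i j)" .
  also have "\<dots> = (\<Sum>i=1..M. \<Sum>j=1..M. s i * s j * f j i)"
    by (subst sum.swap) (simp add: mult.commute)
  finally have "2 * pair_form M s (drift s) = (\<Sum>i=1..M. \<Sum>j=1..M. s i * s j * (f i j + f j i))"
    using A by (simp add: sum.distrib distrib_left)
  also have "\<dots> = (\<Sum>i=1..M. \<Sum>j=1..M. 2 * (s i * s j * pair_freq (i + j)) -
      (if j = 1 then if i = 1 then 4 * (s 1)\<^sup>2 else 0 else 0))"
  proof (intro sum.cong refl)
    fix i j assume "i \<in> {1..M}" "j \<in> {1..M}"
    then have eq: "f i j + f j i = 2 * pair_freq (i + j) - (if i = 1 \<and> j = 1 then 4 else 0)"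
      unfolding f_def by (intro pair_freq_recurrence) auto
    show "s i * s j * (f i j + f j i) = 2 * (s i * s j * pair_freq (i + j)) -
        (if j = 1 then if i = 1 then 4 * (s 1)\<^sup>2 else 0 else 0)"
      unfolding eq by (auto simp: algebra_simps power2_eq_square)
  qed
  also have "\<dots> = 2 * pair_form M s s - (\<Sum>i=1..M. \<Sum>j=1..M.
      (if j = 1 then if i = 1 then 4 * (s 1)\<^sup>2 else 0 else 0))"
    by (simp add: sum_subtractf pair_form_def sum_distrib_left)
  also have "(\<Sum>i=1..M. \<Sum>j=1..M. (if j = 1 then if i = 1 then 4 * (s 1)\<^sup>2 else 0 else 0)) = 4 * (s 1)\<^sup>2"
    using weights_zero_above[OF assms, of 1] by (cases "M = 0") (simp_all add: sum.delta')
  finally show ?thesis by simp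
qed

text \<open>This identifies the covariance matrix: the form \<open>n \<sigma>\<close> is reproduced, up to lower order, when one
step of the process transports it along the flow and adds the variance of the step. The terms left
over after \<open>pair_form_drift\<close> telescope by \<open>sum_growth_rate_diff\<close> for the squared weights.\<close>

lemma cov_form_lyapunov:
  assumes "weights M e s"
  shows "cov_form M s s = cov_form M s (drift s) + step_variance M s"
proof -
  have "(\<Sum>l=1..M. growth_rate l * (s (Suc l) - s l)\<^sup>2) / 2 + (\<Sum>l=1..M. block_freq l * s l * drift s l)
      = (\<Sum>l=1..M. growth_rate l * ((s (Suc l))\<^sup>2 - (s l)\<^sup>2)) / 2"
    unfolding sum_divide_distrib sum.distrib[symmetric]
    by (intro sum.cong refl) (auto simp: growth_rate_eq drift_def power2_eq_square field_simps)
  also have "\<dots> = freq_sum M (\<lambda>l. (s l)\<^sup>2) - (s 1)\<^sup>2"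
    using sum_growth_rate_diff[of "\<lambda>l. (s l)\<^sup>2" M] weights_zero_above[OF assms, of "Suc M"] by simp
  also have "freq_sum M (\<lambda>l. (s l)\<^sup>2) = (\<Sum>l=1..M. block_freq l * s l * s l)"
    by (simp add: freq_sum_def power2_eq_square mult.assoc)
  finally show ?thesis
    unfolding cov_form_eq pair_form_drift[OF assms] freq_sum_drift[OF assms] step_variance_def
    by (simp add: power2_eq_square algebra_simps)
qed

lemma cov_form_add:
  "cov_form M (\<lambda>l. s l + a * t l) (\<lambda>l. s l + a * t l) =
     cov_form M s s + 2 * a * cov_form M s t + a\<^sup>2 * cov_form M t t"
proof -
  have sym: "block_cov i j = block_cov j i" for i j
    by (simp add: block_cov_def add.commute mult.commute)
  have "cov_form M t s = cov_form M s t"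
    unfolding cov_form_def by (subst sum.swap) (simp add: sym mult.commute mult.left_commute)
  moreover have "cov_form M (\<lambda>l. s l + a * t l) (\<lambda>l. s l + a * t l) =
     cov_form M s s + a * cov_form M s t + a * cov_form M t s + a\<^sup>2 * cov_form M t t"
    by (simp add: cov_form_def sum_distrib_left sum.distrib[symmetric] algebra_simps power2_eq_square)
  ultimately show ?thesis by simp
qed

lemma cov_form_bound:
  obtains C where "C \<ge> 0" "\<And>s t e f. weights M e s \<Longrightarrow> weights M f t \<Longrightarrow> \<bar>cov_form M s t\<bar> \<le> C * (e * f)"
proof
  define C where "C = (\<Sum>i=1..M. \<Sum>j=1..M. \<bar>block_cov i j\<bar>)"
  show "C \<ge> 0" unfolding C_def by (intro sum_nonneg) auto
  fix s t e f assume w: "weights M e s" "weights M f t"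
  have "\<bar>cov_form M s t\<bar> \<le> (\<Sum>i=1..M. \<bar>\<Sum>j=1..M. s i * t j * block_cov i j\<bar>)"
    unfolding cov_form_def by (rule sum_abs)
  also have "\<dots> \<le> (\<Sum>i=1..M. \<Sum>j=1..M. \<bar>s i * t j * block_cov i j\<bar>)"
    by (intro sum_mono sum_abs)
  also have "\<dots> \<le> (\<Sum>i=1..M. \<Sum>j=1..M. e * f * \<bar>block_cov i j\<bar>)"
    using w weights_nonneg[OF w(1)] weights_nonneg[OF w(2)]
    by (intro sum_mono) (auto simp: abs_mult intro!: mult_mono weights_bound)
  finally show "\<bar>cov_form M s t\<bar> \<le> C * (e * f)"
    by (simp add: C_def sum_distrib_left sum_distrib_right mult.commute)
qed

section \<open>Moments of the centred statistics\<close>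

abbreviation game_expectation :: "nat \<Rightarrow> (card list \<Rightarrow> 'a :: {banach, second_countable_topology}) \<Rightarrow> 'a" where
  "game_expectation n f \<equiv> measure_pmf.expectation (random_game n) f"

lemma set_pmf_random_game: "set_pmf (random_game n) = games n"
  by (simp add: random_game_def games_nonempty finite_games)

lemma integrable_random_game:
  fixes f :: "card list \<Rightarrow> 'a :: {banach, second_countable_topology}"
  shows "integrable (measure_pmf (random_game n)) f"
  by (rule integrable_measure_pmf_finite) (simp add: set_pmf_random_game finite_games)

lemma game_expectation_mono:
  fixes f g :: "card list \<Rightarrow> real"
  assumes "\<And>xs. xs \<in> games n \<Longrightarrow> f xs \<le> g xs"
  shows "game_expectation n f \<le> game_expectation n g"
  by (intro integral_mono_AE integrable_random_game)
    (simp add: AE_measure_pmf_iff set_pmf_random_game assms)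

lemma game_expectation_cong:
  fixes f g :: "card list \<Rightarrow> 'a :: {banach, second_countable_topology}"
  assumes "\<And>xs. xs \<in> games n \<Longrightarrow> f xs = g xs"
  shows "game_expectation n f = game_expectation n g"
  by (intro integral_cong_AE) (simp_all add: AE_measure_pmf_iff set_pmf_random_game assms)

definition centred :: "nat \<Rightarrow> nat \<Rightarrow> (nat \<Rightarrow> real) \<Rightarrow> card list \<Rightarrow> real" where
  "centred M n s xs = block_sum s xs - real n * freq_sum M s"

lemma centred_linear:
  "centred M n (\<lambda>l. s l + a * t l) xs = centred M n s xs + a * centred M n t xs"
  by (simp add: centred_def block_sum_def freq_sum_def sum_list_addf sum_list_const_mult
      distrib_left sum.distrib sum_distrib_left mult.left_commute right_diff_distrib)

lemma centred_flow:
  "centred M n (flow n s) xs = centred M n s xs + centred M n (drift s) xs / real (2 * n + 1)"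
  using centred_linear[of M n s "1 / real (2 * n + 1)" "drift s" xs]
  by (simp add: flow_def[abs_def])

lemma centred_bound:
  assumes "xs \<in> games n" "weights M e s"
  shows "\<bar>centred M n s xs\<bar> \<le> 2 * real n * e"
proof -
  have "\<bar>\<Sum>l\<leftarrow>ls. s l\<bar> \<le> real (length ls) * e" for ls
    by (induction ls)
      (auto intro!: order_trans[OF abs_triangle_ineq] add_mono weights_bound[OF assms(2)] simp: distrib_right)
  from this[of "block_lengths (map snd xs)"] have "\<bar>block_sum s xs\<bar> \<le> real n * e"
    using num_blocks_eq_count(2)[OF assms(1)] by (simp add: block_sum_def)
  moreover have "\<bar>real n * freq_sum M s\<bar> \<le> real n * e"
    using freq_sum_bound[OF assms(2)] by (simp add: abs_mult mult_left_mono)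
  ultimately show ?thesis unfolding centred_def by linarith
qed

text \<open>The increment of the centred statistic when a block of length \<open>l\<close> grows.\<close>

definition noise :: "nat \<Rightarrow> (nat \<Rightarrow> real) \<Rightarrow> nat \<Rightarrow> real" where
  "noise M s l = increment s l - freq_sum M s"

lemma noise_bound:
  assumes "weights M e s"
  shows "\<bar>noise M s l\<bar> \<le> 4 * e"
  using weights_bound[OF assms, of l] weights_bound[OF assms, of "Suc l"] weights_bound[OF assms, of 1]
    freq_sum_bound[OF assms]
  unfolding noise_def increment_def by linarith

text \<open>The block lengths together with the virtual block of length 1.\<close>

abbreviation slots :: "card list \<Rightarrow> nat list" where
  "slots xs \<equiv> 1 # block_lengths (map snd xs)"

lemma sum_slots: "xs \<in> games n \<Longrightarrow> (\<Sum>l\<leftarrow>slots xs. real l) = real (2 * n + 1)"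
proof -
  assume xs: "xs \<in> games n"
  have "(\<Sum>l\<leftarrow>ls. real l) = real (sum_list ls)" for ls by (induction ls) auto
  then show ?thesis
    using sum_list_block_lengths[OF ends_red_game[OF xs]] length_game[OF xs] by simp
qed

lemma sum_slots_noise:
  assumes "xs \<in> games n" "weights M e s"
  shows "(\<Sum>l\<leftarrow>slots xs. real l * noise M s l) = centred M n (drift s) xs + (s 2 - freq_sum M s)"
proof -
  have "(\<Sum>l\<leftarrow>ls. real l * noise M s l) = (\<Sum>l\<leftarrow>ls. drift s l) + (s 1 - freq_sum M s) * (\<Sum>l\<leftarrow>ls. real l)" for ls
    by (induction ls) (simp_all add: drift_def noise_def increment_def algebra_simps)
  from this[of "slots xs"] have "(\<Sum>l\<leftarrow>slots xs. real l * noise M s l) =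
      drift s 1 + block_sum (drift s) xs + (s 1 - freq_sum M s) * real (2 * n + 1)"
    using sum_slots[OF assms(1)] by (simp add: block_sum_def)
  also have "\<dots> = centred M n (drift s) xs + (s 2 - freq_sum M s)"
    unfolding centred_def freq_sum_drift[OF assms(2)]
    by (simp add: drift_def numeral_2_eq_2 algebra_simps)
  finally show ?thesis .
qed

text \<open>The part of \<open>l (noise M s l)\<^sup>2\<close> that vanishes for large \<open>l\<close>. What remains is the constant multiple
\<open>(s 1 - freq_sum M s)\<^sup>2\<close> of \<open>l\<close>, whose sum over all slots is deterministic.\<close>

definition square_weights :: "nat \<Rightarrow> (nat \<Rightarrow> real) \<Rightarrow> nat \<Rightarrow> real" where
  "square_weights M s l = real l * (s (Suc l) - s l)\<^sup>2 + 2 * (s 1 - freq_sum M s) * drift s l"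

lemma weights_square_weights:
  assumes "weights M e s"
  shows "weights M (12 * real M * e\<^sup>2) (square_weights M s)"
  unfolding weights_def
proof (intro conjI allI impI)
  have e: "e \<ge> 0" using weights_nonneg[OF assms] .
  fix l
  show "\<bar>square_weights M s l\<bar> \<le> 12 * real M * e\<^sup>2"
  proof (cases "l \<le> M")
    case True
    have "(s (Suc l) - s l)\<^sup>2 \<le> (2 * e)\<^sup>2"
      using weights_diff[OF assms, of l] e by (intro iffD1[OF abs_le_square_iff]) simp
    then have 1: "real l * (s (Suc l) - s l)\<^sup>2 \<le> real M * (2 * e)\<^sup>2"
      using True by (intro mult_mono) auto
    have "\<bar>s 1 - freq_sum M s\<bar> \<le> 2 * e"
      using weights_bound[OF assms, of 1] freq_sum_bound[OF assms] by linarith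
    then have "\<bar>s 1 - freq_sum M s\<bar> * \<bar>drift s l\<bar> \<le> (2 * e) * (2 * real M * e)"
      using weights_bound[OF weights_drift[OF assms], of l] e by (intro mult_mono) auto
    moreover have "\<bar>2 * (s 1 - freq_sum M s) * drift s l\<bar> =
        2 * (\<bar>s 1 - freq_sum M s\<bar> * \<bar>drift s l\<bar>)"
      by (simp only: abs_mult abs_numeral mult.assoc)
    ultimately have 2: "\<bar>2 * (s 1 - freq_sum M s) * drift s l\<bar> \<le> 2 * ((2 * e) * (2 * real M * e))"
      by linarith
    have "\<bar>square_weights M s l\<bar> \<le> real l * (s (Suc l) - s l)\<^sup>2 + \<bar>2 * (s 1 - freq_sum M s) * drift s l\<bar>"
      unfolding square_weights_def by (rule order_trans[OF abs_triangle_ineq]) simp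
    then show ?thesis using 1 2 by (simp add: power2_eq_square algebra_simps)
  next
    case False
    then show ?thesis using assms by (simp add: square_weights_def drift_def weights_zero_above)
  qed
qed (use assms in \<open>simp add: square_weights_def drift_def weights_zero_above\<close>)

lemma sum_slots_noise_square:
  assumes "xs \<in> games n" "weights M e s"
  shows "(\<Sum>l\<leftarrow>slots xs. real l * (noise M s l)\<^sup>2) =
    real (2 * n + 1) * step_variance M s + centred M n (square_weights M s) xs
      + ((noise M s 1)\<^sup>2 - step_variance M s)"
proof -
  define a where "a = s 1 - freq_sum M s"
  have "(\<Sum>l\<leftarrow>ls. real l * (noise M s l)\<^sup>2) = (\<Sum>l\<leftarrow>ls. square_weights M s l) + a\<^sup>2 * (\<Sum>l\<leftarrow>ls. real l)" for ls
    by (induction ls)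
      (simp_all add: drift_def noise_def increment_def square_weights_def a_def power2_eq_square algebra_simps)
  from this[of "slots xs"] this[of "[1]"]
  have sq: "(\<Sum>l\<leftarrow>slots xs. real l * (noise M s l)\<^sup>2) =
      (noise M s 1)\<^sup>2 + block_sum (square_weights M s) xs + a\<^sup>2 * (2 * real n)"
    using sum_slots[OF assms(1)] by (simp add: block_sum_def algebra_simps)
  have fs: "freq_sum M (square_weights M s) = 2 * step_variance M s - 2 * a\<^sup>2"
  proof -
    have "freq_sum M (square_weights M s) =
        freq_sum M (\<lambda>l. real l * (s (Suc l) - s l)\<^sup>2) + 2 * a * freq_sum M (drift s)"
      by (simp add: freq_sum_def square_weights_def a_def distrib_left sum.distrib sum_distrib_left
          mult.left_commute)
    also have "freq_sum M (\<lambda>l. real l * (s (Suc l) - s l)\<^sup>2) =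
        (\<Sum>l=1..M. growth_rate l * (s (Suc l) - s l)\<^sup>2)"
      unfolding freq_sum_def by (intro sum.cong refl) (auto simp: growth_rate_eq)
    finally show ?thesis
      unfolding freq_sum_drift[OF assms(2)]
      by (simp add: step_variance_def a_def power2_eq_square algebra_simps)
  qed
  show ?thesis
    unfolding sq centred_def fs by (simp add: algebra_simps)
qed

text \<open>Given the past, one step changes the square of the centred statistic \<open>D\<close> in mean by
\<open>2 D A / (2 n + 1)\<close> plus terms of order \<open>e\<^sup>2\<close>, where \<open>A\<close> is the statistic of the drift. The first of
these is dominated by completing the square, which yields the statistic of the flowed weights.
So every step costs at most \<open>20 e\<^sup>2\<close>.\<close>

lemma second_moment_bound:
  assumes "weights M e s"
  shows "game_expectation n (\<lambda>xs. (centred M n s xs)\<^sup>2) \<le> ((real M + 1)\<^sup>2 + 20) * (real n + 1) * e\<^sup>2"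
proof -
  define C where "C = (real M + 1)\<^sup>2 + 20"
  have "game_expectation n (\<lambda>xs. (centred M n s xs)\<^sup>2) \<le> ((real M + 1)\<^sup>2 + 20 * real n) * e\<^sup>2"
    using assms
  proof (induction n arbitrary: s)
    case 0
    then have "game_expectation 0 (\<lambda>xs. (centred M 0 s xs)\<^sup>2) \<le> game_expectation 0 (\<lambda>xs. 0)"
      using centred_bound[of _ 0] by (intro game_expectation_mono) force
    then show ?case by (simp add: order_trans)
  next
    case (Suc n)
    note w = Suc.prems
    have e: "e \<ge> 0" using weights_nonneg[OF w] .
    show ?case
    proof (cases "M \<le> 2 * n + 1")
      case False
      have "game_expectation (Suc n) (\<lambda>xs. (centred M (Suc n) s xs)\<^sup>2)
          \<le> game_expectation (Suc n) (\<lambda>xs. (real M + 1)\<^sup>2 * e\<^sup>2)"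
      proof (rule game_expectation_mono)
        fix xs assume xs: "xs \<in> games (Suc n)"
        have "\<bar>centred M (Suc n) s xs\<bar> \<le> 2 * real (Suc n) * e" by (rule centred_bound[OF xs w])
        also have "\<dots> \<le> (real M + 1) * e" using False e by (intro mult_right_mono) auto
        finally have "\<bar>centred M (Suc n) s xs\<bar>\<^sup>2 \<le> ((real M + 1) * e)\<^sup>2"
          by (intro power_mono) auto
        then show "(centred M (Suc n) s xs)\<^sup>2 \<le> (real M + 1)\<^sup>2 * e\<^sup>2"
          by (simp add: power_mult_distrib)
      qed
      also have "\<dots> \<le> ((real M + 1)\<^sup>2 + 20 * real (Suc n)) * e\<^sup>2"
        by (simp add: mult_right_mono)
      finally show ?thesis .
    next
      case True
      define T where "T = real (2 * n + 1)"
      have T: "T > 0" "T \<ge> 2 * real n" by (auto simp: T_def)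
      have "game_expectation (Suc n) (\<lambda>xs. (centred M (Suc n) s xs)\<^sup>2) =
        game_expectation n (\<lambda>xs. (\<Sum>l\<leftarrow>slots xs. real l *\<^sub>R
          (block_sum s xs + increment s l - real (Suc n) * freq_sum M s)\<^sup>2) /\<^sub>R T)"
        unfolding centred_def T_def
        by (rule expectation_random_game_Suc[of n "\<lambda>x. (x - real (Suc n) * freq_sum M s)\<^sup>2"])
      also have "\<dots> \<le> game_expectation n (\<lambda>xs. (centred M n (flow n s) xs)\<^sup>2 + 20 * e\<^sup>2)"
      proof (rule game_expectation_mono)
        fix xs assume xs: "xs \<in> games n"
        define D where "D = centred M n s xs"
        define A where "A = centred M n (drift s) xs"
        define b where "b = s 2 - freq_sum M s"
        have b: "\<bar>b\<bar> \<le> 2 * e"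
          using weights_bound[OF w, of 2] freq_sum_bound[OF w] unfolding b_def by linarith
        have D: "\<bar>D\<bar> \<le> T * e"
          using centred_bound[OF xs w] mult_right_mono[OF T(2) e] unfolding D_def by linarith
        have noise_sq: "(noise M s l)\<^sup>2 \<le> 16 * e\<^sup>2" for l
        proof -
          have "\<bar>noise M s l\<bar>\<^sup>2 \<le> (4 * e)\<^sup>2" using noise_bound[OF w] by (intro power_mono) auto
          then show ?thesis by (simp add: power_mult_distrib)
        qed
        have "(\<Sum>l\<leftarrow>slots xs. real l *\<^sub>R (block_sum s xs + increment s l - real (Suc n) * freq_sum M s)\<^sup>2)
          \<le> (\<Sum>l\<leftarrow>slots xs. real l * (D\<^sup>2 + 16 * e\<^sup>2) + 2 * D * (real l * noise M s l))"
        proof (rule sum_list_mono)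
          fix l
          have "real l * (D + noise M s l)\<^sup>2 \<le> real l * (D\<^sup>2 + 16 * e\<^sup>2 + 2 * D * noise M s l)"
            using noise_sq[of l] by (intro mult_left_mono) (simp_all add: power2_sum)
          then show "real l *\<^sub>R (block_sum s xs + increment s l - real (Suc n) * freq_sum M s)\<^sup>2
            \<le> real l * (D\<^sup>2 + 16 * e\<^sup>2) + 2 * D * (real l * noise M s l)"
            by (simp add: D_def centred_def noise_def algebra_simps)
        qed
        also have "\<dots> = (\<Sum>l\<leftarrow>slots xs. real l) * (D\<^sup>2 + 16 * e\<^sup>2) + 2 * D * (\<Sum>l\<leftarrow>slots xs. real l * noise M s l)"
          by (simp only: sum_list_addf sum_list_const_mult sum_list_mult_const)
        also have "\<dots> = T * (D\<^sup>2 + 16 * e\<^sup>2) + 2 * D * (A + b)"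
          unfolding sum_slots[OF xs] sum_slots_noise[OF xs w] T_def A_def b_def ..
        finally have "(\<Sum>l\<leftarrow>slots xs. real l *\<^sub>R (block_sum s xs + increment s l - real (Suc n) * freq_sum M s)\<^sup>2) /\<^sub>R T
          \<le> (T * (D\<^sup>2 + 16 * e\<^sup>2) + 2 * D * (A + b)) /\<^sub>R T"
          using T by (intro scaleR_left_mono) auto
        also have "\<dots> = D\<^sup>2 + 16 * e\<^sup>2 + 2 * D * A / T + 2 * (D * b) / T"
          using T by (simp add: field_simps)
        also have "2 * (D * b) / T \<le> 4 * e\<^sup>2"
        proof -
          have "D * b \<le> \<bar>D\<bar> * \<bar>b\<bar>" by (metis abs_ge_self abs_mult)
          also have "\<dots> \<le> (T * e) * (2 * e)" using D b e T by (intro mult_mono) auto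
          finally show ?thesis using T by (simp add: divide_le_eq power2_eq_square algebra_simps)
        qed
        \<comment> \<open>Completing the square only adds the nonnegative term \<open>(A / T)\<^sup>2\<close>.\<close>
        also have "D\<^sup>2 + 16 * e\<^sup>2 + 2 * D * A / T + 4 * e\<^sup>2 \<le> (D + A / T)\<^sup>2 + 20 * e\<^sup>2"
          using zero_le_power2[of "A / T"] by (simp add: power2_sum)
        finally show "(\<Sum>l\<leftarrow>slots xs. real l *\<^sub>R (block_sum s xs + increment s l - real (Suc n) * freq_sum M s)\<^sup>2) /\<^sub>R T
          \<le> (centred M n (flow n s) xs)\<^sup>2 + 20 * e\<^sup>2"
          by (simp add: centred_flow D_def A_def T_def)
      qed
      also have "\<dots> = game_expectation n (\<lambda>xs. (centred M n (flow n s) xs)\<^sup>2) + 20 * e\<^sup>2"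
        by (subst Bochner_Integration.integral_add) (auto intro: integrable_random_game)
      also have "\<dots> \<le> ((real M + 1)\<^sup>2 + 20 * real n) * e\<^sup>2 + 20 * e\<^sup>2"
        using Suc.IH[OF weights_flow[OF w True]] by simp
      finally show ?thesis by (simp add: algebra_simps)
    qed
  qed
  also have "\<dots> \<le> ((real M + 1)\<^sup>2 + 20) * (real n + 1) * e\<^sup>2"
    by (intro mult_right_mono) (simp_all add: algebra_simps)
  finally show ?thesis .
qed

lemma first_moment_bound:
  assumes "weights M e s"
  shows "game_expectation n (\<lambda>xs. \<bar>centred M n s xs\<bar>) \<le> sqrt (((real M + 1)\<^sup>2 + 20) * (real n + 1)) * e"
proof -
  let ?X = "\<lambda>xs. \<bar>centred M n s xs\<bar>"
  have "0 \<le> measure_pmf.variance (random_game n) ?X"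
    by (rule measure_pmf.variance_positive)
  also have "\<dots> = game_expectation n (\<lambda>xs. (?X xs)\<^sup>2) - (game_expectation n ?X)\<^sup>2"
    by (rule measure_pmf.variance_eq) (rule integrable_random_game)+
  finally have "(game_expectation n ?X)\<^sup>2 \<le> ((real M + 1)\<^sup>2 + 20) * (real n + 1) * e\<^sup>2"
    using second_moment_bound[OF assms, of n] by simp
  then have "game_expectation n ?X \<le> sqrt (((real M + 1)\<^sup>2 + 20) * (real n + 1) * e\<^sup>2)"
    by (rule real_le_rsqrt)
  then show ?thesis using weights_nonneg[OF assms] by (simp add: real_sqrt_mult)
qed

section \<open>Convergence of characteristic functions\<close>

lemma iexp_quadratic: "cmod (iexp x - (1 + \<i> * x - x\<^sup>2 / 2)) \<le> \<bar>x\<bar> ^ 3 / 6"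
proof -
  have "(\<Sum>k\<le>2. (\<i> * x) ^ k / fact k) = 1 + \<i> * x - (complex_of_real x)\<^sup>2 / 2"
  proof -
    have "(\<Sum>k\<le>2. f k) = f 0 + f 1 + f 2" for f :: "nat \<Rightarrow> complex"
      by (simp add: numeral_2_eq_2)
    then show ?thesis by (simp add: power_mult_distrib)
  qed
  then show ?thesis using iexp_approx1[of x 2] by (simp add: eval_nat_numeral)
qed

lemma iexp_linear: "cmod (iexp x - (1 + \<i> * x)) \<le> x\<^sup>2 / 2"
proof -
  have "(\<Sum>k\<le>1. (\<i> * x) ^ k / fact k) = 1 + \<i> * x" by simp
  then show ?thesis using iexp_approx1[of x 1] by (simp add: eval_nat_numeral)
qed

lemma iexp_add: "iexp (x + y) = iexp x * iexp y"
  by (simp add: distrib_left exp_add)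

lemma iexp_constant: "cmod (iexp x - 1) \<le> \<bar>x\<bar>"
  using iexp_approx1[of x 0] by simp

lemma sum_list_iexp_quadratic:
  assumes "\<And>l. \<bar>v l\<bar> \<le> (e :: real)"
  shows "cmod ((\<Sum>l\<leftarrow>ls. real l *\<^sub>R iexp (v l)) -
    (of_real (\<Sum>l\<leftarrow>ls. real l) + \<i> * of_real (\<Sum>l\<leftarrow>ls. real l * v l)
      - of_real (\<Sum>l\<leftarrow>ls. real l * (v l)\<^sup>2) / 2)) \<le> (\<Sum>l\<leftarrow>ls. real l) * (e ^ 3 / 6)"
proof (induction ls)
  case (Cons l ls)
  have "\<bar>v l\<bar> ^ 3 \<le> e ^ 3" using assms by (intro power_mono) auto
  then have "cmod (iexp (v l) - (1 + \<i> * v l - (v l)\<^sup>2 / 2)) \<le> e ^ 3 / 6"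
    using iexp_quadratic[of "v l"] by linarith
  then have "cmod (real l *\<^sub>R (iexp (v l) - (1 + \<i> * v l - (v l)\<^sup>2 / 2))) \<le> real l * (e ^ 3 / 6)"
    unfolding norm_scaleR abs_of_nat by (rule mult_left_mono) simp
  from norm_triangle_le[OF add_mono[OF this Cons.IH]] show ?case
    by (simp add: scaleR_conv_of_real algebra_simps diff_divide_distrib add_divide_distrib)
qed simp

definition charf :: "nat \<Rightarrow> nat \<Rightarrow> (nat \<Rightarrow> real) \<Rightarrow> complex" where
  "charf M n s = game_expectation n (\<lambda>xs. iexp (centred M n s xs))"

text \<open>Second-order expansion of the conditional characteristic function of one increment. The leading
fluctuation \<open>centred M n (drift s) / (2 n + 1)\<close> is kept as an exponential, since it merges with the
past into the statistic of the flowed weights. Everything else beyond the variance is an error: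
the bias of the mean, the deviation of the conditional variance from its limit, and the Taylor
remainders.\<close>

lemma charf_Suc_pointwise:
  assumes xs: "xs \<in> games n" and w: "weights M e s" and e1: "e \<le> 1"
  shows "cmod ((\<Sum>l\<leftarrow>slots xs. real l *\<^sub>R iexp (noise M s l)) /\<^sub>R real (2 * n + 1)
      - (1 - step_variance M s / 2) * iexp (centred M n (drift s) xs / real (2 * n + 1)))
    \<le> 12 * e / (real n + 1) + \<bar>centred M n (square_weights M s) xs\<bar> / (real n + 1)
      + (11 + 4 * real M) * e ^ 3 + (centred M n (drift s) xs)\<^sup>2 / (real n + 1)\<^sup>2"
proof -
  define T where "T = real (2 * n + 1)"
  define q where "q = step_variance M s"
  define a where "a = centred M n (drift s) xs"
  define W where "W = centred M n (square_weights M s) xs"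
  define b where "b = s 2 - freq_sum M s"
  define c where "c = (noise M s 1)\<^sup>2 - q"
  define \<alpha> where "\<alpha> = a / T"
  define S where "S = (\<Sum>l\<leftarrow>slots xs. real l *\<^sub>R iexp (noise M s l))"
  define R where "R = S - (of_real T + \<i> * of_real (a + b) - of_real (T * q + W + c) / 2)"
  have e: "e \<ge> 0" using weights_nonneg[OF w] .
  have T: "T \<ge> real n + 1" "T > 0" by (auto simp: T_def)
  have e2: "e\<^sup>2 \<le> e" using e e1 by (simp add: power2_eq_square mult_left_le)
  have q: "0 \<le> q" "q \<le> 4 * e\<^sup>2"
    using step_variance_nonneg[OF w] step_variance_le[OF w] by (auto simp: q_def)
  have b: "\<bar>b\<bar> \<le> 2 * e"
    using weights_bound[OF w, of 2] freq_sum_bound[OF w] unfolding b_def by linarith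
  have "\<bar>noise M s 1\<bar>\<^sup>2 \<le> (4 * e)\<^sup>2" using noise_bound[OF w] by (intro power_mono) auto
  then have "(noise M s 1)\<^sup>2 \<le> 16 * e\<^sup>2" by (simp add: power_mult_distrib)
  then have c: "\<bar>c\<bar> \<le> 20 * e"
    using q e2 e zero_le_power2[of "noise M s 1"] unfolding c_def by linarith
  have "\<bar>a\<bar> \<le> 2 * real n * (2 * real M * e)"
    unfolding a_def by (rule centred_bound[OF xs weights_drift[OF w]])
  also have "\<dots> \<le> T * (2 * real M * e)"
    using e by (intro mult_right_mono) (auto simp: T_def)
  finally have \<alpha>: "\<bar>\<alpha>\<bar> \<le> 2 * real M * e"
    using T by (simp add: \<alpha>_def abs_divide divide_le_eq mult.commute)
  have R: "cmod R \<le> T * (11 * e ^ 3)"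
  proof -
    \<comment> \<open>Here \<open>4 ^ 3 / 6 < 11\<close>.\<close>
    have "cmod R \<le> T * ((4 * e) ^ 3 / 6)"
      using sum_list_iexp_quadratic[of "noise M s" "4 * e" "slots xs", OF noise_bound[OF w]]
      unfolding R_def S_def sum_slots[OF xs] sum_slots_noise[OF xs w] sum_slots_noise_square[OF xs w]
      unfolding T_def a_def W_def b_def c_def q_def by (simp add: add.assoc)
    also have "\<dots> \<le> T * (11 * e ^ 3)"
      using T e by (intro mult_left_mono) (simp_all add: power_mult_distrib)
    finally show ?thesis .
  qed
  have S_R: "S = R + (of_real T + \<i> * of_real (a + b) - of_real (T * q + W + c) / 2)"
    by (simp add: R_def)
  then have S: "S /\<^sub>R T = R /\<^sub>R T + 1 + \<i> * \<alpha> + \<i> * (b / T) - q / 2 - W / T / 2 - c / T / 2"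
  proof -
    have "z /\<^sub>R T = z / complex_of_real T" for z
      by (simp add: scaleR_conv_of_real divide_inverse mult.commute)
    then show ?thesis
      unfolding S_R using T
      by (simp add: \<alpha>_def add_divide_distrib diff_divide_distrib distrib_left mult.commute)
  qed
  have "S /\<^sub>R T - (1 - q / 2) * iexp \<alpha> =
      (R /\<^sub>R T + \<i> * (b / T)) + (- (W / T / 2) - c / T / 2)
      + (- (iexp \<alpha> - (1 + \<i> * \<alpha>)) + (q / 2) * (iexp \<alpha> - 1))"
    unfolding S by (simp add: algebra_simps)
  also have "cmod \<dots> \<le> (11 * e ^ 3 + 2 * e / T) + (\<bar>W\<bar> / T + 10 * e / T)
      + (\<alpha>\<^sup>2 + 4 * real M * e ^ 3)"
  proof (intro norm_triangle_mono)
    show "cmod (R /\<^sub>R T) \<le> 11 * e ^ 3"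
    proof -
      have "cmod (R /\<^sub>R T) = cmod R / T" using T by (simp add: divide_inverse mult.commute)
      then show ?thesis using R T by (simp add: divide_le_eq mult.commute)
    qed
    show "cmod (\<i> * (b / T)) \<le> 2 * e / T"
      using b T by (simp add: norm_mult norm_divide divide_right_mono)
    have "\<bar>- (W / T / 2) - c / T / 2\<bar> \<le> \<bar>W / T / 2\<bar> + \<bar>c / T / 2\<bar>" by linarith
    also have "\<dots> = \<bar>W\<bar> / T / 2 + \<bar>c\<bar> / T / 2" using T by (simp add: abs_divide)
    also have "\<dots> \<le> \<bar>W\<bar> / T + 20 * e / T / 2"
    proof (rule add_mono)
      have "x / 2 \<le> x" if "0 \<le> x" for x :: real using that by simp
      then show "\<bar>W\<bar> / T / 2 \<le> \<bar>W\<bar> / T" using T by (simp only: divide_nonneg_pos abs_ge_zero)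
      show "\<bar>c\<bar> / T / 2 \<le> 20 * e / T / 2" using T c by (intro divide_right_mono) auto
    qed
    finally show "cmod (complex_of_real (- (W / T / 2) - c / T / 2)) \<le> \<bar>W\<bar> / T + 10 * e / T"
      unfolding norm_of_real by simp
    show "cmod (- (iexp \<alpha> - (1 + \<i> * \<alpha>))) \<le> \<alpha>\<^sup>2"
      using iexp_linear[of \<alpha>] zero_le_power2[of \<alpha>] unfolding norm_minus_cancel by linarith
    have "cmod (complex_of_real (q / 2) * (iexp \<alpha> - 1)) = q / 2 * cmod (iexp \<alpha> - 1)"
      using q by (simp add: norm_mult norm_divide)
    also have "\<dots> \<le> 2 * e\<^sup>2 * (2 * real M * e)"
      using q e iexp_constant[of \<alpha>] \<alpha> by (intro mult_mono) auto
    also have "\<dots> = 4 * real M * e ^ 3"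
      by (simp add: power2_eq_square power3_eq_cube)
    finally show "cmod (complex_of_real (q / 2) * (iexp \<alpha> - 1)) \<le> 4 * real M * e ^ 3" .
  qed
  also have "\<dots> \<le> 12 * e / (real n + 1) + \<bar>W\<bar> / (real n + 1)
      + (11 + 4 * real M) * e ^ 3 + a\<^sup>2 / (real n + 1)\<^sup>2"
  proof -
    have "12 * e / T \<le> 12 * e / (real n + 1)" using T e by (intro divide_left_mono) auto
    moreover have "\<bar>W\<bar> / T \<le> \<bar>W\<bar> / (real n + 1)" using T by (intro divide_left_mono) auto
    moreover have "a\<^sup>2 / T\<^sup>2 \<le> a\<^sup>2 / (real n + 1)\<^sup>2"
      using T by (intro divide_left_mono power_mono mult_pos_pos) auto
    moreover have "\<alpha>\<^sup>2 = a\<^sup>2 / T\<^sup>2" by (simp add: \<alpha>_def power_divide)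
    moreover have "2 * e / T + 10 * e / T = 12 * e / T"
      unfolding add_divide_distrib[symmetric] by simp
    moreover have "(11 + 4 * real M) * e ^ 3 = 11 * e ^ 3 + 4 * real M * e ^ 3"
      by (rule distrib_right)
    ultimately show ?thesis by linarith
  qed
  finally show ?thesis by (simp add: S_def T_def a_def W_def q_def \<alpha>_def)
qed

text \<open>Taking expectations in the previous expansion, the fluctuations in the error terms are controlled by
their moments, which is where the term \<open>e\<^sup>2 / sqrt (real n + 1)\<close> comes from.\<close>

lemma charf_Suc:
  obtains K where "K \<ge> 0"
    "\<And>n s e. weights M e s \<Longrightarrow> e \<le> 1 \<Longrightarrow>
      cmod (charf M (Suc n) s - (1 - step_variance M s / 2) * charf M n (flow n s))
        \<le> K * (e / (real n + 1) + e\<^sup>2 / sqrt (real n + 1) + e ^ 3)"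
proof
  define C where "C = (real M + 1)\<^sup>2 + 20"
  define K where "K = 23 + 4 * real M + 12 * real M * sqrt C + 4 * (real M)\<^sup>2 * C"
  have C: "C \<ge> 0" by (simp add: C_def)
  then show "K \<ge> 0" by (simp add: K_def)
  fix n s e assume w: "weights M e s" and e1: "e \<le> 1"
  have e: "e \<ge> 0" using weights_nonneg[OF w] .
  define N where "N = real n + 1"
  have N: "N > 0" by (simp add: N_def)
  define q where "q = step_variance M s"
  let ?avg = "\<lambda>xs. (\<Sum>l\<leftarrow>slots xs. real l *\<^sub>R iexp (noise M s l)) /\<^sub>R real (2 * n + 1)"
  let ?rot = "\<lambda>xs. iexp (centred M n (drift s) xs / real (2 * n + 1))"
  have "charf M (Suc n) s = game_expectation n (\<lambda>xs. (\<Sum>l\<leftarrow>slots xs. real l *\<^sub>R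
      iexp (block_sum s xs + increment s l - real (Suc n) * freq_sum M s)) /\<^sub>R real (2 * n + 1))"
    unfolding charf_def centred_def
    by (rule expectation_random_game_Suc[of n "\<lambda>x. iexp (x - real (Suc n) * freq_sum M s)"])
  also have "\<dots> = game_expectation n (\<lambda>xs. iexp (centred M n s xs) * ?avg xs)"
  proof (rule game_expectation_cong)
    fix xs
    have *: "iexp (block_sum s xs + increment s l - real (Suc n) * freq_sum M s) =
        iexp (centred M n s xs) * iexp (noise M s l)" for l
      unfolding iexp_add[symmetric] by (simp add: centred_def noise_def algebra_simps)
    have "(\<Sum>l\<leftarrow>ls. real l *\<^sub>R (z * iexp (noise M s l))) = z * (\<Sum>l\<leftarrow>ls. real l *\<^sub>R iexp (noise M s l))" for z ls
      by (induction ls) (simp_all add: distrib_left)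
    then show "(\<Sum>l\<leftarrow>slots xs. real l *\<^sub>R iexp (block_sum s xs + increment s l - real (Suc n) * freq_sum M s))
        /\<^sub>R real (2 * n + 1) = iexp (centred M n s xs) * ?avg xs"
      by (simp only: * mult_scaleR_right)
  qed
  finally have 1: "charf M (Suc n) s = game_expectation n (\<lambda>xs. iexp (centred M n s xs) * ?avg xs)" .
  have 2: "(1 - q / 2) * charf M n (flow n s) =
      game_expectation n (\<lambda>xs. iexp (centred M n s xs) * ((1 - q / 2) * ?rot xs))"
    unfolding charf_def integral_mult_right_zero[symmetric]
    by (rule game_expectation_cong) (simp only: centred_flow iexp_add mult.left_commute)
  have "charf M (Suc n) s - (1 - q / 2) * charf M n (flow n s) =
      game_expectation n (\<lambda>xs. iexp (centred M n s xs) * ?avg xs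
        - iexp (centred M n s xs) * ((1 - q / 2) * ?rot xs))"
    unfolding 1 2
    by (rule Bochner_Integration.integral_diff[symmetric]) (rule integrable_random_game)+
  then have 3: "charf M (Suc n) s - (1 - q / 2) * charf M n (flow n s) =
      game_expectation n (\<lambda>xs. iexp (centred M n s xs) * (?avg xs - (1 - q / 2) * ?rot xs))"
    by (simp only: right_diff_distrib)
  have "cmod (charf M (Suc n) s - (1 - q / 2) * charf M n (flow n s))
      \<le> game_expectation n (\<lambda>xs. cmod (iexp (centred M n s xs) * (?avg xs - (1 - q / 2) * ?rot xs)))"
    unfolding 3 by (rule integral_norm_bound)
  also have "\<dots> \<le> game_expectation n (\<lambda>xs. 12 * e / N + \<bar>centred M n (square_weights M s) xs\<bar> / N
      + (11 + 4 * real M) * e ^ 3 + (centred M n (drift s) xs)\<^sup>2 / N\<^sup>2)"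
  proof (rule game_expectation_mono)
    fix xs assume xs: "xs \<in> games n"
    have unit: "cmod (iexp x * z) = cmod z" for x z by (simp add: norm_mult)
    show "cmod (iexp (centred M n s xs) * (?avg xs - (1 - q / 2) * ?rot xs))
      \<le> 12 * e / N + \<bar>centred M n (square_weights M s) xs\<bar> / N
        + (11 + 4 * real M) * e ^ 3 + (centred M n (drift s) xs)\<^sup>2 / N\<^sup>2"
      unfolding unit unfolding q_def N_def by (rule charf_Suc_pointwise[OF xs w e1])
  qed
  also have "\<dots> = 12 * e / N + game_expectation n (\<lambda>xs. \<bar>centred M n (square_weights M s) xs\<bar>) / N
      + (11 + 4 * real M) * e ^ 3 + game_expectation n (\<lambda>xs. (centred M n (drift s) xs)\<^sup>2) / N\<^sup>2"
    using integrable_random_game[of n, where 'a = real]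
    by (simp only: Bochner_Integration.integral_add integral_divide_zero lebesgue_integral_const
        measure_pmf.prob_space scaleR_one Bochner_Integration.integrable_add)
  also have "\<dots> \<le> 12 * e / N + sqrt C * sqrt N * (12 * real M * e\<^sup>2) / N
      + (11 + 4 * real M) * e ^ 3 + C * N * (2 * real M * e)\<^sup>2 / N\<^sup>2"
  proof -
    have "game_expectation n (\<lambda>xs. \<bar>centred M n (square_weights M s) xs\<bar>)
        \<le> sqrt C * sqrt N * (12 * real M * e\<^sup>2)"
      using first_moment_bound[OF weights_square_weights[OF w], of n]
      unfolding C_def N_def real_sqrt_mult .
    moreover have "game_expectation n (\<lambda>xs. (centred M n (drift s) xs)\<^sup>2) \<le> C * N * (2 * real M * e)\<^sup>2"
      using second_moment_bound[OF weights_drift[OF w], of n] unfolding C_def N_def .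
    ultimately show ?thesis using N by (intro add_mono divide_right_mono order_refl) simp_all
  qed
  also have "sqrt C * sqrt N * (12 * real M * e\<^sup>2) / N = 12 * real M * sqrt C * (e\<^sup>2 / sqrt N)"
  proof -
    have "c * r * (k * x) / (r * r) = k * c * (x / r)" for c r k x :: real by simp
    from this[of "sqrt C" "sqrt N"] show ?thesis using N by simp
  qed
  also have "C * N * (2 * real M * e)\<^sup>2 / N\<^sup>2 = 4 * (real M)\<^sup>2 * C * (e\<^sup>2 / N)"
    using N by (simp add: power2_eq_square)
  also have "12 * e / N + 12 * real M * sqrt C * (e\<^sup>2 / sqrt N) + (11 + 4 * real M) * e ^ 3
      + 4 * (real M)\<^sup>2 * C * (e\<^sup>2 / N) \<le> K * (e / N) + K * (e\<^sup>2 / sqrt N) + K * e ^ 3"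
  proof -
    have "e\<^sup>2 / N \<le> e / N"
      using e e1 N by (intro divide_right_mono) (auto simp: power2_eq_square mult_left_le)
    then have "4 * (real M)\<^sup>2 * C * (e\<^sup>2 / N) \<le> 4 * (real M)\<^sup>2 * C * (e / N)"
      using C by (intro mult_left_mono) auto
    moreover have "(12 + 4 * (real M)\<^sup>2 * C) * (e / N) \<le> K * (e / N)"
      using C e N by (intro mult_right_mono) (auto simp: K_def)
    moreover have "12 * real M * sqrt C * (e\<^sup>2 / sqrt N) \<le> K * (e\<^sup>2 / sqrt N)"
      using C e N by (intro mult_right_mono) (auto simp: K_def)
    moreover have "(11 + 4 * real M) * e ^ 3 \<le> K * e ^ 3"
      using C e N by (intro mult_right_mono) (auto simp: K_def)
    moreover have "(12 + 4 * (real M)\<^sup>2 * C) * (e / N) = 12 * e / N + 4 * (real M)\<^sup>2 * C * (e / N)"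
      by (simp add: distrib_right add_divide_distrib)
    ultimately show ?thesis by linarith
  qed
  finally show "cmod (charf M (Suc n) s - (1 - step_variance M s / 2) * charf M n (flow n s))
      \<le> K * (e / (real n + 1) + e\<^sup>2 / sqrt (real n + 1) + e ^ 3)"
    by (simp add: q_def N_def distrib_left)
qed

definition gauss :: "nat \<Rightarrow> nat \<Rightarrow> (nat \<Rightarrow> real) \<Rightarrow> real" where
  "gauss M n s = exp (- (real n * cov_form M s s) / 2)"

lemma exp_linear_bound: "\<bar>exp x - 1\<bar> \<le> exp \<bar>x\<bar> * \<bar>x :: real\<bar>"
proof -
  obtain t where "\<bar>t\<bar> \<le> \<bar>x\<bar>" "exp x = (\<Sum>m<1. x ^ m / fact m) + exp t / fact 1 * x ^ 1"
    using Maclaurin_exp_le by blast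
  then show ?thesis by (auto simp: abs_mult intro!: mult_right_mono)
qed

lemma exp_quadratic_bound: "\<bar>exp x - 1 - x\<bar> \<le> exp \<bar>x\<bar> * (x :: real)\<^sup>2"
proof -
  obtain t where t: "\<bar>t\<bar> \<le> \<bar>x\<bar>" "exp x = (\<Sum>m<2. x ^ m / fact m) + exp t / fact 2 * x ^ 2"
    using Maclaurin_exp_le by blast
  have eq: "exp x - 1 - x = exp t / 2 * x\<^sup>2" using t(2) by (simp add: numeral_2_eq_2)
  have "exp t \<le> exp \<bar>x\<bar>" using t(1) by simp
  then have "exp t / 2 \<le> exp \<bar>x\<bar>" using exp_gt_zero[of t] by linarith
  then have "exp t / 2 * x\<^sup>2 \<le> exp \<bar>x\<bar> * x\<^sup>2" by (rule mult_right_mono) simp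
  moreover have "\<bar>exp t / 2 * x\<^sup>2\<bar> = exp t / 2 * x\<^sup>2" by simp
  ultimately show ?thesis unfolding eq by linarith
qed

text \<open>By the Lyapunov equation, \<open>(n + 1) \<sigma>(s, s) - n \<sigma>(s', s') = q(s) + O(e\<^sup>2 / (n + 1))\<close> for the flowed
weights \<open>s'\<close>. The bound on \<open>n e\<^sup>2\<close> keeps the exponentials bounded before the form \<open>\<sigma>\<close> is known to
be nonnegative.\<close>

lemma gauss_Suc:
  assumes "B \<ge> 0"
  obtains K where "K \<ge> 0"
    "\<And>n s e. weights M e s \<Longrightarrow> e \<le> 1 \<Longrightarrow> M \<le> 2 * n + 1 \<Longrightarrow> real n * e\<^sup>2 \<le> B \<Longrightarrow>
      \<bar>gauss M (Suc n) s - (1 - step_variance M s / 2) * gauss M n (flow n s)\<bar>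
        \<le> K * (e / (real n + 1) + e ^ 3)"
proof -
  obtain C where C: "C \<ge> 0"
    "\<And>s t e f. weights M e s \<Longrightarrow> weights M f t \<Longrightarrow> \<bar>cov_form M s t\<bar> \<le> C * (e * f)"
    using cov_form_bound by blast
  define D where "D = C * (2 * real M + 4 * (real M)\<^sup>2)"
  have D: "D \<ge> 0" using C by (simp add: D_def)
  define L where "L = 2 + D"
  define K where "K = exp (B * C) * (D + exp L * L\<^sup>2)"
  show ?thesis
  proof
    show "K \<ge> 0" using D by (simp add: K_def)
    fix n s e assume w: "weights M e s" and e1: "e \<le> 1" and M: "M \<le> 2 * n + 1" and nB: "real n * e\<^sup>2 \<le> B"
    have e: "e \<ge> 0" using weights_nonneg[OF w] .
    have e2: "e\<^sup>2 \<le> e" using e e1 by (simp add: power2_eq_square mult_left_le)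
    define T where "T = real (2 * n + 1)"
    have T: "T \<ge> real n + 1" "T > 0" by (auto simp: T_def)
    define q where "q = step_variance M s"
    define x where "x = cov_form M s (drift s)"
    define z where "z = cov_form M (drift s) (drift s)"
    define \<rho> where "\<rho> = x / T - real n * z / T\<^sup>2"
    have q: "0 \<le> q" "q \<le> 4 * e\<^sup>2"
      using step_variance_nonneg[OF w] step_variance_le[OF w] by (auto simp: q_def)
    have x: "\<bar>x\<bar> \<le> C * (2 * real M * e\<^sup>2)"
      using C(2)[OF w weights_drift[OF w]] by (simp add: x_def power2_eq_square algebra_simps)
    have z: "\<bar>z\<bar> \<le> C * (4 * (real M)\<^sup>2 * e\<^sup>2)"
      using C(2)[OF weights_drift[OF w] weights_drift[OF w]]
      by (simp add: z_def power2_eq_square algebra_simps)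
    have \<rho>: "\<bar>\<rho>\<bar> \<le> D * e\<^sup>2 / (real n + 1)"
    proof -
      have "\<bar>\<rho>\<bar> \<le> \<bar>x\<bar> / T + (real n / T) * (\<bar>z\<bar> / T)"
        unfolding \<rho>_def using T
        by (intro order_trans[OF abs_triangle_ineq4]) (simp add: abs_mult power2_eq_square)
      also have "\<dots> \<le> \<bar>x\<bar> / T + 1 * (\<bar>z\<bar> / T)"
        using T by (intro add_mono mult_right_mono) auto
      also have "\<dots> = (\<bar>x\<bar> + \<bar>z\<bar>) / T" by (simp add: add_divide_distrib)
      also have "\<dots> \<le> (D * e\<^sup>2) / T"
        using x z T by (intro divide_right_mono) (auto simp: D_def algebra_simps)
      also have "\<dots> \<le> (D * e\<^sup>2) / (real n + 1)"
        using T D by (intro divide_left_mono) auto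
      finally show ?thesis .
    qed
    have flow_eq: "flow n s = (\<lambda>l. s l + (1 / T) * drift s l)"
      by (simp add: flow_def[abs_def] T_def)
    have "cov_form M (flow n s) (flow n s) = cov_form M s s + 2 * (1 / T) * x + (1 / T)\<^sup>2 * z"
      unfolding flow_eq cov_form_add x_def z_def ..
    then have "real n * cov_form M (flow n s) (flow n s) =
        real n * cov_form M s s + (2 * real n / T) * x + real n * z / T\<^sup>2"
      by (simp add: algebra_simps power_divide)
    also have "2 * real n / T = 1 - 1 / T" using T by (simp add: T_def field_simps)
    finally have rec: "real (Suc n) * cov_form M s s = real n * cov_form M (flow n s) (flow n s) + (q + \<rho>)"
      using cov_form_lyapunov[OF w] by (simp add: \<rho>_def q_def x_def algebra_simps)
    have G: "gauss M (Suc n) s = gauss M n (flow n s) * exp (- (q + \<rho>) / 2)"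
      unfolding gauss_def exp_add[symmetric] rec by (simp add: field_simps)
    have "\<bar>real n * cov_form M (flow n s) (flow n s)\<bar> \<le> real n * (C * (e * e))"
      using C(2)[OF weights_flow[OF w M] weights_flow[OF w M]] by (simp add: abs_mult mult_left_mono)
    also have "\<dots> \<le> B * C"
      using mult_right_mono[OF nB C(1)] by (simp add: power2_eq_square algebra_simps)
    finally have Gb: "gauss M n (flow n s) \<le> exp (B * C)"
      unfolding gauss_def by simp
    define y where "y = - (q + \<rho>) / 2"
    have "y = - q / 2 - \<rho> / 2" by (simp add: y_def field_simps)
    have "D * e\<^sup>2 / (real n + 1) \<le> D * e\<^sup>2 / 1" using D by (intro divide_left_mono) auto
    then have y: "\<bar>y\<bar> \<le> L * e\<^sup>2"
      using q \<rho> D unfolding y_def L_def by (simp add: distrib_right)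
    also have "\<dots> \<le> L * 1" using e2 e1 D by (intro mult_left_mono) (auto simp: L_def)
    finally have "exp \<bar>y\<bar> \<le> exp L" by simp
    moreover have "y\<^sup>2 \<le> L\<^sup>2 * e ^ 3"
    proof -
      have "y\<^sup>2 = \<bar>y\<bar>\<^sup>2" by simp
      also have "\<dots> \<le> (L * e\<^sup>2)\<^sup>2" using y by (intro power_mono) auto
      also have "\<dots> = L\<^sup>2 * (e ^ 3 * e)" by (simp add: power_mult_distrib eval_nat_numeral mult_ac)
      also have "\<dots> \<le> L\<^sup>2 * (e ^ 3 * 1)" using e e1 by (intro mult_left_mono) auto
      finally show ?thesis by simp
    qed
    ultimately have "exp \<bar>y\<bar> * y\<^sup>2 \<le> exp L * (L\<^sup>2 * e ^ 3)" by (intro mult_mono) auto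
    then have "\<bar>exp y - 1 - y\<bar> \<le> exp L * L\<^sup>2 * e ^ 3"
      using exp_quadratic_bound[of y] by simp
    moreover have "\<bar>\<rho>\<bar> \<le> D * (e / (real n + 1))"
    proof -
      have "D * e\<^sup>2 / (real n + 1) \<le> D * e / (real n + 1)"
        using D e2 by (intro divide_right_mono mult_left_mono) auto
      then show ?thesis using \<rho> by simp
    qed
    ultimately have 1: "\<bar>exp y - (1 - q / 2)\<bar> \<le> D * (e / (real n + 1)) + exp L * L\<^sup>2 * e ^ 3"
      using \<open>y = - q / 2 - \<rho> / 2\<close> by linarith
    have "\<bar>gauss M (Suc n) s - (1 - q / 2) * gauss M n (flow n s)\<bar>
        = gauss M n (flow n s) * \<bar>exp y - (1 - q / 2)\<bar>"
    proof -
      have "g * x - z * g = g * (x - z)" for g x z :: real by (simp add: algebra_simps)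
      then show ?thesis unfolding G y_def[symmetric] by (simp only: abs_mult) (simp add: gauss_def)
    qed
    also have "\<dots> \<le> exp (B * C) * (D * (e / (real n + 1)) + exp L * L\<^sup>2 * e ^ 3)"
      using Gb 1 by (intro mult_mono) auto
    also have "\<dots> \<le> exp (B * C) * ((D + exp L * L\<^sup>2) * (e / (real n + 1)) + (D + exp L * L\<^sup>2) * e ^ 3)"
      using D e by (intro mult_left_mono add_mono mult_right_mono) auto
    finally show "\<bar>gauss M (Suc n) s - (1 - step_variance M s / 2) * gauss M n (flow n s)\<bar>
        \<le> K * (e / (real n + 1) + e ^ 3)"
      by (simp add: K_def q_def algebra_simps)
  qed
qed

text \<open>For \<open>n \<le> M\<close> the flow need not be a contraction, but both functions are within a multiple of \<open>e\<close>
of 1.\<close>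

lemma charf_gauss_base:
  obtains K where "K \<ge> 0"
    "\<And>n s e. weights M e s \<Longrightarrow> e \<le> 1 \<Longrightarrow> n \<le> M \<Longrightarrow> cmod (charf M n s - gauss M n s) \<le> K * e"
proof -
  obtain C where C: "C \<ge> 0"
    "\<And>s t e f. weights M e s \<Longrightarrow> weights M f t \<Longrightarrow> \<bar>cov_form M s t\<bar> \<le> C * (e * f)"
    using cov_form_bound by blast
  define L where "L = real M * C"
  have L: "L \<ge> 0" using C by (simp add: L_def)
  show ?thesis
  proof
    show "2 * real M + exp L * L \<ge> 0" using L by simp
    fix n s e assume w: "weights M e s" and e1: "e \<le> 1" and n: "n \<le> M"
    have e: "e \<ge> 0" using weights_nonneg[OF w] .
    have "charf M n s - 1 = game_expectation n (\<lambda>xs. iexp (centred M n s xs) - 1)"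
      unfolding charf_def by (subst Bochner_Integration.integral_diff) (auto intro: integrable_random_game)
    also have "cmod \<dots> \<le> game_expectation n (\<lambda>xs. cmod (iexp (centred M n s xs) - 1))"
      by (rule integral_norm_bound)
    also have "\<dots> \<le> game_expectation n (\<lambda>xs. 2 * real M * e)"
    proof (rule game_expectation_mono)
      fix xs assume xs: "xs \<in> games n"
      have "cmod (iexp (centred M n s xs) - 1) \<le> \<bar>centred M n s xs\<bar>" by (rule iexp_constant)
      also have "\<dots> \<le> 2 * real n * e" by (rule centred_bound[OF xs w])
      also have "\<dots> \<le> 2 * real M * e" using n e by (intro mult_right_mono) auto
      finally show "cmod (iexp (centred M n s xs) - 1) \<le> 2 * real M * e" .
    qed
    finally have 1: "cmod (charf M n s - 1) \<le> 2 * real M * e" by simp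
    define y where "y = - (real n * cov_form M s s) / 2"
    have "\<bar>y\<bar> \<le> real n * \<bar>cov_form M s s\<bar>" by (simp add: y_def abs_mult)
    also have "\<dots> \<le> real M * (C * (e * e))" using n C(2)[OF w w] by (intro mult_mono) auto
    also have "\<dots> = L * (e * e)" by (simp add: L_def)
    finally have y: "\<bar>y\<bar> \<le> L * (e * e)" .
    have "L * (e * e) \<le> L * (e * 1)" using e e1 L by (intro mult_left_mono) auto
    with y have y1: "\<bar>y\<bar> \<le> L * e" by simp
    moreover have "L * e \<le> L * 1" using e e1 L by (intro mult_left_mono) auto
    ultimately have "exp \<bar>y\<bar> * \<bar>y\<bar> \<le> exp L * (L * e)" by (intro mult_mono) auto
    then have 2: "\<bar>gauss M n s - 1\<bar> \<le> exp L * L * e"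
      using exp_linear_bound[of y] by (simp add: gauss_def y_def)
    have "cmod (charf M n s - gauss M n s) \<le> cmod (charf M n s - 1) + cmod (complex_of_real (gauss M n s - 1))"
      using norm_triangle_ineq4[of "charf M n s - 1" "complex_of_real (gauss M n s - 1)"] by simp
    then show "cmod (charf M n s - gauss M n s) \<le> (2 * real M + exp L * L) * e"
      using 1 2 unfolding norm_of_real by (simp add: distrib_right)
  qed
qed

text \<open>Both sequences obey the same recursion with a factor in \<open>[-1, 1]\<close>, and the flow preserves the bound
\<open>e\<close>, so the one-step errors add up.\<close>

lemma charf_gauss_diff:
  assumes "B \<ge> 0"
  obtains K where "K \<ge> 0"
    "\<And>n s e. weights M e s \<Longrightarrow> e \<le> 1 \<Longrightarrow> real n * e\<^sup>2 \<le> B \<Longrightarrow>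
      cmod (charf M n s - gauss M n s)
        \<le> K * (e + (\<Sum>k<n. e / (real k + 1) + e\<^sup>2 / sqrt (real k + 1) + e ^ 3))"
proof -
  obtain K1 where K1: "K1 \<ge> 0"
    "\<And>n s e. weights M e s \<Longrightarrow> e \<le> 1 \<Longrightarrow>
      cmod (charf M (Suc n) s - (1 - step_variance M s / 2) * charf M n (flow n s))
        \<le> K1 * (e / (real n + 1) + e\<^sup>2 / sqrt (real n + 1) + e ^ 3)"
    using charf_Suc[of M] by blast
  obtain K2 where K2: "K2 \<ge> 0"
    "\<And>n s e. weights M e s \<Longrightarrow> e \<le> 1 \<Longrightarrow> M \<le> 2 * n + 1 \<Longrightarrow> real n * e\<^sup>2 \<le> B \<Longrightarrow>
      \<bar>gauss M (Suc n) s - (1 - step_variance M s / 2) * gauss M n (flow n s)\<bar>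
        \<le> K2 * (e / (real n + 1) + e ^ 3)"
    using gauss_Suc[OF assms, of M] by blast
  obtain K0 where K0: "K0 \<ge> 0"
    "\<And>n s e. weights M e s \<Longrightarrow> e \<le> 1 \<Longrightarrow> n \<le> M \<Longrightarrow> cmod (charf M n s - gauss M n s) \<le> K0 * e"
    using charf_gauss_base[of M] by blast
  define K where "K = K0 + K1 + K2"
  have K: "K \<ge> 0" using K0 K1 K2 by (simp add: K_def)
  let ?r = "\<lambda>e k. e / (real k + 1) + e\<^sup>2 / sqrt (real k + 1) + e ^ 3"
  show ?thesis
  proof
    show "K \<ge> 0" by (fact K)
    fix n s e assume "weights M e s" "e \<le> 1" "real n * e\<^sup>2 \<le> B"
    then show "cmod (charf M n s - gauss M n s) \<le> K * (e + (\<Sum>k<n. ?r e k))"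
    proof (induction n arbitrary: s)
      case 0
      have "K0 * e \<le> K * e"
        using K0(1) K1(1) K2(1) weights_nonneg[OF 0(1)] by (intro mult_right_mono) (auto simp: K_def)
      then show ?case using K0(2)[OF 0(1,2), of 0] by simp
    next
      case (Suc n)
      note w = Suc.prems(1) and e1 = Suc.prems(2)
      have e: "e \<ge> 0" using weights_nonneg[OF w] .
      have "real (Suc n) * e\<^sup>2 = real n * e\<^sup>2 + e\<^sup>2" by (simp add: algebra_simps)
      then have nB: "real n * e\<^sup>2 \<le> B"
        using Suc.prems(3) zero_le_power2[of e] by linarith
      show ?case
      proof (cases "M \<le> 2 * n + 1")
        case False
        have "cmod (charf M (Suc n) s - gauss M (Suc n) s) \<le> K0 * e"
          using False by (intro K0(2)[OF w e1]) auto
        also have "\<dots> \<le> K * (e + (\<Sum>k<Suc n. ?r e k))"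
        proof (intro mult_mono)
          show "K0 \<le> K" using K1(1) K2(1) by (simp add: K_def)
          have "0 \<le> (\<Sum>k<Suc n. ?r e k)" using e by (intro sum_nonneg) auto
          then show "e \<le> e + (\<Sum>k<Suc n. ?r e k)" by linarith
        qed (use K e in auto)
        finally show ?thesis .
      next
        case True
        define q where "q = step_variance M s"
        define F where "F = flow n s"
        have wF: "weights M e F" unfolding F_def by (rule weights_flow[OF w True])
        have q: "0 \<le> q" "q \<le> 4"
        proof -
          show "0 \<le> q" unfolding q_def by (rule step_variance_nonneg[OF w])
          have "e\<^sup>2 \<le> 1" using e e1 by (simp add: power_le_one)
          then show "q \<le> 4" using step_variance_le[OF w] by (simp add: q_def)
        qed
        have "charf M (Suc n) s - gauss M (Suc n) s =
            (charf M (Suc n) s - (1 - q / 2) * charf M n F)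
            + (- complex_of_real (gauss M (Suc n) s - (1 - q / 2) * gauss M n F))
            + (1 - q / 2) * (charf M n F - gauss M n F)"
          by (simp add: algebra_simps)
        also have "cmod \<dots> \<le> K1 * ?r e n + K2 * ?r e n + K * (e + (\<Sum>k<n. ?r e k))"
        proof (intro norm_triangle_mono)
          show "cmod (charf M (Suc n) s - (1 - q / 2) * charf M n F) \<le> K1 * ?r e n"
            using K1(2)[OF w e1, of n] by (simp add: q_def F_def)
          have "\<bar>gauss M (Suc n) s - (1 - q / 2) * gauss M n F\<bar> \<le> K2 * (e / (real n + 1) + e ^ 3)"
            using K2(2)[OF w e1 True nB] by (simp add: q_def F_def)
          also have "\<dots> \<le> K2 * ?r e n" using K2(1) by (intro mult_left_mono) auto
          finally show "cmod (- complex_of_real (gauss M (Suc n) s - (1 - q / 2) * gauss M n F)) \<le> K2 * ?r e n"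
            unfolding norm_minus_cancel norm_of_real .
          have "\<bar>1 - q / 2\<bar> \<le> 1" using q by (simp add: abs_le_iff)
          then have "cmod (complex_of_real (1 - q / 2) * (charf M n F - gauss M n F))
              \<le> 1 * cmod (charf M n F - gauss M n F)"
            unfolding norm_mult norm_of_real by (intro mult_right_mono) auto
          then show "cmod (complex_of_real (1 - q / 2) * (charf M n F - gauss M n F))
              \<le> K * (e + (\<Sum>k<n. ?r e k))"
            using Suc.IH[OF wF e1 nB] by simp
        qed
        also have "K1 * ?r e n + K2 * ?r e n \<le> K * ?r e n"
          unfolding distrib_right[symmetric] using K0(1) e by (intro mult_right_mono) (auto simp: K_def)
        finally show ?thesis by (simp add: algebra_simps)
      qed
    qed
  qed
qed

lemma sum_inverse_sqrt_le: "(\<Sum>k<n. 1 / sqrt (real k + 1)) \<le> 2 * sqrt (real n)"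
proof (induction n)
  case (Suc n)
  have "sqrt (real n) * sqrt (real n + 1) \<le> real n + 1 / 2"
    using arith_geo_mean_sqrt[of "real n" "real n + 1"] unfolding real_sqrt_mult by simp
  then have "1 + 2 * sqrt (real n) * sqrt (real n + 1) \<le> 2 * sqrt (real n + 1) * sqrt (real n + 1)"
    by (simp add: mult.assoc)
  then have "1 / sqrt (real n + 1) + 2 * sqrt (real n) \<le> 2 * sqrt (real n + 1)"
    by (simp add: field_simps)
  with Suc show ?case by (simp add: add.commute)
qed simp

text \<open>With \<open>e\<close> of order \<open>1 / sqrt n\<close> the accumulated errors are of order \<open>ln n / sqrt n\<close>.\<close>

lemma charf_clt:
  assumes "\<And>l. l > M \<Longrightarrow> s l = 0"
  shows "(\<lambda>n. game_expectation n (\<lambda>xs. iexp (centred M n s xs / sqrt (real n))))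
    \<longlonglongrightarrow> complex_of_real (exp (- cov_form M s s / 2))"
proof -
  define e where "e = (\<Sum>l\<le>M. \<bar>s l\<bar>)"
  have e: "e \<ge> 0" by (simp add: e_def sum_nonneg)
  have w: "weights M e s"
  proof -
    have "\<bar>s l\<bar> \<le> e" for l
      unfolding e_def using assms[of l]
      by (cases "l \<le> M") (auto intro: member_le_sum sum_nonneg)
    then show ?thesis using assms by (simp add: weights_def)
  qed
  obtain K where K: "K \<ge> 0"
    "\<And>n s f. weights M f s \<Longrightarrow> f \<le> 1 \<Longrightarrow> real n * f\<^sup>2 \<le> e\<^sup>2 \<Longrightarrow>
      cmod (charf M n s - gauss M n s)
        \<le> K * (f + (\<Sum>k<n. f / (real k + 1) + f\<^sup>2 / sqrt (real k + 1) + f ^ 3))"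
    using charf_gauss_diff[of "e\<^sup>2" M] by auto
  define u where "u n = (\<lambda>l. s l / sqrt (real n))" for n
  have cu: "centred M n (u m) xs = centred M n s xs / sqrt (real m)" for n m xs
    using centred_linear[of M n "\<lambda>_. 0" "1 / sqrt (real m)" s xs]
    by (simp add: u_def centred_def block_sum_def freq_sum_def)
  have gu: "gauss M n (u n) = exp (- cov_form M s s / 2)" if "n > 0" for n
  proof -
    have "cov_form M (u n) (u n) = cov_form M s s / real n"
      by (simp add: u_def cov_form_def sum_divide_distrib)
    then show ?thesis using that by (simp add: gauss_def)
  qed
  define g where "g n = K * (e / sqrt (real n) + e * ((1 + ln (real n)) / sqrt (real n))
      + 2 * e\<^sup>2 / sqrt (real n) + e ^ 3 / sqrt (real n))" for n
  have bound: "cmod (charf M n (u n) - exp (- cov_form M s s / 2)) \<le> g n"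
    if n: "n > 0" and en: "e\<^sup>2 \<le> real n" for n
  proof -
    define f where "f = e / sqrt (real n)"
    have wu: "weights M f (u n)"
      using w n by (auto simp: weights_def u_def f_def abs_divide divide_right_mono)
    have f1: "f \<le> 1" using en n by (simp add: f_def real_le_rsqrt)
    have f2: "real n * f\<^sup>2 = e\<^sup>2" using n by (simp add: f_def power_divide)
    have "harm n = (\<Sum>k<n. 1 / (real k + 1))"
      unfolding harm_def by (simp add: sum.atLeast1_atMost_eq divide_inverse add.commute)
    then have "(\<Sum>k<n. 1 / (real k + 1)) \<le> 1 + ln (real n)"
      using euler_mascheroni_sequence_decreasing[of 1 n] n by (simp add: harm_expand)
    then have s1: "f * (\<Sum>k<n. 1 / (real k + 1)) \<le> f * (1 + ln (real n))"
      using e by (intro mult_left_mono) (auto simp: f_def)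
    have s2: "f\<^sup>2 * (\<Sum>k<n. 1 / sqrt (real k + 1)) \<le> f\<^sup>2 * (2 * sqrt (real n))"
      by (intro mult_left_mono sum_inverse_sqrt_le) auto
    have "f\<^sup>2 * (2 * sqrt (real n)) = 2 * e\<^sup>2 / sqrt (real n)"
      using n by (simp add: f_def power_divide field_simps)
    have f3: "real n * f ^ 3 = e ^ 3 / sqrt (real n)"
      using n by (simp add: f_def power3_eq_cube field_simps)
    have "cmod (charf M n (u n) - gauss M n (u n)) \<le>
        K * (f + (\<Sum>k<n. f / (real k + 1) + f\<^sup>2 / sqrt (real k + 1) + f ^ 3))"
      using f2 by (intro K(2)[OF wu f1]) simp
    also have "\<dots> = K * (f + (f * (\<Sum>k<n. 1 / (real k + 1)) + f\<^sup>2 * (\<Sum>k<n. 1 / sqrt (real k + 1)) + real n * f ^ 3))"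
      by (simp add: sum.distrib sum_distrib_left)
    also have "\<dots> \<le> K * (f + (f * (1 + ln (real n)) + 2 * e\<^sup>2 / sqrt (real n) + e ^ 3 / sqrt (real n)))"
      using s1 s2 f3 \<open>f\<^sup>2 * (2 * sqrt (real n)) = _\<close> K(1) by (intro mult_left_mono) auto
    also have "\<dots> = g n" by (simp add: g_def f_def)
    finally show ?thesis unfolding gu[OF n] .
  qed
  have "g \<longlonglongrightarrow> K * (0 + e * 0 + 0 + 0)"
  proof -
    have sq: "(\<lambda>n. c / sqrt (real n)) \<longlonglongrightarrow> 0" for c
      by (intro tendsto_divide_0[OF tendsto_const] filterlim_at_top_imp_at_infinity
          filterlim_compose[OF sqrt_at_top filterlim_real_sequentially])
    have "(\<lambda>n. ln (real n) / real n powr (1/2)) \<longlonglongrightarrow> 0"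
      by (rule lim_ln_over_power) simp
    then have "(\<lambda>n. 1 / sqrt (real n) + ln (real n) / sqrt (real n)) \<longlonglongrightarrow> 0 + 0"
      by (intro tendsto_add sq) (simp add: powr_half_sqrt)
    then have "(\<lambda>n. (1 + ln (real n)) / sqrt (real n)) \<longlonglongrightarrow> 0"
      by (simp add: add_divide_distrib)
    then show ?thesis unfolding g_def by (intro tendsto_intros sq)
  qed
  then have g0: "g \<longlonglongrightarrow> 0" by simp
  have "(\<lambda>n. charf M n (u n) - exp (- cov_form M s s / 2)) \<longlonglongrightarrow> 0"
  proof (rule Lim_null_comparison[OF _ g0])
    have "eventually (\<lambda>n. e\<^sup>2 \<le> real n) sequentially"
      using eventually_ge_at_top[of "nat \<lceil>e\<^sup>2\<rceil>"] by eventually_elim linarith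
    then show "eventually (\<lambda>n. cmod (charf M n (u n) - exp (- cov_form M s s / 2)) \<le> g n) sequentially"
      using eventually_gt_at_top[of 0] by eventually_elim (rule bound)
  qed
  then show ?thesis
    unfolding charf_def cu by (rule LIM_zero_cancel)
qed

section \<open>Gaussian sequences with a given covariance\<close>

definition psd_kernel :: "(nat \<Rightarrow> nat \<Rightarrow> real) \<Rightarrow> bool" where
  "psd_kernel K \<longleftrightarrow> (\<forall>i j. K i j = K j i) \<and>
     (\<forall>n c. 0 \<le> (\<Sum>i<n. \<Sum>j<n. c i * c j * K i j))"

lemma psd_kernelD: "psd_kernel K \<Longrightarrow> 0 \<le> (\<Sum>i<n. \<Sum>j<n. c i * c j * K i j)"
  by (simp add: psd_kernel_def)

lemma quadratic_form_shift:
  fixes K :: "nat \<Rightarrow> nat \<Rightarrow> real"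
  assumes "\<And>i j. K i j = K j i" "l < n"
  shows "(\<Sum>i<n. \<Sum>j<n. (c i + (if i = l then x else 0)) * (c j + (if j = l then x else 0)) * K i j) =
    (\<Sum>i<n. \<Sum>j<n. c i * c j * K i j) + 2 * x * (\<Sum>i<n. c i * K i l) + x\<^sup>2 * K l l"
proof -
  have "(\<Sum>i<n. \<Sum>j<n. (c i + (if i = l then x else 0)) * (c j + (if j = l then x else 0)) * K i j) =
    (\<Sum>i<n. \<Sum>j<n. c i * c j * K i j + (if j = l then c i * x * K i l else 0)
      + (if i = l then x * c j * K l j else 0)
      + (if i = l then if j = l then x * x * K l l else 0 else 0))"
    by (intro sum.cong refl) (auto simp: algebra_simps)
  also have "\<dots> = (\<Sum>i<n. \<Sum>j<n. c i * c j * K i j) + (\<Sum>i<n. c i * x * K i l)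
      + (\<Sum>i<n. \<Sum>j<n. if i = l then x * c j * K l j else 0)
      + (\<Sum>i<n. \<Sum>j<n. if i = l then if j = l then x * x * K l l else 0 else 0)"
    using assms(2) by (simp add: sum.distrib sum.delta)
  also have "(\<Sum>i<n. \<Sum>j<n. if i = l then if j = l then x * x * K l l else 0 else 0) = x * x * K l l"
    using assms(2) by (subst sum.swap) (simp add: sum.delta)
  also have "(\<Sum>i<n. \<Sum>j<n. if i = l then x * c j * K l j else 0) = (\<Sum>j<n. x * c j * K l j)"
    using assms(2) by (subst sum.swap) (simp add: sum.delta)
  also have "(\<Sum>j<n. x * c j * K l j) = (\<Sum>j<n. c j * x * K j l)"
    by (intro sum.cong refl) (simp add: assms(1)[of l])
  also have "(\<Sum>j<n. c j * x * K j l) = x * (\<Sum>j<n. c j * K j l)"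
    by (simp add: sum_distrib_left mult_ac)
  finally show ?thesis by (simp add: power2_eq_square)
qed

lemma psd_kernel_diag_nonneg:
  assumes "psd_kernel K"
  shows "0 \<le> K l l"
proof -
  have "0 \<le> (\<Sum>i<Suc l. \<Sum>j<Suc l. (0 + (if i = l then 1 else 0)) * (0 + (if j = l then 1 else 0)) * K i j)"
    by (rule psd_kernelD[OF assms])
  also have "\<dots> = K l l"
    using assms unfolding psd_kernel_def by (subst quadratic_form_shift) auto
  finally show ?thesis .
qed

lemma psd_kernel_zero_diag:
  assumes "psd_kernel K" "K l l = 0"
  shows "K l j = 0"
proof (rule ccontr)
  assume nz: "K l j \<noteq> 0"
  have sym: "\<And>i j. K i j = K j i" using assms(1) by (simp add: psd_kernel_def)
  have "0 \<le> K j j + 2 * x * K j l" for x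
  proof -
    let ?n = "Suc (l + j)"
    let ?c = "\<lambda>i. if i = j then 1 else 0 :: real"
    have "0 \<le> (\<Sum>i<?n. \<Sum>k<?n. (?c i + (if i = l then x else 0)) * (?c k + (if k = l then x else 0)) * K i k)"
      by (rule psd_kernelD[OF assms(1)])
    also have "\<dots> = (\<Sum>i<?n. \<Sum>k<?n. ?c i * ?c k * K i k) + 2 * x * (\<Sum>i<?n. ?c i * K i l) + x\<^sup>2 * K l l"
      by (rule quadratic_form_shift) (auto intro: sym)
    also have "(\<Sum>i<?n. \<Sum>k<?n. ?c i * ?c k * K i k) = K j j"
      using quadratic_form_shift[of K j ?n "\<lambda>_. 0" 1] sym by simp
    also have "(\<Sum>i<?n. ?c i * K i l) = K j l"
      by (simp add: if_distrib[of "\<lambda>y. y * _"] sum.delta del: sum.lessThan_Suc cong: if_cong)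
    finally show ?thesis using assms(2) by simp
  qed
  \<comment> \<open>A function that is linear in \<open>x\<close> with nonzero slope takes negative values.\<close>
  moreover have "K j j + 2 * (- (K j j + 1) / (2 * K j l)) * K j l = - 1"
    using nz sym[of l j] by (simp add: field_simps)
  ultimately show False by (metis not_one_le_zero neg_0_le_iff_le)
qed

text \<open>The Schur complement arises by minimising the quadratic form over the \<open>l\<close>-th coefficient. If the
diagonal entry vanishes, division by zero leaves the kernel unchanged.\<close>

lemma psd_kernel_schur:
  assumes "psd_kernel K"
  shows "psd_kernel (\<lambda>i j. K i j - K i l * K j l / K l l)"
  unfolding psd_kernel_def
proof (intro conjI allI)
  have sym: "\<And>i j. K i j = K j i" using assms by (simp add: psd_kernel_def)
  fix i j
  show "K i j - K i l * K j l / K l l = K j i - K j l * K i l / K l l"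
    using sym[of i j] by simp
next
  have sym: "\<And>i j. K i j = K j i" using assms by (simp add: psd_kernel_def)
  fix n and c :: "nat \<Rightarrow> real"
  define N where "N = n + Suc l"
  define d where "d i = (if i < n then c i else 0)" for i
  have ext: "(\<Sum>i<N. f i) = (\<Sum>i<n. f i)" if "\<And>i. i \<ge> n \<Longrightarrow> f i = 0" for f :: "nat \<Rightarrow> real"
    using that by (intro sum.mono_neutral_right) (auto simp: N_def)
  define b where "b = (\<Sum>i<N. d i * K i l)"
  define q where "q = (\<Sum>i<N. \<Sum>j<N. d i * d j * K i j)"
  have "(\<Sum>i<n. \<Sum>j<n. c i * c j * (K i j - K i l * K j l / K l l)) =
      (\<Sum>i<n. \<Sum>j<n. d i * d j * (K i j - K i l * K j l / K l l))"
    by (simp add: d_def)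
  also have "\<dots> = (\<Sum>i<N. \<Sum>j<N. d i * d j * (K i j - K i l * K j l / K l l))"
    by (subst (1 2) ext) (auto simp: d_def)
  also have "\<dots> = q - (\<Sum>i<N. \<Sum>j<N. (d i * K i l) * (d j * K j l)) / K l l"
    by (simp add: q_def right_diff_distrib sum_subtractf sum_divide_distrib mult_ac)
  also have "(\<Sum>i<N. \<Sum>j<N. (d i * K i l) * (d j * K j l)) = b\<^sup>2"
    by (simp add: b_def power2_eq_square sum_product)
  finally have eq: "(\<Sum>i<n. \<Sum>j<n. c i * c j * (K i j - K i l * K j l / K l l)) = q - b\<^sup>2 / K l l" .
  have "0 \<le> q + 2 * x * b + x\<^sup>2 * K l l" for x
  proof -
    have "0 \<le> (\<Sum>i<N. \<Sum>j<N. (d i + (if i = l then x else 0)) * (d j + (if j = l then x else 0)) * K i j)"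
      by (rule psd_kernelD[OF assms])
    also have "\<dots> = q + 2 * x * b + x\<^sup>2 * K l l"
      unfolding q_def b_def by (rule quadratic_form_shift) (auto intro: sym simp: N_def)
    finally show ?thesis .
  qed
  \<comment> \<open>This is the minimiser; for \<open>K l l = 0\<close> it is 0 and the claim is \<open>0 \<le> q\<close>.\<close>
  from this[of "- b / K l l"] show "0 \<le> (\<Sum>i<n. \<Sum>j<n. c i * c j * (K i j - K i l * K j l / K l l))"
    unfolding eq by (cases "K l l = 0") (simp_all add: power2_eq_square)
qed

text \<open>Repeated Schur complements clear one row and column after the other. A vanishing pivot does no harm,
as its whole row is then 0 by \<open>psd_kernel_zero_diag\<close>.\<close>

lemma psd_kernel_cholesky:
  assumes "psd_kernel K"
  obtains L :: "nat \<Rightarrow> nat \<Rightarrow> real"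
  where "\<And>i l. i < l \<Longrightarrow> L i l = 0" "\<And>i j m. i < m \<Longrightarrow> K i j = (\<Sum>l<m. L i l * L j l)"
proof -
  \<comment> \<open>\<open>R l\<close> is the kernel after the first \<open>l\<close> eliminations.\<close>
  define R where "R = rec_nat K (\<lambda>l S i j. S i j - S i l * S j l / S l l)"
  have R0: "R 0 = K" and RS: "R (Suc l) = (\<lambda>i j. R l i j - R l i l * R l j l / R l l l)" for l
    by (simp_all add: R_def)
  have psd: "psd_kernel (R l)" for l
    by (induction l) (simp_all add: R0 RS assms psd_kernel_schur)
  have sym: "R l i j = R l j i" for l i j
    using psd[of l] by (simp add: psd_kernel_def)
  have zero: "i < l \<Longrightarrow> R l i j = 0" for i l j
  proof (induction l arbitrary: i j)
    case (Suc l)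
    show ?case
    proof (cases "i = l")
      case True
      then show ?thesis
        using psd_kernel_zero_diag[OF psd[of l], of l j] sym[of l l j]
        by (cases "R l l l = 0") (simp_all add: RS)
    next
      case False
      then show ?thesis using Suc by (simp add: RS)
    qed
  qed simp
  define L where "L i l = R l i l / sqrt (R l l l)" for i l
  have LL: "L i l * L j l = R l i l * R l j l / R l l l" for i j l
    using psd_kernel_diag_nonneg[OF psd[of l], of l] by (simp add: L_def)
  have dec: "K i j = R m i j + (\<Sum>l<m. L i l * L j l)" for i j m
    by (induction m) (simp_all add: R0 RS LL)
  show ?thesis
  proof
    show "L i l = 0" if "i < l" for i l using zero[OF that, of l] by (simp add: L_def)
    show "K i j = (\<Sum>l<m. L i l * L j l)" if "i < m" for i j m
      using dec[of i j m] zero[OF that, of j] by simp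
  qed
qed

definition white_noise :: "(nat \<Rightarrow> real) measure" where
  "white_noise = (\<Pi>\<^sub>M l\<in>UNIV. std_normal_distribution)"

interpretation white_noise: product_prob_space "\<lambda>_::nat. std_normal_distribution" UNIV
  using real_dist_normal_dist by (intro product_prob_spaceI) (rule real_distribution.axioms(1))

lemma prob_space_white_noise: "prob_space white_noise"
  unfolding white_noise_def by (rule white_noise.P.prob_space_axioms)

lemma measurable_coordinate: "(\<lambda>\<omega>. \<omega> l) \<in> borel_measurable white_noise"
  using measurable_component_singleton[of l UNIV "\<lambda>_. std_normal_distribution"]
  by (simp add: white_noise_def cong: measurable_cong_sets)

lemma distr_coordinate: "distr white_noise borel (\<lambda>\<omega>. \<omega> l) = std_normal_distribution"
proof -
  have "distr white_noise borel (\<lambda>\<omega>. \<omega> l) = distr white_noise std_normal_distribution (\<lambda>\<omega>. \<omega> l)"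
    by (rule distr_cong) auto
  then show ?thesis
    unfolding white_noise_def using white_noise.PiM_component[of l] by simp
qed

lemma indep_coordinates: "prob_space.indep_vars white_noise (\<lambda>_. borel) (\<lambda>l \<omega>. \<omega> l) (UNIV :: nat set)"
proof -
  interpret prob_space white_noise by (rule prob_space_white_noise)
  have s: "sets (\<Pi>\<^sub>M i\<in>(UNIV :: nat set). (borel :: real measure)) = sets white_noise"
    unfolding white_noise_def by (rule sets_PiM_cong) auto
  have "distr white_noise (\<Pi>\<^sub>M i\<in>UNIV. borel) (\<lambda>\<omega>. \<lambda>i\<in>UNIV. \<omega> i) = distr white_noise white_noise (\<lambda>\<omega>. \<omega>)"
    by (rule distr_cong) (auto simp: s)
  also have "\<dots> = white_noise" by (rule distr_id)
  also have "\<dots> = (\<Pi>\<^sub>M i\<in>UNIV. distr white_noise borel (\<lambda>\<omega>. \<omega> i))"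
    unfolding distr_coordinate by (simp add: white_noise_def)
  finally show ?thesis
    by (subst indep_vars_iff_distr_eq_PiM) (auto intro: measurable_coordinate)
qed

lemma distributed_coordinate: "distributed white_noise lborel (\<lambda>\<omega>. \<omega> l) (normal_density 0 1)"
  using distr_coordinate[of l] measurable_coordinate[of l]
  by (auto simp: distributed_def cong: distr_cong)

definition coordinate_sum :: "nat \<Rightarrow> (nat \<Rightarrow> real) \<Rightarrow> (nat \<Rightarrow> real) \<Rightarrow> real" where
  "coordinate_sum m b \<omega> = (\<Sum>l<m. b l * \<omega> l)"

lemma measurable_coordinate_sum: "coordinate_sum m b \<in> borel_measurable white_noise"
  unfolding coordinate_sum_def[abs_def] using measurable_coordinate by measurable

text \<open>Sums of independent normal variables are normal; coordinates with coefficient 0 are discarded because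
a normal density requires a positive standard deviation. If none is left, the sum is constant.\<close>

lemma gaussian_coordinate_sum: "gaussian white_noise (coordinate_sum m b)"
proof -
  interpret prob_space white_noise by (rule prob_space_white_noise)
  define I where "I = {l. l < m \<and> b l \<noteq> 0}"
  have eq: "coordinate_sum m b = (\<lambda>\<omega>. \<Sum>l\<in>I. b l * \<omega> l)"
    unfolding coordinate_sum_def[abs_def] I_def
    by (intro ext sum.mono_neutral_right) auto
  show ?thesis
  proof (cases "I = {}")
    case True
    then show ?thesis
      using measurable_coordinate_sum[of m b] by (auto simp: gaussian_def eq)
  next
    case False
    have fin: "finite I" by (simp add: I_def)
    have ind: "indep_vars (\<lambda>_. borel) (\<lambda>l \<omega>. b l * \<omega> l) I"
      by (rule indep_vars_compose2[OF indep_vars_subset[OF indep_coordinates]]) auto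
    have dist: "distributed white_noise lborel (\<lambda>\<omega>. b l * \<omega> l) (normal_density 0 \<bar>b l\<bar>)" if "l \<in> I" for l
      using normal_density_affine[OF distributed_coordinate[of l], of "b l" 0] that by (simp add: I_def)
    have "distributed white_noise lborel (\<lambda>\<omega>. \<Sum>l\<in>I. b l * \<omega> l)
        (normal_density (\<Sum>l\<in>I. 0) (sqrt (\<Sum>l\<in>I. \<bar>b l\<bar>\<^sup>2)))"
      using fin False ind dist by (intro sum_indep_normal) (auto simp: I_def)
    moreover have "0 < sqrt (\<Sum>l\<in>I. \<bar>b l\<bar>\<^sup>2)"
      using fin False by (auto intro!: sum_pos simp: I_def)
    ultimately show ?thesis
      using measurable_coordinate_sum[of m b] unfolding gaussian_def eq by blast
  qed
qed

lemma char_coordinate_sum: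
  "(\<integral>\<omega>. iexp (coordinate_sum m b \<omega>) \<partial>white_noise) = exp (- (\<Sum>l<m. (b l)\<^sup>2) / 2)"
proof -
  interpret prob_space white_noise by (rule prob_space_white_noise)
  have "(\<integral>\<omega>. iexp (coordinate_sum m b \<omega>) \<partial>white_noise) = (\<integral>\<omega>. (\<Prod>l<m. iexp (b l * \<omega> l)) \<partial>white_noise)"
    by (simp add: coordinate_sum_def sum_distrib_left exp_sum)
  also have "\<dots> = (\<Prod>l<m. \<integral>\<omega>. iexp (b l * \<omega> l) \<partial>white_noise)"
  proof (rule indep_vars_lebesgue_integral)
    show "indep_vars (\<lambda>_. borel) (\<lambda>l \<omega>. iexp (b l * \<omega> l)) {..<m}"
      by (rule indep_vars_compose2[OF indep_vars_subset[OF indep_coordinates]]) auto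
    show "integrable white_noise (\<lambda>\<omega>. iexp (b l * \<omega> l))" for l
      using measurable_coordinate[of l]
      by (intro integrable_const_bound[where B = 1]) auto
  qed simp
  also have "\<dots> = (\<Prod>l<m. complex_of_real (exp (- (b l)\<^sup>2 / 2)))"
  proof (rule prod.cong[OF refl])
    fix l
    have "(\<integral>\<omega>. iexp (b l * \<omega> l) \<partial>white_noise) = char (distr white_noise borel (\<lambda>\<omega>. \<omega> l)) (b l)"
      unfolding char_def by (subst integral_distr) (auto intro: measurable_coordinate)
    then show "(\<integral>\<omega>. iexp (b l * \<omega> l) \<partial>white_noise) = complex_of_real (exp (- (b l)\<^sup>2 / 2))"
      unfolding distr_coordinate char_std_normal_distribution .
  qed
  also have "\<dots> = exp (- (\<Sum>l<m. (b l)\<^sup>2) / 2)"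
    by (simp add: exp_sum[symmetric] sum_negf[symmetric] sum_divide_distrib del: of_real_exp
        flip: of_real_prod)
  finally show ?thesis .
qed

lemma coordinate_moments:
  "integrable white_noise (\<lambda>\<omega>. \<omega> l)"
  "(\<integral>\<omega>. \<omega> l \<partial>white_noise) = 0"
  "integrable white_noise (\<lambda>\<omega>. \<omega> k * \<omega> l)"
  "(\<integral>\<omega>. \<omega> k * \<omega> l \<partial>white_noise) = (if k = l then 1 else 0)"
proof -
  interpret prob_space white_noise by (rule prob_space_white_noise)
  have int: "integrable white_noise (\<lambda>\<omega>. \<omega> l ^ p) \<longleftrightarrow> integrable std_normal_distribution (\<lambda>x. x ^ p)"
    and leb: "(\<integral>\<omega>. \<omega> l ^ p \<partial>white_noise) = (\<integral>x. x ^ p \<partial>std_normal_distribution)" for l p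
    unfolding distr_coordinate[of l, symmetric]
    by (simp_all add: integrable_distr_eq integral_distr measurable_coordinate)
  show i1: "integrable white_noise (\<lambda>\<omega>. \<omega> l)" for l
    using int[of l 1] integrable_std_normal_distribution_moment[of 1] by simp
  show e1: "(\<integral>\<omega>. \<omega> l \<partial>white_noise) = 0" for l
    using leb[of l 1] integral_std_normal_distribution_moment_odd[of 1] by simp
  have ind: "indep_vars (\<lambda>_. borel) (\<lambda>l \<omega>. \<omega> l) {k, l}"
    by (rule indep_vars_subset[OF indep_coordinates]) simp
  show "integrable white_noise (\<lambda>\<omega>. \<omega> k * \<omega> l)"
  proof (cases "k = l")
    case True
    then show ?thesis
      using int[of l 2] integrable_std_normal_distribution_moment[of 2] by (simp add: power2_eq_square)
  next
    case False
    then show ?thesis using indep_vars_integrable[OF _ ind] i1 by simp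
  qed
  show "(\<integral>\<omega>. \<omega> k * \<omega> l \<partial>white_noise) = (if k = l then 1 else 0)"
  proof (cases "k = l")
    case True
    then show ?thesis
      using leb[of l 2] std_normal_distribution_even_moments(1)[of 1] by (simp add: power2_eq_square)
  next
    case False
    then show ?thesis using indep_vars_lebesgue_integral[OF _ ind] i1 e1 by simp
  qed
qed

lemma coordinate_sum_moments:
  "integrable white_noise (coordinate_sum m b)"
  "(\<integral>\<omega>. coordinate_sum m b \<omega> \<partial>white_noise) = 0"
  "integrable white_noise (\<lambda>\<omega>. coordinate_sum m b \<omega> * coordinate_sum m' b' \<omega>)"
  "(\<integral>\<omega>. coordinate_sum m b \<omega> * coordinate_sum m b' \<omega> \<partial>white_noise) = (\<Sum>l<m. b l * b' l)"
proof -
  have int: "integrable white_noise (\<lambda>\<omega>. b k * \<omega> k * (b' l * \<omega> l))"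
    and eq: "(\<integral>\<omega>. b k * \<omega> k * (b' l * \<omega> l) \<partial>white_noise) = (if k = l then b k * b' l else 0)" for k l b b'
  proof -
    have *: "(\<lambda>\<omega>. b k * \<omega> k * (b' l * \<omega> l)) = (\<lambda>\<omega>. (b k * b' l) * (\<omega> k * \<omega> l))" by (simp add: mult_ac)
    show "integrable white_noise (\<lambda>\<omega>. b k * \<omega> k * (b' l * \<omega> l))"
      unfolding * by (intro integrable_mult_right coordinate_moments)
    show "(\<integral>\<omega>. b k * \<omega> k * (b' l * \<omega> l) \<partial>white_noise) = (if k = l then b k * b' l else 0)"
      unfolding * integral_mult_right_zero coordinate_moments by simp
  qed
  show "integrable white_noise (coordinate_sum m b)"
    unfolding coordinate_sum_def[abs_def]
    by (intro Bochner_Integration.integrable_sum integrable_mult_right coordinate_moments)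
  show "(\<integral>\<omega>. coordinate_sum m b \<omega> \<partial>white_noise) = 0"
    unfolding coordinate_sum_def[abs_def]
    by (subst Bochner_Integration.integral_sum) (auto intro: coordinate_moments simp: coordinate_moments)
  show "integrable white_noise (\<lambda>\<omega>. coordinate_sum m b \<omega> * coordinate_sum m' b' \<omega>)"
    unfolding coordinate_sum_def sum_product by (intro Bochner_Integration.integrable_sum int)
  show "(\<integral>\<omega>. coordinate_sum m b \<omega> * coordinate_sum m b' \<omega> \<partial>white_noise) = (\<Sum>l<m. b l * b' l)"
    unfolding coordinate_sum_def sum_product
    by (simp add: Bochner_Integration.integral_sum Bochner_Integration.integrable_sum int eq sum.delta)
qed

section \<open>Convergence in distribution of real sequences\<close>

definition finite_linear :: "((nat \<Rightarrow> real) \<Rightarrow> real) \<Rightarrow> bool" where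
  "finite_linear F \<longleftrightarrow> (\<exists>m t. F = (\<lambda>x. \<Sum>k<m. t k * x k))"

lemma finite_linear_add:
  assumes "finite_linear F" "finite_linear G"
  shows "finite_linear (\<lambda>x. F x + c * G x)"
proof -
  obtain m t m' t' where F: "F = (\<lambda>x. \<Sum>k<m. t k * x k)" and G: "G = (\<lambda>x. \<Sum>k<m'. t' k * x k)"
    using assms unfolding finite_linear_def by blast
  let ?n = "m + m'"
  let ?t = "\<lambda>k. (if k < m then t k else 0) + c * (if k < m' then t' k else 0)"
  have "F x + c * G x = (\<Sum>k<?n. ?t k * x k)" for x
  proof -
    have "(\<Sum>k<m. t k * x k) = (\<Sum>k<?n. (if k < m then t k else 0) * x k)"
      by (intro sum.mono_neutral_cong_left) auto
    moreover have "(\<Sum>k<m'. t' k * x k) = (\<Sum>k<?n. (if k < m' then t' k else 0) * x k)"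
      by (intro sum.mono_neutral_cong_left) auto
    ultimately show ?thesis
      unfolding F G by (simp only: sum_distrib_left sum.distrib[symmetric] distrib_right mult.assoc)
  qed
  then show ?thesis
    unfolding finite_linear_def by (intro exI[of _ ?n] exI[of _ ?t] ext)
qed

lemma finite_linear_0: "finite_linear (\<lambda>_. 0)"
  unfolding finite_linear_def by (rule exI[of _ 0]) simp

lemma finite_linear_coordinate: "finite_linear (\<lambda>x. c * x k)"
  unfolding finite_linear_def
  by (intro exI[of _ "Suc k"] exI[of _ "\<lambda>j. if j = k then c else 0"] ext) simp

lemma continuous_finite_linear: "finite_linear F \<Longrightarrow> continuous_on A F"
proof -
  have coordinate: "continuous_on A (\<lambda>x :: nat \<Rightarrow> real. x k)" for k
    by (rule continuous_on_subset[OF continuous_on_product_coordinates]) simp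
  have "continuous_on A (\<lambda>x. \<Sum>k<m. t k * x k)" for m and t :: "nat \<Rightarrow> real"
    by (intro continuous_on_sum continuous_on_mult_left coordinate)
  then show "finite_linear F \<Longrightarrow> continuous_on A F"
    unfolding finite_linear_def by blast
qed

inductive trig_poly :: "((nat \<Rightarrow> real) \<Rightarrow> real) \<Rightarrow> bool" where
  cos: "finite_linear F \<Longrightarrow> trig_poly (\<lambda>x. cos (F x))"
| sin: "finite_linear F \<Longrightarrow> trig_poly (\<lambda>x. sin (F x))"
| add: "trig_poly f \<Longrightarrow> trig_poly g \<Longrightarrow> trig_poly (\<lambda>x. f x + g x)"
| scale: "trig_poly f \<Longrightarrow> trig_poly (\<lambda>x. c * f x)"

lemma trig_poly_const: "trig_poly (\<lambda>_. c)"
  using trig_poly.scale[OF trig_poly.cos[OF finite_linear_0], of c] by simp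

lemma continuous_trig_poly: "trig_poly f \<Longrightarrow> continuous_on A f"
  by (induction rule: trig_poly.induct)
    (simp_all add: continuous_on_cos continuous_on_sin continuous_on_add continuous_on_mult_left
      continuous_finite_linear)

lemma bounded_trig_poly:
  assumes "trig_poly f"
  shows "\<exists>B. \<forall>x. \<bar>f x\<bar> \<le> B"
  using assms
proof (induction rule: trig_poly.induct)
  case (add f g)
  then obtain A B where "\<forall>x. \<bar>f x\<bar> \<le> A" "\<forall>x. \<bar>g x\<bar> \<le> B" by blast
  then have "\<bar>f x + g x\<bar> \<le> A + B" for x
    by (intro order_trans[OF abs_triangle_ineq] add_mono) auto
  then show ?case by blast
next
  case (scale f c)
  then obtain A where "\<forall>x. \<bar>f x\<bar> \<le> A" by blast
  then have "\<bar>c * f x\<bar> \<le> \<bar>c\<bar> * A" for x by (simp add: abs_mult mult_left_mono)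
  then show ?case by blast
qed (auto intro!: exI[of _ 1])

lemma trig_poly_half_sum:
  assumes "trig_poly f" "trig_poly g"
  shows "trig_poly (\<lambda>x. (f x + c * g x) / 2)"
proof -
  have "trig_poly (\<lambda>x. (1 / 2) * (f x + c * g x))"
    by (intro trig_poly.intros assms)
  then show ?thesis by simp
qed

lemma trig_poly_mult:
  assumes "trig_poly f" "trig_poly g"
  shows "trig_poly (\<lambda>x. f x * g x)"
  using assms
proof (induction arbitrary: g rule: trig_poly.induct)
  case (cos F)
  from cos(2) cos(1) show ?case
  proof (induction rule: trig_poly.induct)
    case (cos G)
    have "trig_poly (\<lambda>x. (cos (F x + (-1) * G x) + 1 * cos (F x + 1 * G x)) / 2)"
      using cos by (intro trig_poly_half_sum trig_poly.intros finite_linear_add)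
    then show ?case by (simp add: cos_times_cos)
  next
    case (sin G)
    have "trig_poly (\<lambda>x. (sin (F x + 1 * G x) + (-1) * sin (F x + (-1) * G x)) / 2)"
      using sin by (intro trig_poly_half_sum trig_poly.intros finite_linear_add)
    then show ?case by (simp add: cos_times_sin)
  next
    case (add f g)
    then show ?case using trig_poly.add[of "\<lambda>x. cos (F x) * f x" "\<lambda>x. cos (F x) * g x"]
      by (simp add: distrib_left)
  next
    case (scale f c)
    then show ?case using trig_poly.scale[of "\<lambda>x. cos (F x) * f x" c]
      by (simp add: mult.left_commute)
  qed
next
  case (sin F)
  from sin(2) sin(1) show ?case
  proof (induction rule: trig_poly.induct)
    case (cos G)
    have "trig_poly (\<lambda>x. (sin (F x + 1 * G x) + 1 * sin (F x + (-1) * G x)) / 2)"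
      using cos by (intro trig_poly_half_sum trig_poly.intros finite_linear_add)
    then show ?case by (simp add: sin_times_cos)
  next
    case (sin G)
    have "trig_poly (\<lambda>x. (cos (F x + (-1) * G x) + (-1) * cos (F x + 1 * G x)) / 2)"
      using sin by (intro trig_poly_half_sum trig_poly.intros finite_linear_add)
    then show ?case by (simp add: sin_times_sin)
  next
    case (add f g)
    then show ?case using trig_poly.add[of "\<lambda>x. sin (F x) * f x" "\<lambda>x. sin (F x) * g x"]
      by (simp add: distrib_left)
  next
    case (scale f c)
    then show ?case using trig_poly.scale[of "\<lambda>x. sin (F x) * f x" c]
      by (simp add: mult.left_commute)
  qed
next
  case (add f1 f2)
  then show ?case using trig_poly.add[of "\<lambda>x. f1 x * g x" "\<lambda>x. f2 x * g x"]
    by (simp add: distrib_right)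
next
  case (scale f c)
  then show ?case using trig_poly.scale[of "\<lambda>x. f x * g x" c] by (simp add: mult.assoc)
qed

lemma trig_poly_separates:
  assumes "x \<noteq> (y :: nat \<Rightarrow> real)"
  shows "\<exists>f. trig_poly f \<and> f x \<noteq> f y"
proof -
  obtain k where k: "x k \<noteq> y k" using assms by (meson ext)
  \<comment> \<open>The frequency is small enough for both arguments to lie in \<open>[-1, 1]\<close>, where the sine is injective.\<close>
  define c where "c = 1 / (1 + \<bar>x k\<bar> + \<bar>y k\<bar>)"
  have c: "c > 0" by (simp add: c_def add_nonneg_pos)
  have small: "\<bar>c * x k\<bar> \<le> 1" "\<bar>c * y k\<bar> \<le> 1"
    by (simp_all add: c_def abs_divide)
  have "sin (c * x k) \<noteq> sin (c * y k)"
  proof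
    assume eq: "sin (c * x k) = sin (c * y k)"
    have "c * x k = c * y k"
      by (rule sin_inj_pi[OF _ _ _ _ eq]; use small pi_ge_two in linarith)
    then show False using c k by simp
  qed
  then show ?thesis using trig_poly.sin[OF finite_linear_coordinate[of c k]] by blast
qed

lemma trig_poly_polynomial:
  assumes "real_polynomial_function p" "trig_poly g"
  shows "trig_poly (\<lambda>x. p (g x))"
  using assms(1)
proof (induction rule: real_polynomial_function.induct)
  case (linear h)
  have "h u = h 1 * u" for u :: real
    using linear_cmul[OF bounded_linear.linear[OF linear], of u 1] by (simp add: mult.commute)
  then have eq: "(\<lambda>x. h (g x)) = (\<lambda>x. h 1 * g x)" by (intro ext)
  show ?case unfolding eq by (rule trig_poly.scale[OF assms(2)])
next
  case (const c)
  show ?case by (rule trig_poly_const)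
next
  case (add p q)
  from add.IH show ?case by (rule trig_poly.add)
next
  case (mult p q)
  from mult.IH show ?case by (rule trig_poly_mult)
qed

text \<open>A trigonometric polynomial that is close to \<open>f\<close> on \<open>K\<close> may be much larger than \<open>f\<close> elsewhere.
It is therefore clamped to \<open>[-B, B]\<close>. As its range is bounded on the whole space, the clamping
function can be replaced by a polynomial, which keeps the class of trigonometric polynomials.\<close>

lemma trig_poly_approximation:
  fixes f :: "(nat \<Rightarrow> real) \<Rightarrow> real"
  assumes K: "compact K" and f: "continuous_on UNIV f" and B: "\<And>x. \<bar>f x\<bar> \<le> B" and e: "e > 0"
  obtains h where "trig_poly h" "\<And>x. x \<in> K \<Longrightarrow> \<bar>f x - h x\<bar> \<le> 2 * e" "\<And>x. \<bar>h x\<bar> \<le> B + e"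
proof -
  have "\<exists>g. trig_poly g \<and> (\<forall>x\<in>K. \<bar>f x - g x\<bar> < e)"
  proof (rule Stone_Weierstrass_HOL[OF K])
    show "trig_poly (\<lambda>_. c)" for c by (rule trig_poly_const)
    show "continuous_on K g" if "trig_poly g" for g by (rule continuous_trig_poly[OF that])
    show "trig_poly (\<lambda>x. g x + h x)" if "trig_poly g \<and> trig_poly h" for g h
      using that by (simp add: trig_poly.add)
    show "trig_poly (\<lambda>x. g x * h x)" if "trig_poly g \<and> trig_poly h" for g h
      using that by (simp add: trig_poly_mult)
    show "\<exists>g. trig_poly g \<and> g x \<noteq> g y" if "x \<in> K \<and> y \<in> K \<and> x \<noteq> y" for x y
      using that by (simp add: trig_poly_separates)
    show "continuous_on K f" by (rule continuous_on_subset[OF f]) simp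
  qed (rule e)
  then obtain g where g: "trig_poly g" "\<And>x. x \<in> K \<Longrightarrow> \<bar>f x - g x\<bar> < e" by blast
  obtain G where G: "\<And>x. \<bar>g x\<bar> \<le> G" using bounded_trig_poly[OF g(1)] by blast
  define clamp where "clamp u = max (- B) (min B u)" for u :: real
  have "continuous_on {- G..G} clamp" unfolding clamp_def by (intro continuous_intros)
  then obtain p where p: "real_polynomial_function p" "\<And>u. u \<in> {- G..G} \<Longrightarrow> \<bar>clamp u - p u\<bar> < e"
    using Stone_Weierstrass_real_polynomial_function[of "{- G..G}" clamp e] e by blast
  have pe: "\<bar>clamp (g x) - p (g x)\<bar> < e" for x
    using p(2)[of "g x"] G[of x] by (simp add: abs_le_iff)
  show ?thesis
  proof
    show "trig_poly (\<lambda>x. p (g x))" by (rule trig_poly_polynomial[OF p(1) g(1)])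
    have B0: "B \<ge> 0" using B[of "\<lambda>_. 0"] by linarith
    show "\<bar>p (g x)\<bar> \<le> B + e" for x
    proof -
      have "\<bar>clamp (g x)\<bar> \<le> B" using B0 by (auto simp: clamp_def)
      then show ?thesis using pe[of x] by linarith
    qed
    show "\<bar>f x - p (g x)\<bar> \<le> 2 * e" if "x \<in> K" for x
    proof -
      have "\<bar>f x - clamp (g x)\<bar> \<le> \<bar>f x - g x\<bar>" using B[of x] by (auto simp: clamp_def)
      then show ?thesis using pe[of x] g(2)[OF that] by linarith
    qed
  qed
qed

definition coordinate_box :: "(nat \<Rightarrow> real) \<Rightarrow> (nat \<Rightarrow> real) set" where
  "coordinate_box a = {x. \<forall>k. \<bar>x k\<bar> \<le> a k}"

lemma compact_coordinate_box: "compact (coordinate_box a)"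
proof -
  have "\<bar>x\<bar> \<le> b \<longleftrightarrow> x \<in> {- b..b}" for x b :: real
    unfolding atLeastAtMost_iff by linarith
  then have "coordinate_box a = PiE UNIV (\<lambda>k. {- a k..a k})"
    unfolding coordinate_box_def by (auto simp: PiE_iff)
  moreover have "compactin (product_topology (\<lambda>_. euclidean) UNIV) (PiE UNIV (\<lambda>k. {- a k..a k}))"
    by (subst compactin_PiE) (simp add: compactin_euclidean_iff)
  ultimately show ?thesis
    unfolding euclidean_product_topology compactin_euclidean_iff by simp
qed

text \<open>By Markov's inequality, coordinate \<open>k\<close> leaves its interval with probability at most \<open>e / 2 ^ Suc k\<close>.\<close>

lemma measure_outside_coordinate_box:
  assumes "prob_space M" and X: "\<And>k. (\<lambda>\<omega>. X \<omega> k) \<in> borel_measurable M"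
    and int: "\<And>k. integrable M (\<lambda>\<omega>. (X \<omega> k)\<^sup>2)"
    and bound: "\<And>k. (\<integral>\<omega>. (X \<omega> k)\<^sup>2 \<partial>M) \<le> C k" and C: "\<And>k. C k > (0 :: real)" and e: "e > 0"
  shows "{\<omega> \<in> space M. X \<omega> \<notin> coordinate_box (\<lambda>k. sqrt (C k * 2 ^ Suc k / e))} \<in> sets M"
    and "measure M {\<omega> \<in> space M. X \<omega> \<notin> coordinate_box (\<lambda>k. sqrt (C k * 2 ^ Suc k / e))} \<le> e"
proof -
  interpret prob_space M by fact
  define a where "a k = C k * 2 ^ Suc k / e" for k
  have a: "a k > 0" for k using C e by (simp add: a_def)
  define A where "A k = {\<omega> \<in> space M. a k \<le> (X \<omega> k)\<^sup>2}" for k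
  have A: "A k \<in> sets M" for k unfolding A_def using X[of k] by measurable
  have mA: "measure M (A k) \<le> e * (1 / 2) ^ Suc k" for k
  proof -
    have "measure M (A k) \<le> (\<integral>\<omega>. (X \<omega> k)\<^sup>2 \<partial>M) / a k"
      unfolding A_def by (rule integral_Markov_inequality_measure[OF int, of "{}"]) (auto simp: a)
    also have "\<dots> \<le> C k / a k" using bound a[of k] by (intro divide_right_mono) auto
    also have "\<dots> = e * (1 / 2) ^ Suc k" using C[of k] e by (simp add: a_def power_divide)
    finally show ?thesis .
  qed
  have geo: "(\<lambda>k. e * (1 / 2) ^ Suc k) sums e"
    using sums_mult[OF power_half_series, of e] by simp
  have out: "{\<omega> \<in> space M. X \<omega> \<notin> coordinate_box (\<lambda>k. sqrt (a k))} =
      {\<omega> \<in> space M. \<exists>k. sqrt (a k) < \<bar>X \<omega> k\<bar>}"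
    by (auto simp: coordinate_box_def not_le)
  show meas: "{\<omega> \<in> space M. X \<omega> \<notin> coordinate_box (\<lambda>k. sqrt (C k * 2 ^ Suc k / e))} \<in> sets M"
    unfolding a_def[symmetric] out using X by measurable
  have "{\<omega> \<in> space M. \<exists>k. sqrt (a k) < \<bar>X \<omega> k\<bar>} \<subseteq> (\<Union>k. A k)"
  proof
    fix \<omega> assume "\<omega> \<in> {\<omega> \<in> space M. \<exists>k. sqrt (a k) < \<bar>X \<omega> k\<bar>}"
    then obtain k where k: "\<omega> \<in> space M" "sqrt (a k) < \<bar>X \<omega> k\<bar>" by blast
    then have "a k < (X \<omega> k)\<^sup>2" using real_less_rsqrt a[of k]
      by (metis abs_ge_zero power2_abs real_sqrt_abs real_sqrt_less_iff)
    then show "\<omega> \<in> (\<Union>k. A k)" using k(1) by (auto simp: A_def intro: less_imp_le)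
  qed
  then have "measure M {\<omega> \<in> space M. \<exists>k. sqrt (a k) < \<bar>X \<omega> k\<bar>} \<le> measure M (\<Union>k. A k)"
    using A by (intro finite_measure_mono) auto
  also have "\<dots> \<le> (\<Sum>k. measure M (A k))"
    using A mA geo
    by (intro finite_measure_subadditive_countably)
      (auto intro: summable_comparison_test'[OF sums_summable[OF geo], of 0])
  also have "\<dots> \<le> (\<Sum>k. e * (1 / 2) ^ Suc k)"
    using mA geo
    by (intro suminf_le) (auto intro: sums_summable summable_comparison_test'[OF sums_summable[OF geo], of 0])
  also have "\<dots> = e" using geo by (simp add: sums_iff)
  finally show "measure M {\<omega> \<in> space M. X \<omega> \<notin> coordinate_box (\<lambda>k. sqrt (C k * 2 ^ Suc k / e))} \<le> e"
    unfolding a_def[symmetric] out .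
qed

lemma expectation_approximation:
  fixes X :: "'a \<Rightarrow> nat \<Rightarrow> real"
  assumes M: "prob_space M" and X: "X \<in> borel_measurable M"
    and f: "f \<in> borel_measurable borel" "\<And>x. \<bar>f x\<bar> \<le> B"
    and h: "h \<in> borel_measurable borel" "\<And>x. \<bar>h x\<bar> \<le> B + e" "\<And>x. x \<in> K \<Longrightarrow> \<bar>f x - h x\<bar> \<le> 2 * e"
    and K: "{\<omega> \<in> space M. X \<omega> \<notin> K} \<in> sets M" "measure M {\<omega> \<in> space M. X \<omega> \<notin> K} \<le> e"
    and e: "0 < e" "e \<le> 1"
  shows "\<bar>(\<integral>\<omega>. f (X \<omega>) \<partial>M) - (\<integral>\<omega>. h (X \<omega>) \<partial>M)\<bar> \<le> (2 * B + 3) * e"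
proof -
  interpret prob_space M by fact
  let ?N = "{\<omega> \<in> space M. X \<omega> \<notin> K}"
  have B: "B \<ge> 0" using f(2)[of undefined] by linarith
  have fX: "integrable M (\<lambda>\<omega>. f (X \<omega>))"
    by (rule integrable_const_bound[where B = B])
      (use f(2) in \<open>auto intro: measurable_compose[OF X f(1)]\<close>)
  have hX: "integrable M (\<lambda>\<omega>. h (X \<omega>))"
    by (rule integrable_const_bound[where B = "B + e"])
      (use h(2) in \<open>auto intro: measurable_compose[OF X h(1)]\<close>)
  have ind: "integrable M (\<lambda>\<omega>. indicator ?N \<omega> :: real)"
    using K(1) by (simp add: integrable_indicator_iff emeasure_finite less_top[symmetric])
  have "\<bar>(\<integral>\<omega>. f (X \<omega>) \<partial>M) - (\<integral>\<omega>. h (X \<omega>) \<partial>M)\<bar> = \<bar>\<integral>\<omega>. f (X \<omega>) - h (X \<omega>) \<partial>M\<bar>"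
    using fX hX by (simp add: Bochner_Integration.integral_diff)
  also have "\<dots> \<le> (\<integral>\<omega>. \<bar>f (X \<omega>) - h (X \<omega>)\<bar> \<partial>M)"
    by (rule integral_abs_bound)
  also have "\<dots> \<le> (\<integral>\<omega>. 2 * e + (2 * B + e) * indicator ?N \<omega> \<partial>M)"
  proof (rule integral_mono)
    fix \<omega> assume \<omega>: "\<omega> \<in> space M"
    show "\<bar>f (X \<omega>) - h (X \<omega>)\<bar> \<le> 2 * e + (2 * B + e) * indicator ?N \<omega>"
    proof (cases "X \<omega> \<in> K")
      case True
      then show ?thesis using h(3) by simp
    next
      case False
      then show ?thesis using f(2)[of "X \<omega>"] h(2)[of "X \<omega>"] \<omega> e by simp
    qed
  qed (use fX hX ind in \<open>auto intro!: Bochner_Integration.integrable_diff integrable_abs Bochner_Integration.integrable_add integrable_mult_right\<close>)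
  also have "\<dots> = 2 * e + (2 * B + e) * measure M ?N"
    using ind K(1) by (simp add: Bochner_Integration.integral_add prob_space)
  also have "\<dots> \<le> 2 * e + (2 * B + 1) * e"
    using K(2) B e by (intro add_mono mult_mono) auto
  finally show ?thesis by (simp add: algebra_simps)
qed

text \<open>Cosine and sine of a finite linear combination are the real and imaginary parts of its characteristic
function, and convergence passes to linear combinations.\<close>

lemma converges_trig_poly:
  fixes X :: "nat \<Rightarrow> 'a \<Rightarrow> nat \<Rightarrow> real" and Y :: "'b \<Rightarrow> nat \<Rightarrow> real"
  assumes M: "\<And>n. prob_space (M n)" and N: "prob_space N"
    and X: "\<And>n. X n \<in> borel_measurable (M n)" and Y: "Y \<in> borel_measurable N"
    and char: "\<And>m t. (\<lambda>n. \<integral>\<omega>. iexp (\<Sum>k<m. t k * X n \<omega> k) \<partial>M n)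
        \<longlonglongrightarrow> (\<integral>\<omega>. iexp (\<Sum>k<m. t k * Y \<omega> k) \<partial>N)"
    and f: "trig_poly f"
  shows "(\<lambda>n. \<integral>\<omega>. f (X n \<omega>) \<partial>M n) \<longlonglongrightarrow> (\<integral>\<omega>. f (Y \<omega>) \<partial>N)"
proof -
  have meas: "g \<in> borel_measurable borel" if "continuous_on UNIV g" for g :: "(nat \<Rightarrow> real) \<Rightarrow> real"
    using that by (rule borel_measurable_continuous_onI)
  have int: "integrable P (\<lambda>\<omega>. g (Z \<omega>))"
    if tg: "trig_poly g" and P: "prob_space P" and Z: "Z \<in> borel_measurable P" for g and P :: "'c measure" and Z
  proof -
    interpret P: prob_space P by (rule P)
    obtain B where B: "\<And>x. \<bar>g x\<bar> \<le> B" using bounded_trig_poly[OF tg] by blast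
    show ?thesis
      by (rule P.integrable_const_bound[where B = B])
        (use B in \<open>auto intro: measurable_compose[OF Z meas[OF continuous_trig_poly[OF tg]]]\<close>)
  qed
  have lin: "(\<lambda>n. \<integral>\<omega>. cos (F (X n \<omega>)) \<partial>M n) \<longlonglongrightarrow> (\<integral>\<omega>. cos (F (Y \<omega>)) \<partial>N)"
    "(\<lambda>n. \<integral>\<omega>. sin (F (X n \<omega>)) \<partial>M n) \<longlonglongrightarrow> (\<integral>\<omega>. sin (F (Y \<omega>)) \<partial>N)" if F: "finite_linear F" for F
  proof -
    have i: "integrable P (\<lambda>\<omega>. iexp (F (Z \<omega>)))"
      if P: "prob_space P" "Z \<in> borel_measurable P" for P :: "'c measure" and Z
    proof -
      interpret P: prob_space P by (rule P(1))
      have "(\<lambda>\<omega>. F (Z \<omega>)) \<in> borel_measurable P"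
        by (rule measurable_compose[OF P(2) meas[OF continuous_finite_linear[OF F]]])
      then show ?thesis
        by (intro P.integrable_const_bound[where B = 1]) auto
    qed
    have ReP: "Re (\<integral>\<omega>. iexp (F (Z \<omega>)) \<partial>P) = (\<integral>\<omega>. cos (F (Z \<omega>)) \<partial>P)"
      and ImP: "Im (\<integral>\<omega>. iexp (F (Z \<omega>)) \<partial>P) = (\<integral>\<omega>. sin (F (Z \<omega>)) \<partial>P)"
      if P: "prob_space P" "Z \<in> borel_measurable P" for P :: "'c measure" and Z
      using i[OF P] by (simp_all flip: integral_Re integral_Im add: Re_exp Im_exp)
    have c: "(\<lambda>n. \<integral>\<omega>. iexp (F (X n \<omega>)) \<partial>M n) \<longlonglongrightarrow> (\<integral>\<omega>. iexp (F (Y \<omega>)) \<partial>N)"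
      using F char unfolding finite_linear_def by auto
    show "(\<lambda>n. \<integral>\<omega>. cos (F (X n \<omega>)) \<partial>M n) \<longlonglongrightarrow> (\<integral>\<omega>. cos (F (Y \<omega>)) \<partial>N)"
      using tendsto_Re[OF c] M N X Y by (simp add: ReP)
    show "(\<lambda>n. \<integral>\<omega>. sin (F (X n \<omega>)) \<partial>M n) \<longlonglongrightarrow> (\<integral>\<omega>. sin (F (Y \<omega>)) \<partial>N)"
      using tendsto_Im[OF c] M N X Y by (simp add: ImP)
  qed
  from f show ?thesis
  proof (induction rule: trig_poly.induct)
    case (add f g)
    have "(\<integral>\<omega>. f (X n \<omega>) + g (X n \<omega>) \<partial>M n) = (\<integral>\<omega>. f (X n \<omega>) \<partial>M n) + (\<integral>\<omega>. g (X n \<omega>) \<partial>M n)" for n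
      by (rule Bochner_Integration.integral_add[OF int[OF add.hyps(1) M X] int[OF add.hyps(2) M X]])
    moreover have "(\<integral>\<omega>. f (Y \<omega>) + g (Y \<omega>) \<partial>N) = (\<integral>\<omega>. f (Y \<omega>) \<partial>N) + (\<integral>\<omega>. g (Y \<omega>) \<partial>N)"
      by (rule Bochner_Integration.integral_add[OF int[OF add.hyps(1) N Y] int[OF add.hyps(2) N Y]])
    ultimately show ?case using tendsto_add[OF add.IH] by simp
  next
    case (scale f c)
    then show ?case by (simp add: tendsto_mult_left)
  qed (auto intro: lin)
qed

text \<open>The choice of the compact box depends only on the bounds for the second moments and is thus the same
for all \<open>n\<close> and for the limit. Outside the box, test function and trigonometric polynomial are both
bounded, and the probability is small.\<close>

theorem converges_in_distribution_sequence:
  fixes X :: "nat \<Rightarrow> 'a \<Rightarrow> nat \<Rightarrow> real" and Y :: "'b \<Rightarrow> nat \<Rightarrow> real"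
  assumes M: "\<And>n. prob_space (M n)" and N: "prob_space N"
    and X: "\<And>n. X n \<in> borel_measurable (M n)" and Y: "Y \<in> borel_measurable N"
    and char: "\<And>m t. (\<lambda>n. \<integral>\<omega>. iexp (\<Sum>k<m. t k * X n \<omega> k) \<partial>M n)
        \<longlonglongrightarrow> (\<integral>\<omega>. iexp (\<Sum>k<m. t k * Y \<omega> k) \<partial>N)"
    and int: "\<And>n k. integrable (M n) (\<lambda>\<omega>. (X n \<omega> k)\<^sup>2)" "\<And>k. integrable N (\<lambda>\<omega>. (Y \<omega> k)\<^sup>2)"
    and bound: "\<And>n k. (\<integral>\<omega>. (X n \<omega> k)\<^sup>2 \<partial>M n) \<le> C k" "\<And>k. (\<integral>\<omega>. (Y \<omega> k)\<^sup>2 \<partial>N) \<le> C k"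
  shows "converges_in_distribution M X N Y"
  unfolding converges_in_distribution_def
proof (intro conjI allI impI)
  fix f :: "(nat \<Rightarrow> real) \<Rightarrow> real"
  assume "continuous_on UNIV f \<and> bounded (range f)"
  then obtain B where f: "continuous_on UNIV f" and B: "\<And>x. \<bar>f x\<bar> \<le> B"
    by (auto simp: bounded_iff)
  have B0: "B \<ge> 0" using B[of undefined] by linarith
  define C' where "C' k = max 1 (C k)" for k
  have C': "C' k > 0" "C k \<le> C' k" for k by (auto simp: C'_def)
  have fm: "f \<in> borel_measurable borel" using f by (rule borel_measurable_continuous_onI)
  show "(\<lambda>n. \<integral>\<omega>. f (X n \<omega>) \<partial>M n) \<longlonglongrightarrow> (\<integral>\<omega>. f (Y \<omega>) \<partial>N)"
  proof (rule LIMSEQ_I)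
    fix r :: real assume r: "r > 0"
    \<comment> \<open>Replacing \<open>f\<close> by \<open>h\<close> costs at most \<open>r / 4\<close> on each side, and so does the convergence for \<open>h\<close>.\<close>
    define e where "e = min 1 (r / (4 * (2 * B + 3)))"
    have e: "0 < e" "e \<le> 1" using r B0 by (auto simp: e_def)
    have "(2 * B + 3) * e \<le> (2 * B + 3) * (r / (4 * (2 * B + 3)))"
      using B0 by (intro mult_left_mono) (auto simp: e_def)
    also have "\<dots> = r / 4" using B0 by (simp add: divide_simps)
    finally have er: "(2 * B + 3) * e \<le> r / 4" .
    let ?K = "coordinate_box (\<lambda>k. sqrt (C' k * 2 ^ Suc k / e))"
    obtain h where h: "trig_poly h" "\<And>x. x \<in> ?K \<Longrightarrow> \<bar>f x - h x\<bar> \<le> 2 * e" "\<And>x. \<bar>h x\<bar> \<le> B + e"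
      using trig_poly_approximation[OF compact_coordinate_box f B e(1)] by metis
    have hm: "h \<in> borel_measurable borel"
      using continuous_trig_poly[OF h(1)] by (rule borel_measurable_continuous_onI)
    have XK: "\<bar>(\<integral>\<omega>. f (X n \<omega>) \<partial>M n) - (\<integral>\<omega>. h (X n \<omega>) \<partial>M n)\<bar> \<le> (2 * B + 3) * e" for n
    proof (rule expectation_approximation[OF M X fm B hm h(3,2) _ _ e])
      show "{\<omega> \<in> space (M n). X n \<omega> \<notin> ?K} \<in> sets (M n)"
        "measure (M n) {\<omega> \<in> space (M n). X n \<omega> \<notin> ?K} \<le> e"
        by (rule measure_outside_coordinate_box[OF M measurable_product_then_coordinatewise[OF X] int(1)
            order_trans[OF bound(1) C'(2)] C'(1) e(1)])+
    qed
    have YK: "\<bar>(\<integral>\<omega>. f (Y \<omega>) \<partial>N) - (\<integral>\<omega>. h (Y \<omega>) \<partial>N)\<bar> \<le> (2 * B + 3) * e"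
    proof (rule expectation_approximation[OF N Y fm B hm h(3,2) _ _ e])
      show "{\<omega> \<in> space N. Y \<omega> \<notin> ?K} \<in> sets N" "measure N {\<omega> \<in> space N. Y \<omega> \<notin> ?K} \<le> e"
        by (rule measure_outside_coordinate_box[OF N measurable_product_then_coordinatewise[OF Y] int(2)
            order_trans[OF bound(2) C'(2)] C'(1) e(1)])+
    qed
    have lim: "(\<lambda>n. \<integral>\<omega>. h (X n \<omega>) \<partial>M n) \<longlonglongrightarrow> (\<integral>\<omega>. h (Y \<omega>) \<partial>N)"
      by (rule converges_trig_poly[OF M N X Y char h(1)])
    obtain n0 where n0: "\<And>n. n \<ge> n0 \<Longrightarrow>
        \<bar>(\<integral>\<omega>. h (X n \<omega>) \<partial>M n) - (\<integral>\<omega>. h (Y \<omega>) \<partial>N)\<bar> < r / 4"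
      using LIMSEQ_D[OF lim, of "r / 4"] r unfolding real_norm_def by auto
    have "\<bar>(\<integral>\<omega>. f (X n \<omega>) \<partial>M n) - (\<integral>\<omega>. f (Y \<omega>) \<partial>N)\<bar> < r" if "n \<ge> n0" for n
      using XK[of n] YK n0[OF that] er r by linarith
    then show "\<exists>no. \<forall>n\<ge>no. norm ((\<integral>\<omega>. f (X n \<omega>) \<partial>M n) - (\<integral>\<omega>. f (Y \<omega>) \<partial>N)) < r"
      by auto
  qed
qed (use X Y in auto)

section \<open>The joint limit of the block counts\<close>

lemma sum_list_eq_sum_count:
  fixes s :: "nat \<Rightarrow> real"
  assumes "\<And>l. l \<notin> A \<Longrightarrow> s l = 0" "finite A"
  shows "(\<Sum>l\<leftarrow>ls. s l) = (\<Sum>l\<in>A. s l * real (count_list ls l))"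
proof (induction ls)
  case (Cons x ls)
  have "(\<Sum>l\<in>A. s l * real (count_list (x # ls) l)) =
      (\<Sum>l\<in>A. s l * real (count_list ls l) + (if l = x then s x else 0))"
    by (intro sum.cong refl) (simp add: algebra_simps)
  also have "\<dots> = (\<Sum>l\<in>A. s l * real (count_list ls l)) + s x"
    using assms by (simp add: sum.distrib sum.delta)
  finally show ?case using Cons by simp
qed simp

text \<open>Sequences in the limit theorem are indexed from 0, block lengths from 1.\<close>

definition shifted_weights :: "nat \<Rightarrow> (nat \<Rightarrow> real) \<Rightarrow> nat \<Rightarrow> real" where
  "shifted_weights m t l = (if 1 \<le> l \<and> l \<le> m then t (l - 1) else 0)"

lemma sum_shifted_weights:
  "(\<Sum>l=1..m. shifted_weights m t l * f l) = (\<Sum>k<m. t k * f (Suc k))"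
proof -
  have "(\<Sum>l=1..m. shifted_weights m t l * f l) = (\<Sum>k<m. shifted_weights m t (Suc k) * f (Suc k))"
    using sum.atLeast1_atMost_eq[of "\<lambda>l. shifted_weights m t l * f l" m] by simp
  also have "\<dots> = (\<Sum>k<m. t k * f (Suc k))"
    by (intro sum.cong refl) (simp add: shifted_weights_def)
  finally show ?thesis .
qed

lemma sum_normalized_blocks:
  assumes "xs \<in> games n"
  shows "(\<Sum>k<m. t k * normalized_blocks n xs k) = centred m n (shifted_weights m t) xs / sqrt (real n)"
proof -
  let ?c = "\<lambda>l. real (count_list (block_lengths (map snd xs)) l)"
  have "normalized_blocks n xs k = (?c (Suc k) - real n * block_freq (Suc k)) / sqrt (real n)" for k
    unfolding normalized_blocks_def Let_def num_blocks_eq_count(1)[OF assms] block_freq_falling[symmetric]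
    by simp
  then have "(\<Sum>k<m. t k * normalized_blocks n xs k) =
      (\<Sum>k<m. t k * (?c (Suc k) - real n * block_freq (Suc k))) / sqrt (real n)"
    by (simp add: sum_divide_distrib)
  also have "(\<Sum>k<m. t k * (?c (Suc k) - real n * block_freq (Suc k))) =
      (\<Sum>l=1..m. shifted_weights m t l * (?c l - real n * block_freq l))"
    by (rule sum_shifted_weights[symmetric])
  also have "\<dots> = (\<Sum>l=1..m. shifted_weights m t l * ?c l)
      - real n * (\<Sum>l=1..m. block_freq l * shifted_weights m t l)"
    by (simp add: right_diff_distrib sum_subtractf sum_distrib_left mult_ac)
  also have "\<dots> = centred m n (shifted_weights m t) xs"
    unfolding centred_def block_sum_def freq_sum_def
    by (subst sum_list_eq_sum_count[of "{1..m}"]) (auto simp: shifted_weights_def)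
  finally show ?thesis .
qed

lemma cov_form_shifted_weights:
  "cov_form m (shifted_weights m t) (shifted_weights m t) =
    (\<Sum>i<m. \<Sum>j<m. t i * t j * block_cov (Suc i) (Suc j))"
proof -
  let ?s = "shifted_weights m t"
  have "cov_form m ?s ?s = (\<Sum>i=1..m. ?s i * (\<Sum>j=1..m. ?s j * block_cov i j))"
    by (simp add: cov_form_def sum_distrib_left mult.assoc)
  also have "\<dots> = (\<Sum>i<m. t i * (\<Sum>j<m. t j * block_cov (Suc i) (Suc j)))"
    unfolding sum_shifted_weights ..
  finally show ?thesis by (simp add: sum_distrib_left mult.assoc)
qed

lemma char_normalized_blocks:
  "(\<lambda>n. game_expectation n (\<lambda>xs. iexp (\<Sum>k<m. t k * normalized_blocks n xs k)))
    \<longlonglongrightarrow> complex_of_real (exp (- (\<Sum>i<m. \<Sum>j<m. t i * t j * block_cov (Suc i) (Suc j)) / 2))"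
proof -
  have "game_expectation n (\<lambda>xs. iexp (\<Sum>k<m. t k * normalized_blocks n xs k)) =
      game_expectation n (\<lambda>xs. iexp (centred m n (shifted_weights m t) xs / sqrt (real n)))" for n
    by (rule game_expectation_cong) (simp only: sum_normalized_blocks)
  then show ?thesis
    using charf_clt[of m "shifted_weights m t"]
    by (simp only: cov_form_shifted_weights) (simp add: shifted_weights_def)
qed

text \<open>A limit of characteristic functions is bounded by 1 in modulus, so the exponent must be nonpositive.\<close>

lemma psd_kernel_block_cov: "psd_kernel (\<lambda>i j. block_cov (Suc i) (Suc j))"
  unfolding psd_kernel_def
proof (intro conjI allI)
  show "block_cov (Suc i) (Suc j) = block_cov (Suc j) (Suc i)" for i j
    by (simp add: block_cov_def add.commute mult.commute)
  fix m and t :: "nat \<Rightarrow> real"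
  let ?q = "\<Sum>i<m. \<Sum>j<m. t i * t j * block_cov (Suc i) (Suc j)"
  have "cmod (game_expectation n (\<lambda>xs. iexp (\<Sum>k<m. t k * normalized_blocks n xs k))) \<le> 1" for n
  proof -
    have "cmod (game_expectation n (\<lambda>xs. iexp (\<Sum>k<m. t k * normalized_blocks n xs k)))
        \<le> game_expectation n (\<lambda>xs. cmod (iexp (\<Sum>k<m. t k * normalized_blocks n xs k)))"
      by (rule integral_norm_bound)
    then show ?thesis by (simp only: norm_exp_i_times) simp
  qed
  then have "cmod (complex_of_real (exp (- ?q / 2))) \<le> 1"
    by (intro tendsto_upperbound[OF tendsto_norm[OF char_normalized_blocks]]) auto
  then show "0 \<le> ?q" by simp
qed

lemma second_moment_normalized_blocks:
  "game_expectation n (\<lambda>xs. (normalized_blocks n xs k)\<^sup>2) \<le> 2 * ((real (Suc k) + 1)\<^sup>2 + 20)"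
proof -
  define C where "C = (real (Suc k) + 1)\<^sup>2 + 20"
  define s where "s = shifted_weights (Suc k) (\<lambda>j. if j = k then 1 else 0)"
  have C: "C \<ge> 0" by (simp add: C_def)
  have w: "weights (Suc k) 1 s" by (auto simp: weights_def s_def shifted_weights_def)
  have "normalized_blocks n xs k = centred (Suc k) n s xs / sqrt (real n)" if "xs \<in> games n" for xs
    unfolding s_def sum_normalized_blocks[OF that, symmetric] by simp
  then have "game_expectation n (\<lambda>xs. (normalized_blocks n xs k)\<^sup>2) =
      game_expectation n (\<lambda>xs. (centred (Suc k) n s xs)\<^sup>2 / real n)"
    by (intro game_expectation_cong) (simp add: power_divide)
  also have "\<dots> = game_expectation n (\<lambda>xs. (centred (Suc k) n s xs)\<^sup>2) / real n" by simp
  also have "\<dots> \<le> C * (real n + 1) / real n"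
    using second_moment_bound[OF w, of n] by (intro divide_right_mono) (simp_all add: C_def)
  also have "\<dots> \<le> 2 * C"
  proof (cases "n = 0")
    case False
    then have "C * (real n + 1) \<le> C * (2 * real n)" using C by (intro mult_left_mono) auto
    then show ?thesis using False by (simp add: divide_le_eq)
  qed (use C in simp)
  finally show ?thesis by (simp add: C_def)
qed

theorem theorem1:
  shows "\<exists>(N :: (nat \<Rightarrow> real) measure) (W :: nat \<Rightarrow> (nat \<Rightarrow> real) \<Rightarrow> real).
    prob_space N \<and>
    jointly_gaussian N {1..} W \<and>
    (\<forall>i\<ge>1. (\<integral>\<omega>. W i \<omega> \<partial>N) = 0) \<and>
    (\<forall>i\<ge>1. \<forall>j\<ge>1. covariance N (W i) (W j) = block_cov i j) \<and>
    converges_in_distribution (\<lambda>n. measure_pmf (random_game n)) normalized_blocks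
      N (\<lambda>\<omega> k. W (Suc k) \<omega>)"
proof -
  obtain L :: "nat \<Rightarrow> nat \<Rightarrow> real" where L0: "\<And>i l. i < l \<Longrightarrow> L i l = 0"
    and LL: "\<And>i j m. i < m \<Longrightarrow> block_cov (Suc i) (Suc j) = (\<Sum>l<m. L i l * L j l)"
    using psd_kernel_cholesky[OF psd_kernel_block_cov] by blast
  define W where "W i = coordinate_sum i (L (i - 1))" for i
  have W: "W i \<omega> = coordinate_sum m (L (i - 1)) \<omega>" if "1 \<le> i" "i \<le> m" for i m \<omega>
    unfolding W_def coordinate_sum_def
    using that L0 by (intro sum.mono_neutral_left) auto
  have lin: "(\<Sum>i\<in>J. c i * W i \<omega>) = coordinate_sum m (\<lambda>l. \<Sum>i\<in>J. c i * L (i - 1) l) \<omega>"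
    if "J \<subseteq> {1..m}" for J c m \<omega>
  proof -
    have "(\<Sum>i\<in>J. c i * W i \<omega>) = (\<Sum>i\<in>J. \<Sum>l<m. c i * L (i - 1) l * \<omega> l)"
      using that W[of _ m] by (intro sum.cong refl) (auto simp: coordinate_sum_def sum_distrib_left mult.assoc)
    also have "\<dots> = (\<Sum>l<m. \<Sum>i\<in>J. c i * L (i - 1) l * \<omega> l)" by (rule sum.swap)
    finally show ?thesis by (simp add: coordinate_sum_def sum_distrib_right)
  qed
  have joint: "jointly_gaussian white_noise {1..} W"
    unfolding jointly_gaussian_def
  proof (intro allI impI)
    fix J :: "nat set" and c :: "nat \<Rightarrow> real"
    assume J: "finite J \<and> J \<subseteq> {1..}"
    then have sub: "J \<subseteq> {1..\<Sum>J}" by (auto intro: member_le_sum[of _ J "\<lambda>i. i", simplified])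
    have eq: "(\<lambda>\<omega>. \<Sum>i\<in>J. c i * W i \<omega>) = coordinate_sum (\<Sum>J) (\<lambda>l. \<Sum>i\<in>J. c i * L (i - 1) l)"
      by (intro ext lin[OF sub])
    show "gaussian white_noise (\<lambda>\<omega>. \<Sum>i\<in>J. c i * W i \<omega>)"
      unfolding eq by (rule gaussian_coordinate_sum)
  qed
  have mean: "(\<integral>\<omega>. W i \<omega> \<partial>white_noise) = 0" for i
    unfolding W_def by (rule coordinate_sum_moments)
  have prod: "(\<integral>\<omega>. W i \<omega> * W j \<omega> \<partial>white_noise) = block_cov i j" if "1 \<le> i" "1 \<le> j" for i j
  proof -
    have "(\<integral>\<omega>. W i \<omega> * W j \<omega> \<partial>white_noise) = (\<Sum>l<i + j. L (i - 1) l * L (j - 1) l)"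
      using that by (simp add: W[of _ "i + j"] coordinate_sum_moments)
    also have "\<dots> = block_cov i j" using LL[of "i - 1" "i + j" "j - 1"] that by simp
    finally show ?thesis .
  qed
  have cov: "covariance white_noise (W i) (W j) = block_cov i j" if "1 \<le> i" "1 \<le> j" for i j
    unfolding covariance_def mean using prod[OF that] by simp
  have char: "(\<integral>\<omega>. iexp (\<Sum>k<m. t k * W (Suc k) \<omega>) \<partial>white_noise) =
      complex_of_real (exp (- (\<Sum>i<m. \<Sum>j<m. t i * t j * block_cov (Suc i) (Suc j)) / 2))" for m t
  proof -
    define b where "b l = (\<Sum>k<m. t k * L k l)" for l
    have "(\<Sum>k<m. t k * W (Suc k) \<omega>) = coordinate_sum m b \<omega>" for \<omega>
    proof -
      have "(\<Sum>k<m. t k * W (Suc k) \<omega>) = (\<Sum>k<m. \<Sum>l<m. t k * L k l * \<omega> l)"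
        using W[of _ m] by (intro sum.cong refl) (auto simp: coordinate_sum_def sum_distrib_left mult.assoc)
      also have "\<dots> = (\<Sum>l<m. \<Sum>k<m. t k * L k l * \<omega> l)" by (rule sum.swap)
      finally show ?thesis by (simp add: coordinate_sum_def b_def sum_distrib_right)
    qed
    moreover have "(\<Sum>l<m. (b l)\<^sup>2) = (\<Sum>i<m. \<Sum>j<m. t i * t j * block_cov (Suc i) (Suc j))"
    proof -
      have "(\<Sum>l<m. (b l)\<^sup>2) = (\<Sum>l<m. \<Sum>i<m. \<Sum>j<m. t i * t j * (L i l * L j l))"
        by (simp add: b_def power2_eq_square sum_product mult_ac)
      also have "\<dots> = (\<Sum>i<m. \<Sum>j<m. \<Sum>l<m. t i * t j * (L i l * L j l))"
        by (subst sum.swap) (intro sum.cong refl sum.swap)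
      also have "\<dots> = (\<Sum>i<m. \<Sum>j<m. t i * t j * block_cov (Suc i) (Suc j))"
        by (intro sum.cong refl) (simp add: LL[of _ m] sum_distrib_left)
      finally show ?thesis .
    qed
    ultimately show ?thesis by (simp only: char_coordinate_sum)
  qed
  have "converges_in_distribution (\<lambda>n. measure_pmf (random_game n)) normalized_blocks
      white_noise (\<lambda>\<omega> k. W (Suc k) \<omega>)"
  proof (rule converges_in_distribution_sequence)
    show "prob_space (measure_pmf (random_game n))" for n by (rule measure_pmf.prob_space_axioms)
    show "prob_space white_noise" by (rule prob_space_white_noise)
    show "normalized_blocks n \<in> borel_measurable (measure_pmf (random_game n))" for n by simp
    show "(\<lambda>\<omega> k. W (Suc k) \<omega>) \<in> borel_measurable white_noise"
      by (rule measurable_coordinatewise_then_product)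
        (use measurable_coordinate_sum in \<open>simp add: W_def\<close>)
    show "(\<lambda>n. \<integral>xs. iexp (\<Sum>k<m. t k * normalized_blocks n xs k) \<partial>measure_pmf (random_game n))
        \<longlonglongrightarrow> (\<integral>\<omega>. iexp (\<Sum>k<m. t k * W (Suc k) \<omega>) \<partial>white_noise)" for m t
      unfolding char by (rule char_normalized_blocks)
    show "integrable (measure_pmf (random_game n)) (\<lambda>xs. (normalized_blocks n xs k)\<^sup>2)" for n k
      by (rule integrable_random_game)
    show "integrable white_noise (\<lambda>\<omega>. (W (Suc k) \<omega>)\<^sup>2)" for k
      unfolding W_def power2_eq_square by (rule coordinate_sum_moments)
    let ?C = "\<lambda>k. max (2 * ((real (Suc k) + 1)\<^sup>2 + 20)) (block_cov (Suc k) (Suc k))"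
    show "(\<integral>xs. (normalized_blocks n xs k)\<^sup>2 \<partial>measure_pmf (random_game n)) \<le> ?C k" for n k
      using second_moment_normalized_blocks[of n k] by linarith
    show "(\<integral>\<omega>. (W (Suc k) \<omega>)\<^sup>2 \<partial>white_noise) \<le> ?C k" for k
      unfolding power2_eq_square using prod[of "Suc k" "Suc k"] by simp
  qed
  then show ?thesis
    using prob_space_white_noise joint mean cov by blast
qed

end
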